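(* Let $k$ be a fixed positive integer. There exists a randomized algorithm running in $\tilde{O}(mn + n^{k/2 + 1})$ time that, with high probability, computes a $\left(2 - \frac{1}{2k-1}, 1 - \frac{1}{2k-1}\right)$-approximation to the $k$-center of any unweighted, undirected graph with $n$ vertices and $m$ edges.
   Context: $G=(V,E)$ is an undirected unweighted graph with $n$ vertices and $m\ge n-1$ edges, $d$ its shortest-path distance. $R_k(G)=\min_{C\subseteq V,|C|=k}\max_{v\in V} d(v,C)$ with $d(v,C)=\min_{c\in C}d(v,c)$ (the $k$-radius). An $(\alpha,\beta)$-approximation to the $k$-center is a value $\tilde R$ (witnessed by $k$ vertices covering all vertices within distance $\tilde R$) with $R_k(G)\le \tilde R\le \alpha R_k(G)+\beta$. $\tilde O$ hides polylogarithmic factors; "with high probability" means with probability at least $1-1/n^{c}$ for a constant $c>0$. *)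

theory Defs
  imports "HOL-Probability.Probability" "HOL-Library.Log_Nat"
begin

section \<open>Graphs and the k-center problem\<close>

text \<open>Graphs have vertex set \<open>{..<n}\<close>; they need not be connected, so distances are extended
  naturals, with \<open>\<infinity>\<close> (the infimum of the empty set) between different components.\<close>

definition simple_graph :: "nat \<Rightarrow> nat set set \<Rightarrow> bool" where
  "simple_graph n E \<longleftrightarrow> (\<forall>e\<in>E. \<exists>u v. e = {u, v} \<and> u \<noteq> v \<and> u < n \<and> v < n)"

definition walk :: "nat set set \<Rightarrow> nat list \<Rightarrow> bool" where
  "walk E p \<longleftrightarrow> p \<noteq> [] \<and> successively (\<lambda>u v. {u, v} \<in> E) p"

definition gdist :: "nat set set \<Rightarrow> nat \<Rightarrow> nat \<Rightarrow> enat" where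
  "gdist E u v = (INF p\<in>{p. walk E p \<and> hd p = u \<and> last p = v}. enat (length p - 1))"

definition set_gdist :: "nat set set \<Rightarrow> nat \<Rightarrow> nat set \<Rightarrow> enat" where
  "set_gdist E v C = (INF c\<in>C. gdist E v c)"

definition k_radius :: "nat \<Rightarrow> nat set set \<Rightarrow> nat \<Rightarrow> enat" where
  "k_radius n E k = (INF C\<in>{C. C \<subseteq> {..<n} \<and> card C = k}. SUP v\<in>{..<n}. set_gdist E v C)"

definition k_center_approx ::
  "real \<Rightarrow> real \<Rightarrow> nat \<Rightarrow> nat set set \<Rightarrow> nat \<Rightarrow> enat \<Rightarrow> nat set \<Rightarrow> bool" where
  "k_center_approx \<alpha> \<beta> n E k R C \<longleftrightarrow>
     C \<subseteq> {..<n} \<and> card C = k \<and> (\<forall>v<n. set_gdist E v C \<le> R) \<and>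
     k_radius n E k \<le> R \<and>
     ereal_of_enat R \<le> ereal \<alpha> * ereal_of_enat (k_radius n E k) + ereal \<beta>"

section \<open>Randomized word RAM\<close>

text \<open>Programs act on registers and on a random-access memory, both holding \<open>w\<close>-bit words;
  arithmetic is modulo \<open>2 ^ w\<close>. Every instruction, and every evaluation of a branch or loop
  condition (register nonzero), takes one step.\<close>

datatype binop = OpAdd | OpSub | OpMul | OpDiv | OpMod | OpLess | OpEq

datatype instr =
    Const nat nat
  | Move nat nat
  | Bin binop nat nat nat
  | Load nat nat
  | Store nat nat
  | Rand nat
  | Cond nat "instr list" "instr list"
  | While nat "instr list"

record ram_state =
  reg :: "nat \<Rightarrow> nat"
  mem :: "nat \<Rightarrow> nat"

text \<open>A configuration consists of the instructions still to be executed and the state.\<close>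

type_synonym config = "instr list \<times> ram_state"

fun eval_op :: "nat \<Rightarrow> binop \<Rightarrow> nat \<Rightarrow> nat \<Rightarrow> nat" where
  "eval_op w OpAdd a b = (a + b) mod 2 ^ w"
| "eval_op w OpSub a b = nat ((int a - int b) mod 2 ^ w)"
| "eval_op w OpMul a b = (a * b) mod 2 ^ w"
| "eval_op w OpDiv a b = a div b"
| "eval_op w OpMod a b = a mod b"
| "eval_op w OpLess a b = of_bool (a < b)"
| "eval_op w OpEq a b = of_bool (a = b)"

definition set_reg :: "nat \<Rightarrow> nat \<Rightarrow> ram_state \<Rightarrow> ram_state" where
  "set_reg x a s = s\<lparr>reg := (reg s)(x := a)\<rparr>"

definition set_mem :: "nat \<Rightarrow> nat \<Rightarrow> ram_state \<Rightarrow> ram_state" where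
  "set_mem i a s = s\<lparr>mem := (mem s)(i := a)\<rparr>"

fun step :: "nat \<Rightarrow> config \<Rightarrow> config pmf" where
  "step w ([], s) = return_pmf ([], s)"
| "step w (Const x a # K, s) = return_pmf (K, set_reg x (a mod 2 ^ w) s)"
| "step w (Move x y # K, s) = return_pmf (K, set_reg x (reg s y) s)"
| "step w (Bin f x y z # K, s) = return_pmf (K, set_reg x (eval_op w f (reg s y) (reg s z)) s)"
| "step w (Load x y # K, s) = return_pmf (K, set_reg x (mem s (reg s y)) s)"
| "step w (Store x y # K, s) = return_pmf (K, set_mem (reg s x) (reg s y) s)"
| "step w (Rand x # K, s) = map_pmf (\<lambda>a. (K, set_reg x a s)) (pmf_of_set {..<2 ^ w})"
| "step w (Cond x A B # K, s) = return_pmf ((if reg s x \<noteq> 0 then A else B) @ K, s)"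
| "step w (While x A # K, s) = return_pmf (if reg s x \<noteq> 0 then A @ While x A # K else K, s)"

definition run :: "nat \<Rightarrow> nat \<Rightarrow> config \<Rightarrow> config pmf" where
  "run w t c = ((\<lambda>p. bind_pmf p (step w)) ^^ t) (return_pmf c)"

definition halted :: "config \<Rightarrow> bool" where
  "halted c \<longleftrightarrow> fst c = []"

section \<open>Input, output and running time\<close>

text \<open>The input is an arbitrary listing of the edges, each once and in arbitrary orientation.\<close>

definition edge_listing :: "nat set set \<Rightarrow> (nat \<times> nat) list \<Rightarrow> bool" where
  "edge_listing E es \<longleftrightarrow>
     distinct (map (\<lambda>(u, v). {u, v}) es) \<and> set (map (\<lambda>(u, v). {u, v}) es) = E"

definition input_state :: "nat \<Rightarrow> (nat \<times> nat) list \<Rightarrow> ram_state" where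
  "input_state n es =
     \<lparr>reg = (\<lambda>_. 0)(0 := n, 1 := length es),
      mem = (\<lambda>i. if i < 2 * length es
                  then (if even i then fst (es ! (i div 2)) else snd (es ! (i div 2))) else 0)\<rparr>"

text \<open>The output value is read off register 0, where the word \<open>0\<close> stands for \<open>\<infinity>\<close> and
  \<open>r + 1\<close> stands for \<open>r\<close>; the centers are read off the first \<open>k\<close> memory cells.\<close>

definition output_value :: "config \<Rightarrow> enat" where
  "output_value c = (case reg (snd c) 0 of 0 \<Rightarrow> \<infinity> | Suc r \<Rightarrow> enat r)"

definition output_centers :: "nat \<Rightarrow> config \<Rightarrow> nat set" where
  "output_centers k c = mem (snd c) ` {..<k}"

text \<open>The polylogarithmic factor is a power of \<open>1 + log 2 n\<close>, so that it does not vanish at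
  \<open>n = 1\<close>.\<close>

definition soft_O :: "(nat \<Rightarrow> nat \<Rightarrow> real) \<Rightarrow> (nat \<Rightarrow> nat \<Rightarrow> nat) set" where
  "soft_O f = {T. \<exists>a b::nat. \<forall>n\<ge>1. \<forall>m.
     real (T n m) \<le> real a * f n m * (1 + log 2 (real n)) ^ b}"

text \<open>The word length is \<open>\<kappa>\<close> times the bit length of \<open>n\<close>; for \<open>\<kappa> \<ge> 2\<close> all input
  words and input addresses fit. The time bound holds for every outcome of the random choices.\<close>

definition solves_k_center_whp ::
  "instr list \<Rightarrow> nat \<Rightarrow> (nat \<Rightarrow> nat \<Rightarrow> nat) \<Rightarrow> real \<Rightarrow> nat \<Rightarrow> real \<Rightarrow> real \<Rightarrow> bool" where
  "solves_k_center_whp P \<kappa> T c k \<alpha> \<beta> \<longleftrightarrow>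
     (\<forall>n E es. simple_graph n E \<and> k \<le> n \<and> n \<le> card E + 1 \<and> edge_listing E es \<longrightarrow>
        (let D = run (\<kappa> * floorlog 2 n) (T n (card E)) (P, input_state n es) in
           (\<forall>cf\<in>set_pmf D. halted cf) \<and>
           measure_pmf.prob D
             {cf. k_center_approx \<alpha> \<beta> n E k (output_value cf) (output_centers k cf)}
             \<ge> 1 - 1 / real n powr c))"

end

theory Submission imports Defs begin

text \<open>
No random choices are needed. Breadth-first search yields all distances and, for every vertex \<open>v\<close>, the row \<open>N v\<close>
of its \<open>q\<close> nearest vertices, where \<open>q\<close> is about \<open>sqrt n\<close>. A greedy set \<open>S\<close> of about \<open>(n / q) * ln n\<close> vertices
hits all these rows; hence a vertex \<open>v\<close> at distance more than \<open>r\<close> from \<open>S\<close> has its whole ball of radius \<open>r\<close>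
inside \<open>N v\<close>.

Binary search guesses the optimal radius \<open>R\<close>. Let \<open>h = R div (2 * k - 1)\<close> and \<open>D = 2 * R - h\<close>, the radius aimed at.
Centers are chosen one after the other. If the optimal centers that are still needed all lie within \<open>R - h\<close> of \<open>S\<close>,
they may be replaced by elements of \<open>S\<close>. Otherwise let \<open>c\<close> be one that does not, covering a vertex \<open>v\<close> at distance
more than \<open>D\<close> from the \<open>i\<close> vertices chosen so far. The point at distance \<open>2 * i * h\<close> from \<open>c\<close> on the way to \<open>v\<close> is
not covered by the optimal centers already approximated, and it is still far from \<open>S\<close>. So the vertex \<open>w\<close> that is
farthest from \<open>S\<close> among the vertices at distance more than \<open>R + (2 * i - 1) * h\<close> from the chosen ones is covered by a
new optimal center \<open>c'\<close>, and \<open>N w\<close> contains a vertex within \<open>(2 * i + 1) * h\<close> of \<open>c'\<close>. In both cases \<open>S \<union> N w\<close>,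
of size about \<open>sqrt n\<close>, contains a suitable next choice.

The last center is found in time about \<open>n * sqrt n\<close>. If some uncovered \<open>w\<close> is at distance more than
\<open>rho = (R - h) div 2\<close> from \<open>S\<close>, then \<open>N w\<close> contains a good choice. Otherwise each uncovered vertex has a
representative in \<open>S\<close> within \<open>rho\<close>, and it suffices to test, for all vertices \<open>u\<close>, whether \<open>u\<close> is within
\<open>R + rho\<close> of these representatives.
\<close>


section \<open>Graph distances\<close>

lemma gdist_attained:
  assumes "gdist E u v = enat r"
  obtains p where "walk E p" "hd p = u" "last p = v" "length p = Suc r"
proof -
  let ?lengths = "(\<lambda>p. enat (length p - 1)) ` {p. walk E p \<and> hd p = u \<and> last p = v}"
  have Inf_eq: "Inf ?lengths = enat r" using assms by (simp add: gdist_def)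
  then have "?lengths \<noteq> {}" unfolding Inf_enat_def by (metis enat.distinct(1))
  then have "Inf ?lengths \<in> ?lengths"
    unfolding Inf_enat_def by (metis (mono_tags, lifting) LeastI ex_in_conv)
  then obtain p where path: "walk E p" "hd p = u" "last p = v" "length p - 1 = r"
    using Inf_eq by auto
  then have "length p = Suc r" by (cases p) (auto simp: walk_def)
  with path that show thesis by blast
qed

lemma gdist_le_walk: "walk E p \<Longrightarrow> gdist E (hd p) (last p) \<le> enat (length p - 1)"
  unfolding gdist_def by (rule INF_lower) auto

lemma gdist_refl [simp]: "gdist E u u = 0"
  using gdist_le_walk[of E "[u]"] by (simp add: walk_def flip: zero_enat_def)

lemma gdist_eq_0: "gdist E u v = 0 \<longleftrightarrow> u = v"
proof
  assume "gdist E u v = 0"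
  then have "gdist E u v = enat 0" by (simp add: zero_enat_def)
  then obtain p where "hd p = u" "last p = v" "length p = Suc 0" by (rule gdist_attained)
  then show "u = v" by (cases p) auto
qed simp

lemma gdist_commute: "gdist E u v = gdist E v u"
proof (rule antisym)
  show "gdist E u v \<le> gdist E v u" for u v
  proof (cases "gdist E v u")
    case (enat r)
    then obtain p where path: "walk E p" "hd p = v" "last p = u" "length p = Suc r"
      by (rule gdist_attained)
    have "walk E (rev p)"
      using path(1) by (auto simp: walk_def successively_rev insert_commute)
    from gdist_le_walk[OF this] show ?thesis
      using path enat by (simp add: hd_rev last_rev)
  qed simp
  then show "gdist E v u \<le> gdist E u v" .
qed

lemma gdist_triangle: "gdist E u x \<le> gdist E u v + gdist E v x"
proof (cases "gdist E u v = \<infinity> \<or> gdist E v x = \<infinity>")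
  case False
  then obtain a b where finite: "gdist E u v = enat a" "gdist E v x = enat b" by auto
  obtain p where path: "walk E p" "hd p = u" "last p = v" "length p = Suc a"
    using finite(1) by (rule gdist_attained)
  obtain p' where path': "walk E p'" "hd p' = v" "last p' = x" "length p' = Suc b"
    using finite(2) by (rule gdist_attained)
  obtain p2 where tail: "p' = v # p2" using path' by (cases p') (auto simp: walk_def)
  have "walk E (p @ p2)" "hd (p @ p2) = u" "last (p @ p2) = x"
    using path path' by (auto simp: tail walk_def successively_append_iff successively_Cons
      split: if_splits)
  then show ?thesis
    using gdist_le_walk[of E "p @ p2"] path path' finite by (simp add: tail)
qed auto

lemma gdist_edge: "{u, v} \<in> E \<Longrightarrow> gdist E u v \<le> 1"
  using gdist_le_walk[of E "[u, v]"] by (simp add: walk_def one_enat_def)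

lemma gdist_1_edge:
  assumes "gdist E u v = enat 1"
  shows "{u, v} \<in> E"
proof -
  obtain p where path: "walk E p" "hd p = u" "last p = v" "length p = Suc (Suc 0)"
    using gdist_attained[OF assms] by auto
  then obtain a b where "p = [a, b]" by (auto simp: length_Suc_conv)
  with path show ?thesis by (simp add: walk_def)
qed

lemma gdist_geodesic:
  assumes "gdist E u v = enat r" "y \<le> r"
  obtains x where "gdist E u x = enat y" "gdist E x v = enat (r - y)"
proof -
  obtain p where path: "walk E p" "hd p = u" "last p = v" "length p = Suc r"
    using assms(1) by (rule gdist_attained)
  define x where "x = p ! y"
  have "walk E (take (Suc y) p)" "hd (take (Suc y) p) = u"
    using path assms(2) by (auto simp: walk_def successively_conv_nth)
  moreover have "last (take (Suc y) p) = x"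
    using path assms(2) by (simp add: x_def take_Suc_conv_app_nth)
  ultimately have near: "gdist E u x \<le> enat y"
    using gdist_le_walk[of E "take (Suc y) p"] path assms(2) by (simp add: min_def split: if_splits)
  have "walk E (drop y p)" "hd (drop y p) = x" "last (drop y p) = v"
    using path assms(2) by (auto simp: x_def walk_def successively_conv_nth hd_drop_conv_nth last_drop)
  then have far: "gdist E x v \<le> enat (r - y)"
    using gdist_le_walk[of E "drop y p"] path by simp
  obtain a b where "gdist E u x = enat a" "gdist E x v = enat b"
    using near far by (metis enat_ile)
  then show thesis
    using near far gdist_triangle[of E u v x] assms by (intro that[of x]) auto
qed

locale finite_graph =
  fixes n :: nat and E :: "nat set set"
  assumes simple: "simple_graph n E" and n_pos: "1 \<le> n"
begin

text \<open>The value \<open>2 * n\<close> stands for \<open>\<infinity>\<close>; it is large enough to keep the triangle inequality.\<close>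

definition d :: "nat \<Rightarrow> nat \<Rightarrow> nat" where
  "d u v = (case gdist E u v of enat r \<Rightarrow> r | \<infinity> \<Rightarrow> 2 * n)"

lemma edge_less: "{u, v} \<in> E \<Longrightarrow> u < n" "{u, v} \<in> E \<Longrightarrow> v < n"
  using simple by (auto simp: simple_graph_def doubleton_eq_iff)

lemma card_edges_le: "card E \<le> n * n"
proof -
  let ?pairs = "{..<n} \<times> {..<n}"
  have "E \<subseteq> (\<lambda>(u, v). {u, v}) ` ?pairs"
    using simple by (fastforce simp: simple_graph_def)
  then have "card E \<le> card ((\<lambda>(u, v). {u, v}) ` ?pairs)" by (intro card_mono) auto
  also have "\<dots> \<le> card ?pairs" by (intro card_image_le) auto
  finally show ?thesis by (simp add: card_cartesian_product)
qed

lemma reachable_less: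
  assumes "u < n" "gdist E u v = enat r"
  shows "v < n"
proof (cases r)
  case 0
  then show ?thesis using assms by (simp add: gdist_eq_0 flip: zero_enat_def)
next
  case (Suc r')
  then obtain x where "gdist E x v = enat 1"
    using gdist_geodesic[OF assms(2), of r'] by auto
  from gdist_1_edge[OF this] show ?thesis by (rule edge_less)
qed

lemma gdist_finite_less:
  assumes "u < n" "gdist E u v = enat r"
  shows "r < n"
proof -
  have "\<forall>y\<in>{..r}. \<exists>x<n. gdist E u x = enat y"
    using assms by (metis atMost_iff gdist_geodesic reachable_less)
  then obtain f where vertex_at: "\<And>y. y \<le> r \<Longrightarrow> f y < n \<and> gdist E u (f y) = enat y"
    by (metis atMost_iff)
  have "inj_on f {..r}"
    by (rule inj_onI) (metis vertex_at atMost_iff enat.inject)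
  moreover have "f ` {..r} \<subseteq> {..<n}" using vertex_at by auto
  ultimately have "card {..r} \<le> card {..<n}" by (metis card_inj_on_le finite_lessThan)
  then show ?thesis by simp
qed

lemma d_self [simp]: "d u u = 0"
  by (simp add: d_def zero_enat_def)

lemma d_eq_0: "d u v = 0 \<longleftrightarrow> u = v"
  using n_pos gdist_eq_0[of E u v] by (auto simp: d_def zero_enat_def split: enat.splits)

lemma d_commute: "d u v = d v u"
  by (simp add: d_def gdist_commute)

lemma d_less_or_inf: "u < n \<Longrightarrow> d u v < n \<or> d u v = 2 * n"
  by (cases "gdist E u v") (auto simp: d_def dest: gdist_finite_less)

lemma d_le_inf: "u < n \<Longrightarrow> d u v \<le> 2 * n"
  using d_less_or_inf[of u v] by auto

lemma d_triangle: "u < n \<Longrightarrow> d u x \<le> d u v + d v x"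
  using gdist_triangle[of E u x v] d_le_inf[of u x]
  by (auto simp: d_def split: enat.splits)

lemma d_geodesic:
  assumes "u < n" "d u v < 2 * n" "y \<le> d u v"
  obtains x where "x < n" "d u x = y" "d x v = d u v - y"
proof (cases "gdist E u v")
  case (enat r)
  then have "y \<le> r" using assms(3) by (simp add: d_def)
  from gdist_geodesic[OF enat this] obtain x
    where "gdist E u x = enat y" "gdist E x v = enat (r - y)" .
  then show thesis using that[of x] reachable_less[OF assms(1)] enat by (simp add: d_def)
qed (use assms in \<open>simp add: d_def\<close>)

lemma d_edge: "{u, v} \<in> E \<Longrightarrow> d u v \<le> 1"
  using gdist_edge[of u v E] by (auto simp: d_def one_enat_def split: enat.splits)

lemma d_predecessor:
  assumes "u < n" "d u v = Suc r" "Suc r < 2 * n"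
  obtains x where "x < n" "d u x = r" "{x, v} \<in> E"
proof -
  obtain x where on_path: "x < n" "d u x = r" "d x v = 1"
    using d_geodesic[of u v r] assms by auto
  then have "gdist E x v = enat 1"
    using n_pos by (cases "gdist E x v") (auto simp: d_def)
  then show thesis using that on_path gdist_1_edge by blast
qed

lemma set_gdist_le_iff:
  assumes "r < 2 * n"
  shows "set_gdist E v C \<le> enat r \<longleftrightarrow> (\<exists>c\<in>C. d v c \<le> r)"
proof -
  have "set_gdist E v C \<le> enat r \<longleftrightarrow> set_gdist E v C < enat (Suc r)"
    by (cases "set_gdist E v C") auto
  also have "\<dots> \<longleftrightarrow> (\<exists>c\<in>C. gdist E v c < enat (Suc r))"
    unfolding set_gdist_def by (rule INF_less_iff)
  also have "\<dots> \<longleftrightarrow> (\<exists>c\<in>C. d v c \<le> r)"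
    using assms by (intro bex_cong refl) (auto simp: d_def split: enat.splits)
  finally show ?thesis .
qed

lemma k_radius_le_iff:
  assumes "r < 2 * n"
  shows "k_radius n E k \<le> enat r \<longleftrightarrow> (\<exists>C\<subseteq>{..<n}. card C = k \<and> (\<forall>v<n. \<exists>c\<in>C. d v c \<le> r))"
proof -
  let ?radius = "\<lambda>C. SUP v\<in>{..<n}. set_gdist E v C"
  have radius_le: "?radius C \<le> enat r \<longleftrightarrow> (\<forall>v<n. \<exists>c\<in>C. d v c \<le> r)" for C
    using set_gdist_le_iff[OF assms] by (auto simp: SUP_le_iff)
  have "k_radius n E k \<le> enat r \<longleftrightarrow> k_radius n E k < enat (Suc r)"
    by (cases "k_radius n E k") auto
  also have "\<dots> \<longleftrightarrow> (\<exists>C\<in>{C. C \<subseteq> {..<n} \<and> card C = k}. ?radius C < enat (Suc r))"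
    unfolding k_radius_def by (rule INF_less_iff)
  also have "\<dots> \<longleftrightarrow> (\<exists>C\<in>{C. C \<subseteq> {..<n} \<and> card C = k}. ?radius C \<le> enat r)"
  proof -
    have "x < enat (Suc r) \<longleftrightarrow> x \<le> enat r" for x by (cases x) auto
    then show ?thesis by simp
  qed
  finally show ?thesis unfolding radius_le by auto
qed

lemma k_radius_less_or_inf: "k_radius n E k < enat n \<or> k_radius n E k = \<infinity>"
proof (cases "k_radius n E k = \<infinity>")
  case False
  then have "k_radius n E k < \<infinity>" by simp
  then obtain C where cover: "C \<subseteq> {..<n}" "card C = k" "(SUP v\<in>{..<n}. set_gdist E v C) < \<infinity>"
    unfolding k_radius_def INF_less_iff by blast
  have "\<exists>c\<in>C. d v c \<le> n - 1" if "v < n" for v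
  proof -
    have "set_gdist E v C \<le> (SUP v\<in>{..<n}. set_gdist E v C)" using that by (intro SUP_upper) simp
    then have "set_gdist E v C < \<infinity>" using cover(3) by (rule le_less_trans)
    then obtain c r where "c \<in> C" "gdist E v c = enat r"
      unfolding set_gdist_def INF_less_iff by auto
    then show ?thesis
      using gdist_finite_less[OF that, of c r] by (intro bexI[of _ c]) (auto simp: d_def)
  qed
  then have "k_radius n E k \<le> enat (n - 1)"
    using k_radius_le_iff[of "n - 1" k] cover(1,2) n_pos by auto
  then show ?thesis using n_pos by (cases "k_radius n E k") auto
qed simp

text \<open>\<open>X 0, \<dots>, X (i - 1)\<close> are the vertices chosen so far.\<close>

definition beyond :: "nat \<Rightarrow> (nat \<Rightarrow> nat) \<Rightarrow> nat \<Rightarrow> nat \<Rightarrow> bool" where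
  "beyond i X t v \<longleftrightarrow> (\<forall>l<i. t < d (X l) v)"

lemma beyond_0 [simp]: "beyond 0 X t v"
  by (simp add: beyond_def)

lemma beyond_Suc: "beyond (Suc i) X t v \<longleftrightarrow> beyond i X t v \<and> t < d (X i) v"
  by (auto simp: beyond_def less_Suc_eq)

lemma beyond_upd [simp]: "beyond i (X(i := x)) t v \<longleftrightarrow> beyond i X t v"
  by (simp add: beyond_def)

lemma beyond_cong: "(\<And>l. l < i \<Longrightarrow> X l = X' l) \<Longrightarrow> beyond i X = beyond i X'"
  by (auto simp: beyond_def fun_eq_iff)

lemma beyond_antimono: "beyond i X t' v \<Longrightarrow> t \<le> t' \<Longrightarrow> beyond i X t v"
  by (meson beyond_def le_less_trans)

end

section \<open>Completing a partial choice of centers\<close>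

text \<open>\<open>S\<close> is the hitting set, \<open>dS\<close> the distance to it, and \<open>N v\<close> contains the vertices that are nearer
  to \<open>v\<close> than \<open>S\<close> is.\<close>

locale center_search = finite_graph +
  fixes k :: nat and S :: "nat set" and N :: "nat \<Rightarrow> nat set" and dS :: "nat \<Rightarrow> nat" and R :: nat
  assumes k_pos: "1 \<le> k" and R_less: "R < n"
    and S_less: "\<And>s. s \<in> S \<Longrightarrow> s < n"
    and N_ne: "\<And>v. v < n \<Longrightarrow> N v \<noteq> {}"
    and dS_le: "\<And>v s. v < n \<Longrightarrow> s \<in> S \<Longrightarrow> dS v \<le> d v s"
    and dS_le_inf: "\<And>v. v < n \<Longrightarrow> dS v \<le> 2 * n"
    and dS_attained: "\<And>v. v < n \<Longrightarrow> dS v < 2 * n \<Longrightarrow> \<exists>s\<in>S. d v s = dS v"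
    and N_ball: "\<And>v r x. v < n \<Longrightarrow> r < 2 * n \<Longrightarrow> r < dS v \<Longrightarrow> x < n \<Longrightarrow> d v x \<le> r \<Longrightarrow> x \<in> N v"
    and dS_eq_0: "\<And>v. v < n \<Longrightarrow> k = 1 \<Longrightarrow> dS v = 0"
begin

definition "h = R div (2 * k - 1)"
definition "D = 2 * R - h"
definition "rho = (R - h) div 2"
definition "threshold i = R + 2 * i * h - h"

lemma h_bound: "i < k \<Longrightarrow> 2 * i * h + h \<le> R"
proof -
  assume "i < k"
  then have "(2 * i + 1) * h \<le> (2 * k - 1) * h" by (intro mult_le_mono1) simp
  also have "\<dots> \<le> R" by (simp add: h_def)
  finally show ?thesis by simp
qed

lemma h_le: "h \<le> R"
  using h_bound[of 0] k_pos by simp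

lemma rho_le: "rho \<le> R"
  unfolding rho_def using div_le_dividend[of "R - h" 2] by linarith

lemma threshold_le: "i < k \<Longrightarrow> threshold i \<le> D"
  using h_bound[of i] by (simp add: threshold_def D_def)

lemma dS_triangle: "c < n \<Longrightarrow> x < n \<Longrightarrow> dS c \<le> d c x + dS x"
proof (cases "dS x < 2 * n")
  case True
  assume less: "c < n" "x < n"
  then obtain s where "s \<in> S" "d x s = dS x" using dS_attained True by blast
  then show ?thesis using dS_le[OF less(1)] d_triangle[OF less(1), of s x] by fastforce
next
  case False
  then show "c < n \<Longrightarrow> ?thesis" using dS_le_inf[of c] by simp
qed

definition completion :: "nat set \<Rightarrow> nat \<Rightarrow> nat \<Rightarrow> (nat \<Rightarrow> nat) \<Rightarrow> bool" where
  "completion C i t X \<longleftrightarrow> finite C \<and> C \<subseteq> {..<n} \<and> card C \<le> k - i \<and>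
     (\<forall>v<n. beyond i X t v \<longrightarrow> (\<exists>c\<in>C. d v c \<le> R))"

lemma completionD:
  assumes "completion C i t X"
  shows "finite C" "C \<subseteq> {..<n}" "card C \<le> k - i"
    "\<And>v. v < n \<Longrightarrow> beyond i X t v \<Longrightarrow> \<exists>c\<in>C. d v c \<le> R"
  using assms by (auto simp: completion_def)

lemma completion_mono: "completion C i t X \<Longrightarrow> t \<le> t' \<Longrightarrow> completion C i t' X"
  unfolding completion_def using beyond_antimono by blast

lemma completion_relevant:
  assumes "completion C i t X"
  shows "completion {c\<in>C. \<exists>v<n. beyond i X t v \<and> d v c \<le> R} i t X" (is "completion ?C' i t X")
proof -
  have "card ?C' \<le> card C" using completionD(1)[OF assms] by (intro card_mono) auto
  then show ?thesis using completionD[OF assms] by (fastforce simp: completion_def)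
qed

lemma completion_choose:
  assumes "completion C i t X" "t \<le> t'" "c \<in> C"
    and covers: "\<And>v. v < n \<Longrightarrow> d v c \<le> R \<Longrightarrow> d x v \<le> t'"
  shows "completion (C - {c}) (Suc i) t' (X(i := x))"
  unfolding completion_def
proof (intro conjI allI impI)
  note C = completionD[OF assms(1)]
  show "finite (C - {c})" "C - {c} \<subseteq> {..<n}" "card (C - {c}) \<le> k - Suc i"
    using C assms(3) by auto
  fix v assume uncovered: "v < n" "beyond (Suc i) (X(i := x)) t' v"
  then obtain c' where cover: "c' \<in> C" "d v c' \<le> R"
    using C(4)[of v] beyond_antimono[OF _ assms(2)] by (auto simp: beyond_Suc)
  moreover have "c' \<noteq> c" using covers[OF uncovered(1)] uncovered(2) cover by (auto simp: beyond_Suc)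
  ultimately show "\<exists>c\<in>C - {c}. d v c \<le> R" by blast
qed

text \<open>In a near completion the missing centers may be looked up in \<open>S\<close>; this is of no interest for the
  last one.\<close>

definition near_completable :: "nat \<Rightarrow> (nat \<Rightarrow> nat) \<Rightarrow> bool" where
  "near_completable i X \<longleftrightarrow> (\<exists>C. completion C i D X \<and> (Suc i < k \<longrightarrow> (\<forall>c\<in>C. dS c \<le> R - h)))"

definition far_completable :: "nat \<Rightarrow> (nat \<Rightarrow> nat) \<Rightarrow> bool" where
  "far_completable i X \<longleftrightarrow> (\<exists>C. completion C i (threshold i) X)"

definition completable :: "nat \<Rightarrow> (nat \<Rightarrow> nat) \<Rightarrow> bool" where
  "completable i X \<longleftrightarrow> near_completable i X \<or> far_completable i X"

lemma completable_cong:
  "(\<And>l. l < i \<Longrightarrow> X l = X' l) \<Longrightarrow> completable i X \<longleftrightarrow> completable i X'"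
  using beyond_cong[of i X X']
  by (simp add: completable_def near_completable_def far_completable_def completion_def)

text \<open>\<open>b\<close> is one more than the distance of \<open>w\<close> to \<open>S\<close>, or \<open>0\<close> if no vertex is beyond \<open>t\<close>.\<close>

definition farthest :: "nat \<Rightarrow> (nat \<Rightarrow> nat) \<Rightarrow> nat \<Rightarrow> nat \<Rightarrow> nat \<Rightarrow> bool" where
  "farthest i X t b w \<longleftrightarrow> w < n \<and> (\<forall>z<n. beyond i X t z \<longrightarrow> dS z < b) \<and>
     (b \<noteq> 0 \<longrightarrow> b = dS w + 1 \<and> beyond i X t w)"

lemma near_completable_step:
  assumes "near_completable i X" "Suc i < k" "w < n"
  shows "\<exists>x\<in>S \<union> N w. near_completable (Suc i) (X(i := x))"
proof -
  obtain C where compl: "completion C i D X" "\<forall>c\<in>C. dS c \<le> R - h"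
    using assms(1,2) unfolding near_completable_def by blast
  show ?thesis
  proof (cases "C = {}")
    case True
    obtain x where "x \<in> N w" using N_ne assms(3) by blast
    moreover have "completion {} (Suc i) D (X(i := x))"
      using compl(1) True by (auto simp: completion_def beyond_Suc)
    ultimately show ?thesis unfolding near_completable_def by blast
  next
    case False
    then obtain c where c_in: "c \<in> C" by blast
    then have "c < n" "dS c \<le> R - h" using compl(2) completionD(2)[OF compl(1)] by auto
    moreover from this have "dS c < 2 * n" using R_less by simp
    ultimately obtain s where hitter: "s \<in> S" "d c s = dS c" using dS_attained by blast
    have "d s v \<le> D" if "v < n" "d v c \<le> R" for v
      using d_triangle[OF S_less[OF hitter(1)], of v c] hitter \<open>dS c \<le> R - h\<close> that h_le
      by (simp add: D_def d_commute[of s c] d_commute[of c v])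
    from completion_choose[OF compl(1) le_refl c_in this]
    show ?thesis using hitter(1) compl(2) unfolding near_completable_def by blast
  qed
qed

lemma beyond_far_from_hitters:
  assumes "Suc i < k" "\<forall>l<i. X l < n"
    and far_center: "c < n" "R - h < dS c" and v_beyond: "beyond i X D v" "d v c \<le> R"
  obtains x where "x < n" "beyond i X (threshold i) x" "R - h < 2 * i * h + dS x"
proof -
  define y where "y = min (2 * i * h) (d c v)"
  obtain x where on_path: "x < n" "d c x = y" "d x v = d c v - y"
    using d_geodesic[OF far_center(1), of v y] v_beyond(2) R_less by (auto simp: d_commute y_def)
  have "2 * i * h + h \<le> R" using h_bound assms(1) by simp
  have "threshold i < d (X l) x" if "l < i" for l
  proof -
    have "d (X l) v \<le> d (X l) x + d x v" using d_triangle assms(2) that by blast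
    moreover have "D < d (X l) v" using v_beyond(1) that by (simp add: beyond_def)
    ultimately show ?thesis
      using on_path v_beyond(2) \<open>2 * i * h + h \<le> R\<close> h_le
      by (auto simp: D_def threshold_def y_def d_commute[of v c] min_def split: if_splits)
  qed
  moreover have "R - h < 2 * i * h + dS x"
    using dS_triangle[OF far_center(1) on_path(1)] on_path(2) far_center(2) by (simp add: y_def)
  ultimately show thesis using that on_path(1) by (simp add: beyond_def)
qed

lemma row_contains_near_center:
  assumes "Suc i < k" "w < n" "R - h < 2 * i * h + dS w" "d w c \<le> R"
  obtains a where "a \<in> N w" "a < n" "d a c \<le> 2 * i * h + h"
proof -
  define y where "y = min (R - h - 2 * i * h) (d w c)"
  have h_small: "2 * i * h + h \<le> R" using h_bound assms(1) by simp
  obtain a where a_near: "a < n" "d w a = y" "d a c = d w c - y"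
    using d_geodesic[OF assms(2), of c y] assms(4) R_less by (auto simp: y_def)
  have "a \<in> N w"
    by (rule N_ball[OF assms(2), of "R - h - 2 * i * h"])
      (use R_less assms(3) h_small a_near in \<open>auto simp: y_def\<close>)
  then show thesis
    using that[of a] a_near assms(4) h_small by (auto simp: y_def min_def split: if_splits)
qed

lemma far_completable_step:
  assumes "far_completable i X" "Suc i < k" "farthest i X (threshold i) b w" "\<forall>l<i. X l < n"
  shows "\<exists>x\<in>S \<union> N w. completable (Suc i) (X(i := x))"
proof -
  obtain C where compl: "completion C i (threshold i) X"
    using assms(1) unfolding far_completable_def by blast
  have w_less: "w < n" using assms(3) by (simp add: farthest_def)
  define C' where "C' = {c\<in>C. \<exists>v<n. beyond i X D v \<and> d v c \<le> R}"
  have relevant: "completion C' i D X"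
    unfolding C'_def using assms(2)
    by (intro completion_relevant completion_mono[OF compl] threshold_le) simp
  show ?thesis
  proof (cases "\<forall>c\<in>C'. dS c \<le> R - h")
    case True
    then have "near_completable i X" using relevant unfolding near_completable_def by blast
    from near_completable_step[OF this assms(2) w_less] show ?thesis by (auto simp: completable_def)
  next
    case False
    then obtain c v where "c \<in> C" "R - h < dS c" "beyond i X D v" "d v c \<le> R"
      by (auto simp: C'_def not_le)
    moreover from this have "c < n" using completionD(2)[OF compl] by auto
    ultimately obtain x where "x < n" "beyond i X (threshold i) x" "R - h < 2 * i * h + dS x"
      using beyond_far_from_hitters[OF assms(2,4)] by blast
    then have w_far: "R - h < 2 * i * h + dS w" and "beyond i X (threshold i) w"
      using assms(3) by (fastforce simp: farthest_def)+
    then obtain c' where cover: "c' \<in> C" "d w c' \<le> R" using completionD(4)[OF compl w_less] by blast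
    obtain a where a_near: "a \<in> N w" "a < n" "d a c' \<le> 2 * i * h + h"
      using row_contains_near_center[OF assms(2) w_less w_far cover(2)] .
    have "d a v \<le> threshold (Suc i)" if "v < n" "d v c' \<le> R" for v
      using d_triangle[OF a_near(2), of v c'] a_near(3) that
      by (simp add: threshold_def d_commute[of c' v])
    moreover have "threshold i \<le> threshold (Suc i)" by (simp add: threshold_def)
    ultimately have "completion (C - {c'}) (Suc i) (threshold (Suc i)) (X(i := a))"
      using completion_choose[OF compl _ cover(1)] by blast
    then show ?thesis using a_near(1) unfolding completable_def far_completable_def by blast
  qed
qed

lemma completable_step:
  assumes "completable i X" "Suc i < k" "farthest i X (threshold i) b w" "\<forall>l<i. X l < n"
  shows "\<exists>x\<in>S \<union> N w. completable (Suc i) (X(i := x))"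
  using assms far_completable_step near_completable_step
  unfolding completable_def farthest_def by blast

lemma completable_last:
  assumes "completable i X" "Suc i = k"
  obtains c where "c < n" "\<And>v. v < n \<Longrightarrow> beyond i X D v \<Longrightarrow> d v c \<le> R"
proof -
  obtain C where compl: "completion C i D X"
    using assms completion_mono[OF _ threshold_le[of i]]
    unfolding completable_def near_completable_def far_completable_def by auto
  show thesis
  proof (cases "C = {}")
    case True
    then show thesis using completionD(4)[OF compl] n_pos by (intro that[of 0]) auto
  next
    case False
    then have "card C \<noteq> 0" using completionD(1)[OF compl] by simp
    then have "card C = 1" using completionD(3)[OF compl] assms(2) by linarith
    then obtain c where "C = {c}" by (rule card_1_singletonE)
    then show thesis using completionD(2,4)[OF compl] by (intro that[of c]) auto
  qed
qed

lemma last_center_near_complete: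
  assumes "z < n" "d z s \<le> rho" "c < n" "d z c \<le> R"
  shows "d c s \<le> R + rho"
  using d_triangle[OF assms(3), of s z] assms d_commute[of c z] by simp

lemma last_center_near_sound:
  assumes "z < n" "d z s \<le> rho" "d u s \<le> R + rho"
  shows "d u z \<le> D"
  using d_triangle[OF assms(1), of u s] assms h_le
  by (auto simp: D_def rho_def d_commute[of s u] d_commute[of u z])

lemma last_center_far_complete:
  assumes cover: "c < n" "\<And>v. v < n \<Longrightarrow> beyond i X D v \<Longrightarrow> d v c \<le> R"
    and far: "w < n" "beyond i X D w" "rho < dS w"
  shows "\<exists>u\<in>N w. \<forall>z<n. beyond i X D z \<longrightarrow> d u z \<le> D"
proof -
  have "k \<noteq> 1" using dS_eq_0[OF far(1)] far(3) by auto
  then have "h \<le> rho" using h_bound[of 1] k_pos by (simp add: rho_def)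
  define y where "y = min rho (d w c)"
  obtain u where on_path: "u < n" "d w u = y" "d u c = d w c - y"
    using d_geodesic[OF far(1), of c y] cover(2)[OF far(1,2)] R_less by (auto simp: y_def)
  have "u \<in> N w"
    by (rule N_ball[OF far(1) _ far(3) on_path(1)]) (use on_path(2) rho_le R_less in \<open>auto simp: y_def\<close>)
  moreover have "d u z \<le> D" if "z < n" "beyond i X D z" for z
    using d_triangle[OF on_path(1), of z c] on_path(3) cover(2)[OF that] cover(2)[OF far(1,2)] \<open>h \<le> rho\<close>
      h_le
    by (auto simp: D_def d_commute[of c z] y_def min_def split: if_splits)
  ultimately show ?thesis by blast
qed

lemma completable_initially:
  assumes "k_radius n E k \<le> enat R"
  shows "completable 0 X"
proof -
  obtain C where "C \<subseteq> {..<n}" "card C = k" "\<forall>v<n. \<exists>c\<in>C. d v c \<le> R"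
    using assms k_radius_le_iff[of R k] R_less by auto
  then have "completion C 0 (threshold 0) X"
    by (auto simp: completion_def intro: finite_subset)
  then show ?thesis unfolding completable_def far_completable_def by blast
qed

end

section \<open>Breadth-first search\<close>

context finite_graph begin

text \<open>\<open>qu\<close> is the queue with write position \<open>qt\<close> and read position \<open>qh\<close>, \<open>lab\<close> the distance labels
  so far.\<close>

definition bfs_queue :: "nat \<Rightarrow> nat \<Rightarrow> (nat \<Rightarrow> nat) \<Rightarrow> (nat \<Rightarrow> nat) \<Rightarrow> bool" where
  "bfs_queue s qt qu lab \<longleftrightarrow> 1 \<le> qt \<and> inj_on qu {..<qt} \<and>
     (\<forall>i<qt. qu i < n \<and> d s (qu i) < 2 * n) \<and> qu 0 = s \<and>
     (\<forall>i j. i < j \<longrightarrow> j < qt \<longrightarrow> d s (qu i) \<le> d s (qu j)) \<and>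
     (\<forall>u<n. lab u = (if u \<in> qu ` {..<qt} then d s u else 2 * n))"

definition bfs_head :: "nat \<Rightarrow> nat \<Rightarrow> nat \<Rightarrow> (nat \<Rightarrow> nat) \<Rightarrow> bool" where
  "bfs_head s qh qt qu \<longleftrightarrow> (\<forall>i<qh. \<forall>u. {qu i, u} \<in> E \<longrightarrow> u \<in> qu ` {..<qt}) \<and>
     (qh < qt \<longrightarrow> (\<forall>i<qt. d s (qu i) \<le> d s (qu qh) + 1) \<and>
       (\<forall>x<n. d s x \<le> d s (qu qh) \<longrightarrow> x \<in> qu ` {..<qt}))"

lemma bfs_queueD:
  assumes "bfs_queue s qt qu lab"
  shows "inj_on qu {..<qt}" "\<And>i. i < qt \<Longrightarrow> qu i < n" "\<And>i. i < qt \<Longrightarrow> d s (qu i) < 2 * n"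
    "\<And>i j. i \<le> j \<Longrightarrow> j < qt \<Longrightarrow> d s (qu i) \<le> d s (qu j)"
    "\<And>u. u < n \<Longrightarrow> lab u = (if u \<in> qu ` {..<qt} then d s u else 2 * n)" "s \<in> qu ` {..<qt}"
  using assms unfolding bfs_queue_def by (auto simp: le_less)

lemma bfs_headD:
  assumes "bfs_head s qh qt qu"
  shows "\<And>i u. i < qh \<Longrightarrow> {qu i, u} \<in> E \<Longrightarrow> u \<in> qu ` {..<qt}"
    "\<And>i. qh < qt \<Longrightarrow> i < qt \<Longrightarrow> d s (qu i) \<le> d s (qu qh) + 1"
    "\<And>x. qh < qt \<Longrightarrow> x < n \<Longrightarrow> d s x \<le> d s (qu qh) \<Longrightarrow> x \<in> qu ` {..<qt}"
  using assms unfolding bfs_head_def by blast+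

lemma bfs_queue_le:
  assumes "bfs_queue s qt qu lab"
  shows "qt \<le> n"
proof -
  have "qu ` {..<qt} \<subseteq> {..<n}" using bfs_queueD(2)[OF assms] by auto
  then have "card {..<qt} \<le> card {..<n}"
    using bfs_queueD(1)[OF assms] by (intro card_inj_on_le) auto
  then show ?thesis by simp
qed

lemma bfs_init:
  assumes "s < n" "qu 0 = s" "\<And>u. u < n \<Longrightarrow> lab u = (if u = s then 0 else 2 * n)"
  shows "bfs_queue s 1 qu lab" "bfs_head s 0 1 qu"
  using assms by (auto simp: bfs_queue_def bfs_head_def lessThan_Suc d_eq_0)

lemma bfs_push:
  assumes queue: "bfs_queue s qt qu lab" and head: "bfs_head s qh qt qu" "qh < qt" and s_less: "s < n"
    and new: "{qu qh, u} \<in> E" "u \<notin> qu ` {..<qt}"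
  shows "bfs_queue s (Suc qt) (qu(qt := u)) (lab(u := d s (qu qh) + 1))"
    "bfs_head s qh (Suc qt) (qu(qt := u))"
proof -
  have u_less: "u < n" using new edge_less by blast
  have d_less: "d s (qu qh) < n" using queue head(2) s_less d_less_or_inf[of s "qu qh"]
    by (auto simp: bfs_queue_def)
  have "\<not> d s u \<le> d s (qu qh)" using bfs_headD(3)[OF head u_less] new(2) by blast
  moreover have "d s u \<le> d s (qu qh) + 1"
    using d_triangle[OF s_less, of u "qu qh"] d_edge[OF new(1)] by simp
  ultimately have d_u: "d s u = d s (qu qh) + 1" by simp
  have image_eq: "(qu(qt := u)) ` {..<Suc qt} = insert u (qu ` {..<qt})"
    by (auto simp: lessThan_Suc)
  have "inj_on (qu(qt := u)) {..<Suc qt}"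
    using queue new by (auto simp: bfs_queue_def inj_on_def less_Suc_eq)
  then show "bfs_queue s (Suc qt) (qu(qt := u)) (lab(u := d s (qu qh) + 1))"
    unfolding bfs_queue_def image_eq using queue head(2) bfs_headD(2)[OF head] u_less d_u d_less
    by (auto simp: bfs_queue_def less_Suc_eq)
  show "bfs_head s qh (Suc qt) (qu(qt := u))"
    unfolding bfs_head_def image_eq using head d_u by (auto simp: bfs_head_def less_Suc_eq)
qed

lemma bfs_advance:
  assumes queue: "bfs_queue s qt qu lab" and head: "bfs_head s qh qt qu" "qh < qt" and s_less: "s < n"
    and neighbours: "\<And>u. {qu qh, u} \<in> E \<Longrightarrow> u \<in> qu ` {..<qt}"
  shows "bfs_head s (Suc qh) qt qu"
  unfolding bfs_head_def
proof (intro conjI impI allI)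
  show closed: "u \<in> qu ` {..<qt}" if "i < Suc qh" "{qu i, u} \<in> E" for i u
    using bfs_headD(1)[OF head(1)] neighbours that by (auto simp: less_Suc_eq)
  assume more: "Suc qh < qt"
  have "d s (qu qh) \<le> d s (qu (Suc qh))" using bfs_queueD(4)[OF queue, of qh "Suc qh"] more by simp
  then show "d s (qu i) \<le> d s (qu (Suc qh)) + 1" if "i < qt" for i
    using bfs_headD(2)[OF head that] by simp
  fix x assume x_near: "x < n" "d s x \<le> d s (qu (Suc qh))"
  show "x \<in> qu ` {..<qt}"
  proof (cases "d s x \<le> d s (qu qh)")
    case True
    then show ?thesis using bfs_headD(3)[OF head x_near(1)] by blast
  next
    case False
    then have next_level: "d s x = Suc (d s (qu qh))" "d s (qu (Suc qh)) = Suc (d s (qu qh))"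
      using x_near bfs_headD(2)[OF head more] by auto
    then obtain y where pred: "y < n" "d s y = d s (qu qh)" "{y, x} \<in> E"
      using d_predecessor[OF s_less next_level(1)] bfs_queueD(3)[OF queue more] by auto
    then obtain i where index: "i < qt" "y = qu i" using bfs_headD(3)[OF head pred(1)] by auto
    have "i < Suc qh"
    proof (rule ccontr)
      assume "\<not> i < Suc qh"
      then have "d s (qu (Suc qh)) \<le> d s (qu i)" using bfs_queueD(4)[OF queue _ index(1)] by simp
      then show False using pred index next_level by simp
    qed
    then show ?thesis using closed pred index by blast
  qed
qed

lemma bfs_complete:
  assumes queue: "bfs_queue s qt qu lab" "bfs_head s qt qt qu" "s < n"
    and reachable: "u < n" "d s u < 2 * n"
  shows "u \<in> qu ` {..<qt}"
  using reachable
proof (induction "d s u" arbitrary: u)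
  case 0
  then have "u = s" using d_eq_0[of s u] by simp
  then show ?case using bfs_queueD(6)[OF queue(1)] by simp
next
  case (Suc r)
  then obtain x where pred: "x < n" "d s x = r" "{x, u} \<in> E"
    using d_predecessor[OF queue(3), of u r] by metis
  then have "x \<in> qu ` {..<qt}" using Suc by auto
  then show ?case using bfs_headD(1)[OF queue(2)] pred by auto
qed

lemma bfs_labels:
  assumes queue: "bfs_queue s qt qu lab" "bfs_head s qt qt qu" "s < n" and u_less: "u < n"
  shows "lab u = d s u"
  using bfs_complete[OF queue u_less] bfs_queueD(5)[OF queue(1) u_less] d_le_inf[OF queue(3), of u]
  by (cases "d s u < 2 * n") auto

text \<open>The entries \<open>rw 0, \<dots>, rw (q - 1)\<close> are the vertices nearest to \<open>s\<close>; \<open>ample\<close> tells whether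
  there are that many.\<close>

definition near_row :: "nat \<Rightarrow> nat \<Rightarrow> (nat \<Rightarrow> nat) \<Rightarrow> bool \<Rightarrow> bool" where
  "near_row q s rw ample \<longleftrightarrow> (ample \<longrightarrow> inj_on rw {..<q}) \<and> (q = 1 \<longrightarrow> ample) \<and>
     (\<forall>r<2 * n. (\<forall>x<n. d s x \<le> r \<longrightarrow> x \<in> rw ` {..<q}) \<or> (ample \<and> (\<forall>i<q. d s (rw i) \<le> r)))"

lemma near_rowD:
  assumes "near_row q s rw ample"
  shows "ample \<Longrightarrow> inj_on rw {..<q}" "q = 1 \<Longrightarrow> ample"
    "r < 2 * n \<Longrightarrow> (\<forall>x<n. d s x \<le> r \<longrightarrow> x \<in> rw ` {..<q}) \<or> (ample \<and> (\<forall>i<q. d s (rw i) \<le> r))"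
  using assms by (simp_all add: near_row_def)

lemma near_row_ball:
  assumes "near_row q s rw ample" "ample \<Longrightarrow> \<exists>i<q. b \<le> d s (rw i)"
    and "r < 2 * n" "r < b" "x < n" "d s x \<le> r"
  shows "x \<in> rw ` {..<q}"
  using near_rowD(3)[OF assms(1,3)]
proof
  assume close: "ample \<and> (\<forall>i<q. d s (rw i) \<le> r)"
  then obtain i where "i < q" "b \<le> d s (rw i)" using assms(2) by blast
  then show ?thesis using close assms(4) by (meson leD le_trans)
qed (use assms(5,6) in blast)

lemma near_row_1:
  assumes "near_row 1 s rw ample" "s < n"
  shows "rw 0 = s"
  using near_rowD(3)[OF assms(1), of 0] n_pos assms(2) by (auto simp: d_eq_0)

lemma bfs_near_row:
  assumes queue: "bfs_queue s qt qu lab" "bfs_head s qt qt qu" "s < n"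
  shows "near_row q s qu (q \<le> qt)"
  unfolding near_row_def
proof (intro conjI allI impI)
  show "inj_on qu {..<q}" if "q \<le> qt"
    using bfs_queueD(1)[OF queue(1)] by (rule inj_on_subset) (use that in auto)
  show "q \<le> qt" if "q = 1" using queue(1) that by (simp add: bfs_queue_def)
  fix r assume r_less: "r < 2 * n"
  have early: "x \<in> qu ` {..<q}"
    if x_near: "x < n" "d s x \<le> r" and late: "qt \<le> q \<or> (\<exists>i<q. r < d s (qu i))" for x
  proof -
    obtain j where index: "j < qt" "x = qu j" using bfs_complete[OF queue x_near(1)] x_near(2) r_less
      by auto
    have "j < q"
    proof (rule ccontr)
      assume "\<not> j < q"
      then obtain i where "i < q" "r < d s (qu i)" using late index(1) by auto
      then show False using bfs_queueD(4)[OF queue(1), of i j] \<open>\<not> j < q\<close> index x_near(2) by simp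
    qed
    then show ?thesis using index(2) by blast
  qed
  show "(\<forall>x<n. d s x \<le> r \<longrightarrow> x \<in> qu ` {..<q}) \<or> (q \<le> qt \<and> (\<forall>i<q. d s (qu i) \<le> r))"
  proof (cases "qt \<le> q \<or> (\<exists>i<q. r < d s (qu i))")
    case False
    then show ?thesis by (intro disjI2 conjI allI impI) (auto simp: not_less not_le dest: leD)
  qed (use early in blast)
qed

end

subsection \<open>Adjacency lists of half-edges\<close>

text \<open>\<open>prev ep j v\<close> is one more than the last half-edge before \<open>j\<close> that leaves \<open>v\<close>, and \<open>0\<close> if there
  is none.\<close>

fun prev :: "(nat \<Rightarrow> nat) \<Rightarrow> nat \<Rightarrow> nat \<Rightarrow> nat" where
  "prev ep 0 v = 0"
| "prev ep (Suc j) v = (if ep j = v then Suc j else prev ep j v)"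

fun out_degree :: "(nat \<Rightarrow> nat) \<Rightarrow> nat \<Rightarrow> nat \<Rightarrow> nat" where
  "out_degree ep 0 v = 0"
| "out_degree ep (Suc j) v = out_degree ep j v + of_bool (ep j = v)"

lemma prev_le: "prev ep j v \<le> j"
  by (induction j) auto

lemma out_degree_prev [simp]: "out_degree ep (prev ep j v) v = out_degree ep j v"
  by (induction j) auto

lemma prev_leaves: "prev ep j v = Suc e \<Longrightarrow> ep e = v"
  by (induction j) (auto split: if_splits)

lemma prev_last: "prev ep j v \<le> e \<Longrightarrow> e < j \<Longrightarrow> ep e \<noteq> v"
  by (induction j) (auto simp: less_Suc_eq split: if_splits)

lemma sum_out_degree: "(\<And>e. e < j \<Longrightarrow> ep e < n) \<Longrightarrow> (\<Sum>v<n. out_degree ep j v) = j"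
proof (induction j)
  case (Suc j)
  have "(\<Sum>v<n. of_bool (ep j = v)) = (1::nat)"
    using Suc.prems[of j] by (simp add: of_bool_def)
  then show ?case using Suc by (simp add: sum.distrib)
qed simp

section \<open>Greedy hitting sets\<close>

lemma card_le_of_frequency_le:
  assumes "finite U" "finite A" "\<And>v. v \<in> U \<Longrightarrow> N v \<subseteq> A \<and> card (N v) = q"
    and "\<And>u. u \<in> A \<Longrightarrow> card {v\<in>U. u \<in> N v} \<le> b"
  shows "card U * q \<le> card A * b"
proof -
  have "{u\<in>A. u \<in> N v} = N v" if "v \<in> U" for v using assms(3)[OF that] by blast
  then have "(\<Sum>u\<in>A. card {v\<in>U. u \<in> N v}) = q * card U"
    using assms(1-3) by (intro sum_multicount) auto
  moreover have "(\<Sum>u\<in>A. card {v\<in>U. u \<in> N v}) \<le> (\<Sum>u\<in>A. b)" by (intro sum_mono assms(4))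
  ultimately show ?thesis by (simp add: mult.commute)
qed

text \<open>Each greedy choice shrinks the number \<open>u\<close> of sets to be hit by the factor \<open>1 - q / n\<close>.\<close>

definition greedy_potential :: "nat \<Rightarrow> nat \<Rightarrow> nat \<Rightarrow> real" where
  "greedy_potential n q u = (if u = 0 then 0 else real n / real q * (1 + ln (real u)))"

lemma greedy_potential_nonneg: "0 \<le> greedy_potential n q u"
  by (auto simp: greedy_potential_def)

lemma greedy_potential_mono:
  assumes "u \<le> v"
  shows "greedy_potential n q u \<le> greedy_potential n q v"
proof (cases "u = 0")
  case False
  then have "real n / real q * (1 + ln (real u)) \<le> real n / real q * (1 + ln (real v))"
    using assms by (intro mult_left_mono add_left_mono ln_mono) auto
  then show ?thesis using False assms by (simp add: greedy_potential_def)
qed (simp add: greedy_potential_def)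

lemma greedy_potential_step:
  assumes "1 \<le> q" "q \<le> n" "1 \<le> u" "b \<le> u" "u * q \<le> n * b"
  shows "greedy_potential n q (u - b) + 1 \<le> greedy_potential n q u"
proof (cases "u = b")
  case True
  have "1 \<le> real n / real q" "0 \<le> ln (real u)" using assms by simp_all
  then have "1 * 1 \<le> real n / real q * (1 + ln (real u))" by (intro mult_mono) auto
  then show ?thesis using True assms by (simp add: greedy_potential_def)
next
  case False
  define v where "v = u - b"
  have rest: "1 \<le> v" "real v = real u - real b" using False assms by (auto simp: v_def)
  have "ln (real v) - ln (real u) = ln (real v / real u)" using rest assms by (simp add: ln_div)
  also have "\<dots> \<le> real v / real u - 1" using rest assms by (intro ln_le_minus_one) auto
  also have "\<dots> = - (real b / real u)" using assms(3) unfolding rest(2) by (simp add: diff_divide_distrib)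
  also have "\<dots> \<le> - (real q / real n)"
  proof -
    have "real u * real q \<le> real n * real b" using assms(5) by (metis of_nat_mult of_nat_le_iff)
    then show ?thesis using assms by (simp add: field_simps)
  qed
  finally have "real n / real q * (1 + ln (real v))
      \<le> real n / real q * (1 + (ln (real u) - real q / real n))"
    by (intro mult_left_mono) auto
  also have "\<dots> = real n / real q * (1 + ln (real u)) - 1" using assms by (simp add: field_simps)
  finally show ?thesis using rest assms by (simp add: greedy_potential_def v_def[symmetric])
qed

section \<open>A while language and its compiler\<close>

text \<open>Otherwise step counts would be rewritten from numerals to successor form.\<close>

declare One_nat_def [simp del]

datatype var =
    Row_len | Num_hit | Guess | Gap | Target | Half | Found | Low | High | Result
  | Src | Dst | Mid | Edge | Level | First | Last | Pos | Best | Best_at | Limit | Probe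
  | Margin | Pick | Valid | Choice nat | Center nat | Cursor nat | Farthest nat

instance var :: countable by countable_datatype

datatype arr =
    Ends | Prev | Head | Dist | Queue | Ample | Count | Hitter | HitDist | HitNear | Needed

datatype expr =
    Lit nat
  | NumV
  | NumE
  | V var
  | Cell arr expr expr ("_\<langle>_, _\<rangle>" [1000, 0, 0] 1000)
  | Opr binop expr expr

abbreviation eadd (infixl "\<oplus>" 65) where "a \<oplus> b \<equiv> Opr OpAdd a b"
abbreviation esub (infixl "\<ominus>" 65) where "a \<ominus> b \<equiv> Opr OpSub a b"
abbreviation emul (infixl "\<otimes>" 70) where "a \<otimes> b \<equiv> Opr OpMul a b"
abbreviation ediv (infixl "\<oslash>" 70) where "a \<oslash> b \<equiv> Opr OpDiv a b"
abbreviation eless (infix "\<prec>" 50) where "a \<prec> b \<equiv> Opr OpLess a b"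
abbreviation eeq (infix "\<doteq>" 50) where "a \<doteq> b \<equiv> Opr OpEq a b"
abbreviation vec ("_\<langle>_\<rangle>" [1000, 0] 1000) where "a\<langle>e\<rangle> \<equiv> a\<langle>Lit 0, e\<rangle>"

datatype com =
    SKIP
  | Assign var expr ("_ ::= _" [900, 61] 61)
  | Update arr expr expr expr ("_\<langle>_, _\<rangle> \<leftarrow> _" [1000, 0, 0, 61] 61)
  | Seq com com (infixr ";;" 60)
  | Branch expr com com ("(IF _/ THEN _/ ELSE _)" [0, 0, 61] 61)
  | Repeat expr com ("(WHILE _/ DO _)" [0, 61] 61)

abbreviation vec_update ("_\<langle>_\<rangle> \<leftarrow> _" [1000, 0, 61] 61) where
  "a\<langle>j\<rangle> \<leftarrow> e \<equiv> a\<langle>Lit 0, j\<rangle> \<leftarrow> e"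

definition For :: "var \<Rightarrow> expr \<Rightarrow> com \<Rightarrow> com" ("(FOR _ < _ DO _)" [0, 0, 61] 61) where
  "FOR x < e DO c = (x ::= Lit 0;; WHILE V x \<prec> e DO (c;; x ::= V x \<oplus> Lit 1))"

fun assigned :: "com \<Rightarrow> var set" where
  "assigned SKIP = {}"
| "assigned (x ::= e) = {x}"
| "assigned (a\<langle>i, j\<rangle> \<leftarrow> e) = {}"
| "assigned (c;; c') = assigned c \<union> assigned c'"
| "assigned (IF e THEN c ELSE c') = assigned c \<union> assigned c'"
| "assigned (WHILE e DO c) = assigned c"

fun stored :: "com \<Rightarrow> arr set" where
  "stored SKIP = {}"
| "stored (x ::= e) = {}"
| "stored (a\<langle>i, j\<rangle> \<leftarrow> e) = {a}"
| "stored (c;; c') = stored c \<union> stored c'"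
| "stored (IF e THEN c ELSE c') = stored c \<union> stored c'"
| "stored (WHILE e DO c) = stored c"

lemma assigned_For [simp]: "assigned (FOR x < e DO c) = insert x (assigned c)"
  by (auto simp: For_def)

lemma stored_For [simp]: "stored (FOR x < e DO c) = stored c"
  by (simp add: For_def)

subsection \<open>Compilation\<close>

text \<open>The input registers \<open>0\<close> and \<open>1\<close> are never overwritten; the other even registers hold the
  variables, and the odd ones from \<open>3\<close> on the intermediate results of expression evaluation.\<close>

definition vreg :: "var \<Rightarrow> nat" where "vreg x = 2 * to_nat x + 2"
definition treg :: "nat \<Rightarrow> nat" where "treg d = 2 * d + 3"

lemma vreg_eq [simp]: "vreg x = vreg y \<longleftrightarrow> x = y"
  by (simp add: vreg_def)

lemma treg_eq [simp]: "treg d = treg d' \<longleftrightarrow> d = d'"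
  by (simp add: treg_def)

lemma vreg_neq_treg [simp]: "vreg x \<noteq> treg d" "treg d \<noteq> vreg x"
  unfolding vreg_def treg_def by presburger+

lemma register_gt_1 [simp]:
  "vreg x \<noteq> 0" "vreg x \<noteq> 1" "treg d \<noteq> 0" "treg d \<noteq> 1" "0 \<noteq> vreg x" "1 \<noteq> vreg x" "0 \<noteq> treg d" "1 \<noteq> treg d"
  by (simp_all add: vreg_def treg_def)

fun array_index :: "arr \<Rightarrow> nat" where
  "array_index Ends = 0"
| "array_index Prev = 1"
| "array_index Head = 2"
| "array_index Dist = 3"
| "array_index Queue = 4"
| "array_index Ample = 5"
| "array_index Count = 6"
| "array_index Hitter = 7"
| "array_index HitDist = 8"
| "array_index HitNear = 9"
| "array_index Needed = 10"

lemma array_index_eq [simp]: "array_index a = array_index a' \<longleftrightarrow> a = a'"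
  by (cases a; cases a') simp_all

lemma array_index_le: "array_index a \<le> 10"
  by (cases a) simp_all

text \<open>Every array occupies a block of \<open>n * n + n + 2 * m\<close> cells. Given the row and the column in two
  consecutive scratch registers, \<open>locate\<close> computes the address of a cell.\<close>

definition locate :: "arr \<Rightarrow> nat \<Rightarrow> instr list" where
  "locate a d = (let r = treg d; r1 = treg (Suc d); r2 = treg (Suc (Suc d)) in
     [Bin OpMul r r 0, Bin OpAdd r r r1, Bin OpMul r1 0 0, Bin OpAdd r1 r1 0, Bin OpAdd r1 r1 1,
      Bin OpAdd r1 r1 1, Const r2 (array_index a), Bin OpMul r1 r1 r2, Bin OpAdd r r r1])"

fun compile_expr :: "expr \<Rightarrow> nat \<Rightarrow> instr list" where
  "compile_expr (Lit b) d = [Const (treg d) b]"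
| "compile_expr NumV d = [Move (treg d) 0]"
| "compile_expr NumE d = [Move (treg d) 1]"
| "compile_expr (V x) d = [Move (treg d) (vreg x)]"
| "compile_expr (a\<langle>i, j\<rangle>) d =
     compile_expr i d @ compile_expr j (Suc d) @ locate a d @ [Load (treg d) (treg d)]"
| "compile_expr (Opr f e e') d =
     compile_expr e d @ compile_expr e' (Suc d) @ [Bin f (treg d) (treg d) (treg (Suc d))]"

fun compile :: "com \<Rightarrow> instr list" where
  "compile SKIP = []"
| "compile (x ::= e) = compile_expr e 0 @ [Move (vreg x) (treg 0)]"
| "compile (a\<langle>i, j\<rangle> \<leftarrow> e) = compile_expr i 0 @ compile_expr j 1 @ locate a 0 @ compile_expr e 1 @
     [Store (treg 0) (treg 1)]"
| "compile (c;; c') = compile c @ compile c'"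
| "compile (IF e THEN c ELSE c') = compile_expr e 0 @ [Cond (treg 0) (compile c) (compile c')]"
| "compile (WHILE e DO c) = compile_expr e 0 @ [While (treg 0) (compile c @ compile_expr e 0)]"

fun steps :: "expr \<Rightarrow> nat" where
  "steps (Lit b) = 1"
| "steps NumV = 1"
| "steps NumE = 1"
| "steps (V x) = 1"
| "steps (a\<langle>i, j\<rangle>) = steps i + steps j + 10"
| "steps (Opr f e e') = steps e + steps e' + 1"

fun nat_op :: "binop \<Rightarrow> nat \<Rightarrow> nat \<Rightarrow> nat" where
  "nat_op OpAdd a b = a + b"
| "nat_op OpSub a b = a - b"
| "nat_op OpMul a b = a * b"
| "nat_op OpDiv a b = a div b"
| "nat_op OpMod a b = a mod b"
| "nat_op OpLess a b = of_bool (a < b)"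
| "nat_op OpEq a b = of_bool (a = b)"

fun no_overflow :: "nat \<Rightarrow> binop \<Rightarrow> nat \<Rightarrow> nat \<Rightarrow> bool" where
  "no_overflow w OpAdd a b \<longleftrightarrow> a + b < 2 ^ w"
| "no_overflow w OpSub a b \<longleftrightarrow> b \<le> a \<and> a < 2 ^ w"
| "no_overflow w OpMul a b \<longleftrightarrow> a * b < 2 ^ w"
| "no_overflow w _ a b \<longleftrightarrow> True"

lemma eval_op_eq_nat_op:
  assumes "no_overflow w f a b"
  shows "eval_op w f a b = nat_op f a b"
proof (cases f)
  case OpSub
  then have no_underflow: "b \<le> a" "a < 2 ^ w" using assms by auto
  then have "int (a - b) < int (2 ^ w)" by (simp only: of_nat_less_iff)
  then have "(int a - int b) mod 2 ^ w = int (a - b)"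
    using no_underflow(1) by (simp add: of_nat_diff mod_pos_pos_trivial)
  then show ?thesis by (simp only: OpSub eval_op.simps nat_op.simps nat_int)
qed (use assms in simp_all)

lemma run_0: "run w 0 c = return_pmf c"
  by (simp add: run_def)

lemma run_add: "run w (s + t) c = bind_pmf (run w s c) (run w t)"
proof (induction t)
  case 0
  then show ?case by (simp add: run_def bind_return_pmf')
next
  case (Suc t)
  have "run w (Suc t) = (\<lambda>x. bind_pmf (run w t x) (step w))"
    by (simp add: run_def fun_eq_iff)
  then show ?case using Suc by (simp add: run_def bind_assoc_pmf)
qed

lemma run_1: "run w 1 = step w"
  by (simp add: run_def One_nat_def bind_return_pmf fun_eq_iff)

lemma run_trans:
  assumes "run w s c = return_pmf c'" "run w t c' = p"
  shows "run w (s + t) c = p"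
  using assms by (simp add: run_add bind_return_pmf)

lemma run_Suc: "run w (Suc t) c = bind_pmf (step w c) (run w t)"
  using run_add[of w 1 t c] by (simp add: run_1 plus_1_eq_Suc)

lemma run_halted: "run w t ([], s) = return_pmf ([], s)"
  by (induction t) (simp_all add: run_0 run_Suc bind_return_pmf)

type_synonym store = "var \<Rightarrow> nat"
type_synonym arrays = "arr \<Rightarrow> nat \<Rightarrow> nat \<Rightarrow> nat"

abbreviation upd :: "arrays \<Rightarrow> arr \<Rightarrow> nat \<Rightarrow> nat \<Rightarrow> nat \<Rightarrow> arrays" where
  "upd \<alpha> a i j b \<equiv> \<alpha>(a := (\<alpha> a)(i := (\<alpha> a i)(j := b)))"

locale machine =
  fixes n m w :: nat
  assumes n_pos: "1 \<le> n" and word: "100 * (n * n + n + m + 1) \<le> 2 ^ w"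
begin

lemma less_word: "b < 100 * (n * n + n + m + 1) \<Longrightarrow> b < 2 ^ w"
  using word by (rule less_le_trans[rotated])

lemma one_less_word [simp]: "1 < (2::nat) ^ w" "Suc 0 < (2::nat) ^ w"
  using less_word[of 1] by (simp_all add: One_nat_def)

text \<open>A one-dimensional array is a single row. The \<open>n\<close> cells following the input serve for the output.\<close>

fun in_range :: "arr \<Rightarrow> nat \<Rightarrow> nat \<Rightarrow> bool" where
  "in_range Ends i j \<longleftrightarrow> i = 0 \<and> j < 2 * m + n"
| "in_range Prev i j \<longleftrightarrow> i = 0 \<and> j < 2 * m"
| "in_range Dist i j \<longleftrightarrow> i < n \<and> j < n"
| "in_range Queue i j \<longleftrightarrow> i < n \<and> j < n"
| "in_range a i j \<longleftrightarrow> i = 0 \<and> j < n"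

definition "block = n * n + n + 2 * m"
definition "addr a i j = array_index a * block + (i * n + j)"

lemma row_major_less: "i < n \<Longrightarrow> j < n \<Longrightarrow> i * n + j < n * n"
proof -
  assume "i < n" "j < n"
  then have "i * n + j < Suc i * n" "Suc i * n \<le> n * n" by (simp, intro mult_le_mono1, simp)
  then show ?thesis by (rule less_le_trans)
qed

lemma in_range_block: "in_range a i j \<Longrightarrow> i * n + j < block"
  using row_major_less[of i j] n_pos by (cases a) (auto simp: block_def)

lemma addr_eq:
  assumes "in_range a i j" "in_range a' i' j'"
  shows "addr a i j = addr a' i' j' \<longleftrightarrow> a = a' \<and> i = i' \<and> j = j'"
proof
  assume same_addr: "addr a i j = addr a' i' j'"
  have "(array_index a * block + (i * n + j)) div block = array_index a"
    if "in_range a i j" for a i j using in_range_block[OF that] by simp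
  with assms same_addr have array_eq: "a = a'" unfolding addr_def by (metis array_index_eq)
  then have offset_eq: "i * n + j = i' * n + j'" using same_addr by (simp add: addr_def)
  show "a = a' \<and> i = i' \<and> j = j'"
  proof (cases "j < n \<and> j' < n")
    case True
    then have "i = (i * n + j) div n" "i' = (i' * n + j') div n" by simp_all
    then show ?thesis using array_eq offset_eq by simp
  next
    case False
    then show ?thesis
      using array_eq offset_eq assms by (cases a) auto
  qed
qed auto

fun val :: "expr \<Rightarrow> store \<Rightarrow> arrays \<Rightarrow> nat" where
  "val (Lit b) \<sigma> \<alpha> = b"
| "val NumV \<sigma> \<alpha> = n"
| "val NumE \<sigma> \<alpha> = m"
| "val (V x) \<sigma> \<alpha> = \<sigma> x"
| "val (a\<langle>i, j\<rangle>) \<sigma> \<alpha> = \<alpha> a (val i \<sigma> \<alpha>) (val j \<sigma> \<alpha>)"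
| "val (Opr f e e') \<sigma> \<alpha> = nat_op f (val e \<sigma> \<alpha>) (val e' \<sigma> \<alpha>)"

fun fits :: "expr \<Rightarrow> store \<Rightarrow> arrays \<Rightarrow> bool" where
  "fits (Lit b) \<sigma> \<alpha> \<longleftrightarrow> b < 2 ^ w"
| "fits (a\<langle>i, j\<rangle>) \<sigma> \<alpha> \<longleftrightarrow> fits i \<sigma> \<alpha> \<and> fits j \<sigma> \<alpha> \<and> in_range a (val i \<sigma> \<alpha>) (val j \<sigma> \<alpha>)"
| "fits (Opr f e e') \<sigma> \<alpha> \<longleftrightarrow> fits e \<sigma> \<alpha> \<and> fits e' \<sigma> \<alpha> \<and> no_overflow w f (val e \<sigma> \<alpha>) (val e' \<sigma> \<alpha>)"
| "fits e \<sigma> \<alpha> \<longleftrightarrow> True"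

definition simulates :: "ram_state \<Rightarrow> store \<Rightarrow> arrays \<Rightarrow> bool" where
  "simulates r \<sigma> \<alpha> \<longleftrightarrow> reg r 0 = n \<and> reg r 1 = m \<and> (\<forall>x. reg r (vreg x) = \<sigma> x) \<and>
     (\<forall>a i j. in_range a i j \<longrightarrow> mem r (addr a i j) = \<alpha> a i j)"

lemma simulates_set_treg [simp]: "simulates (set_reg (treg d) b r) \<sigma> \<alpha> \<longleftrightarrow> simulates r \<sigma> \<alpha>"
  by (simp add: simulates_def set_reg_def)

lemma simulates_set_vreg: "simulates r \<sigma> \<alpha> \<Longrightarrow> simulates (set_reg (vreg x) b r) (\<sigma>(x := b)) \<alpha>"
  by (simp add: simulates_def set_reg_def)

lemma simulates_set_mem:
  "simulates r \<sigma> \<alpha> \<Longrightarrow> in_range a i j \<Longrightarrow> simulates (set_mem (addr a i j) b r) \<sigma> (upd \<alpha> a i j b)"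
  by (auto simp: simulates_def set_mem_def addr_eq)

lemma reg_set_reg: "reg (set_reg y b r) x = (if x = y then b else reg r x)"
  by (simp add: set_reg_def)

lemma run_locate:
  assumes start: "simulates r \<sigma> \<alpha>" "reg r (treg d) = i" "reg r (treg (Suc d)) = j"
    and in_range: "in_range a i j"
  shows "\<exists>r'. simulates r' \<sigma> \<alpha> \<and> reg r' (treg d) = addr a i j \<and>
    (\<forall>d'<d. reg r' (treg d') = reg r (treg d')) \<and>
    run w 9 (locate a d @ K, r) = return_pmf (K, r')"
proof -
  have inputs: "reg r 0 = n" "reg r 1 = m" using start(1) by (simp_all add: simulates_def)
  have "array_index a * block \<le> 10 * block" by (intro mult_le_mono1 array_index_le)
  then have bounds: "i * n + j < 2 ^ w" "n * n + n + m + m < 2 ^ w" "array_index a < 2 ^ w"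
    "block * array_index a < 2 ^ w" "i * n + j + block * array_index a < 2 ^ w"
    using in_range_block[OF in_range] array_index_le[of a] unfolding mult.commute[of block]
    by (intro less_word, simp add: block_def)+
  define regs where "regs = [(treg d, i * n), (treg d, i * n + j), (treg (Suc d), n * n),
    (treg (Suc d), n * n + n), (treg (Suc d), n * n + n + m), (treg (Suc d), block),
    (treg (Suc (Suc d)), array_index a), (treg (Suc d), block * array_index a), (treg d, addr a i j)]"
  define r' where "r' = fold (\<lambda>(y, b). set_reg y b) regs r"
  have nine: "(9 :: nat) = Suc (Suc (Suc (Suc (Suc (Suc (Suc (Suc (Suc 0))))))))" by simp
  have "run w 9 (locate a d @ K, r) = return_pmf (K, r')"
    unfolding nine r'_def regs_def using bounds start inputs
    by (simp add: locate_def Let_def run_Suc run_0 bind_return_pmf reg_set_reg block_def addr_def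
      ac_simps mult_2_right)
  moreover have "simulates r' \<sigma> \<alpha>" "reg r' (treg d) = addr a i j"
    "\<forall>d'<d. reg r' (treg d') = reg r (treg d')"
    using start(1) by (simp_all add: r'_def regs_def reg_set_reg)
  ultimately show ?thesis by blast
qed

text \<open>\<open>I\<close> computes \<open>b\<close> into the \<open>d\<close>-th scratch register in \<open>t\<close> steps.\<close>

definition evaluates :: "instr list \<Rightarrow> nat \<Rightarrow> nat \<Rightarrow> nat \<Rightarrow> store \<Rightarrow> arrays \<Rightarrow> bool" where
  "evaluates I d b t \<sigma> \<alpha> \<longleftrightarrow> (\<forall>r K. simulates r \<sigma> \<alpha> \<longrightarrow> (\<exists>r'. simulates r' \<sigma> \<alpha> \<and> reg r' (treg d) = b \<and>
     (\<forall>d'<d. reg r' (treg d') = reg r (treg d')) \<and> run w t (I @ K, r) = return_pmf (K, r')))"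

lemma evaluatesD:
  assumes "evaluates I d b t \<sigma> \<alpha>" "simulates r \<sigma> \<alpha>"
  obtains r' where "simulates r' \<sigma> \<alpha>" "reg r' (treg d) = b" "\<forall>d'<d. reg r' (treg d') = reg r (treg d')"
    "run w t (I @ K, r) = return_pmf (K, r')"
  using assms unfolding evaluates_def by blast

lemma evaluates_step:
  assumes "\<And>r K. simulates r \<sigma> \<alpha> \<Longrightarrow> step w (i # K, r) = return_pmf (K, set_reg (treg d) b r)"
  shows "evaluates [i] d b 1 \<sigma> \<alpha>"
  unfolding evaluates_def
proof (intro allI impI)
  fix r K
  assume "simulates r \<sigma> \<alpha>"
  then show "\<exists>r'. simulates r' \<sigma> \<alpha> \<and> reg r' (treg d) = b \<and> (\<forall>d'<d. reg r' (treg d') = reg r (treg d')) \<and>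
      run w 1 ([i] @ K, r) = return_pmf (K, r')"
    using assms by (intro exI[of _ "set_reg (treg d) b r"]) (simp add: run_1 reg_set_reg)
qed

lemma run_evaluates_pair:
  assumes "evaluates I d a s \<sigma> \<alpha>" "evaluates J (Suc d) b t \<sigma> \<alpha>" "simulates r \<sigma> \<alpha>"
  obtains r' where "simulates r' \<sigma> \<alpha>" "reg r' (treg d) = a" "reg r' (treg (Suc d)) = b"
    "\<forall>d'<d. reg r' (treg d') = reg r (treg d')" "run w (s + t) (I @ J @ K, r) = return_pmf (K, r')"
proof -
  obtain r1 where first: "simulates r1 \<sigma> \<alpha>" "reg r1 (treg d) = a"
    "\<forall>d'<d. reg r1 (treg d') = reg r (treg d')"
    "run w s (I @ J @ K, r) = return_pmf (J @ K, r1)"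
    using evaluatesD[OF assms(1,3)] by blast
  obtain r2 where second: "simulates r2 \<sigma> \<alpha>" "reg r2 (treg (Suc d)) = b"
    "\<forall>d'<Suc d. reg r2 (treg d') = reg r1 (treg d')" "run w t (J @ K, r1) = return_pmf (K, r2)"
    using evaluatesD[OF assms(2) first(1)] by blast
  show thesis
    by (rule that[OF second(1)]) (use first second run_trans[OF first(4) second(4)] in simp_all)
qed

lemma evaluates_Opr:
  assumes "evaluates I d a s \<sigma> \<alpha>" "evaluates J (Suc d) b t \<sigma> \<alpha>" "no_overflow w f a b"
  shows "evaluates (I @ J @ [Bin f (treg d) (treg d) (treg (Suc d))]) d (nat_op f a b) (s + t + 1) \<sigma> \<alpha>"
  unfolding evaluates_def append_assoc append_Cons append_Nil
proof (intro allI impI)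
  fix r K
  assume "simulates r \<sigma> \<alpha>"
  let ?bin = "Bin f (treg d) (treg d) (treg (Suc d))"
  obtain r1 where pair: "simulates r1 \<sigma> \<alpha>" "reg r1 (treg d) = a" "reg r1 (treg (Suc d)) = b"
    "\<forall>d'<d. reg r1 (treg d') = reg r (treg d')"
    "run w (s + t) (I @ J @ ?bin # K, r) = return_pmf (?bin # K, r1)"
    using run_evaluates_pair[OF assms(1,2) \<open>simulates r \<sigma> \<alpha>\<close>] by blast
  have "run w 1 (?bin # K, r1) = return_pmf (K, set_reg (treg d) (nat_op f a b) r1)"
    using pair(2,3) eval_op_eq_nat_op[OF assms(3)] by (simp only: run_1) simp
  from run_trans[OF pair(5) this] show "\<exists>r'. simulates r' \<sigma> \<alpha> \<and> reg r' (treg d) = nat_op f a b \<and>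
      (\<forall>d'<d. reg r' (treg d') = reg r (treg d')) \<and> run w (s + t + 1) (I @ J @ ?bin # K, r)
        = return_pmf (K, r')"
    using pair(1,4) by (intro exI[of _ "set_reg (treg d) (nat_op f a b) r1"]) (simp add: reg_set_reg)
qed

lemma evaluates_locate:
  assumes "evaluates I d i s \<sigma> \<alpha>" "evaluates J (Suc d) j t \<sigma> \<alpha>" "in_range a i j"
  shows "evaluates (I @ J @ locate a d) d (addr a i j) (s + t + 9) \<sigma> \<alpha>"
  unfolding evaluates_def append_assoc
proof (intro allI impI)
  fix r K
  assume "simulates r \<sigma> \<alpha>"
  then obtain r1 where pair: "simulates r1 \<sigma> \<alpha>" "reg r1 (treg d) = i" "reg r1 (treg (Suc d)) = j"
    "\<forall>d'<d. reg r1 (treg d') = reg r (treg d')"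
    "run w (s + t) (I @ J @ locate a d @ K, r) = return_pmf (locate a d @ K, r1)"
    using run_evaluates_pair[OF assms(1,2)] by blast
  obtain r2 where "simulates r2 \<sigma> \<alpha>" "reg r2 (treg d) = addr a i j"
    "\<forall>d'<d. reg r2 (treg d') = reg r1 (treg d')"
    "run w 9 (locate a d @ K, r1) = return_pmf (K, r2)"
    using run_locate[OF pair(1-3) assms(3)] by blast
  then show "\<exists>r'. simulates r' \<sigma> \<alpha> \<and> reg r' (treg d) = addr a i j \<and>
      (\<forall>d'<d. reg r' (treg d') = reg r (treg d')) \<and>
      run w (s + t + 9) (I @ J @ locate a d @ K, r) = return_pmf (K, r')"
    using pair(4) run_trans[OF pair(5)] by (intro exI[of _ r2]) simp
qed

lemma evaluates_Load:
  assumes "evaluates I d (addr a i j) t \<sigma> \<alpha>" "in_range a i j"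
  shows "evaluates (I @ [Load (treg d) (treg d)]) d (\<alpha> a i j) (t + 1) \<sigma> \<alpha>"
  unfolding evaluates_def append_assoc append_Cons append_Nil
proof (intro allI impI)
  fix r K
  assume "simulates r \<sigma> \<alpha>"
  then obtain r1 where addr: "simulates r1 \<sigma> \<alpha>" "reg r1 (treg d) = addr a i j"
    "\<forall>d'<d. reg r1 (treg d') = reg r (treg d')"
    "run w t (I @ Load (treg d) (treg d) # K, r) = return_pmf (Load (treg d) (treg d) # K, r1)"
    using evaluatesD[OF assms(1)] by blast
  have "run w 1 (Load (treg d) (treg d) # K, r1) = return_pmf (K, set_reg (treg d) (\<alpha> a i j) r1)"
    using addr(1,2) assms(2) by (simp only: run_1) (simp add: simulates_def)
  from run_trans[OF addr(4) this] show "\<exists>r'. simulates r' \<sigma> \<alpha> \<and> reg r' (treg d) = \<alpha> a i j \<and>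
      (\<forall>d'<d. reg r' (treg d') = reg r (treg d')) \<and>
      run w (t + 1) (I @ Load (treg d) (treg d) # K, r) = return_pmf (K, r')"
    using addr(1,3) by (intro exI[of _ "set_reg (treg d) (\<alpha> a i j) r1"]) (simp add: reg_set_reg)
qed

lemma evaluates_compile_expr: "fits e \<sigma> \<alpha> \<Longrightarrow> evaluates (compile_expr e d) d (val e \<sigma> \<alpha>) (steps e) \<sigma> \<alpha>"
proof (induction e arbitrary: d)
  case (Cell a i j)
  then show ?case
    using evaluates_Load[OF evaluates_locate[OF Cell.IH(1)[of d] Cell.IH(2)[of "Suc d"]]]
    by (simp add: ac_simps)
next
  case (Opr f e e')
  then show ?case using evaluates_Opr[OF Opr.IH(1)[of d] Opr.IH(2)[of "Suc d"]] by simp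
qed (auto intro!: evaluates_step simp: simulates_def)

subsection \<open>Big-step semantics with running time\<close>

inductive exec :: "com \<Rightarrow> store \<Rightarrow> arrays \<Rightarrow> nat \<Rightarrow> store \<Rightarrow> arrays \<Rightarrow> bool" where
  Skip: "exec SKIP \<sigma> \<alpha> 0 \<sigma> \<alpha>"
| Assign: "fits e \<sigma> \<alpha> \<Longrightarrow> exec (x ::= e) \<sigma> \<alpha> (steps e + 1) (\<sigma>(x := val e \<sigma> \<alpha>)) \<alpha>"
| Update: "fits (a\<langle>i, j\<rangle>) \<sigma> \<alpha> \<Longrightarrow> fits e \<sigma> \<alpha> \<Longrightarrow>
    exec (a\<langle>i, j\<rangle> \<leftarrow> e) \<sigma> \<alpha> (steps (a\<langle>i, j\<rangle>) + steps e) \<sigma> (upd \<alpha> a (val i \<sigma> \<alpha>) (val j \<sigma> \<alpha>) (val e \<sigma> \<alpha>))"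
| Seq: "exec c \<sigma> \<alpha> t \<sigma>' \<alpha>' \<Longrightarrow> exec c' \<sigma>' \<alpha>' t' \<sigma>'' \<alpha>'' \<Longrightarrow> exec (c;; c') \<sigma> \<alpha> (t + t') \<sigma>'' \<alpha>''"
| Branch: "fits e \<sigma> \<alpha> \<Longrightarrow> exec (if val e \<sigma> \<alpha> \<noteq> 0 then c else c') \<sigma> \<alpha> t \<sigma>' \<alpha>' \<Longrightarrow>
    exec (IF e THEN c ELSE c') \<sigma> \<alpha> (steps e + 1 + t) \<sigma>' \<alpha>'"
| Exit: "fits e \<sigma> \<alpha> \<Longrightarrow> val e \<sigma> \<alpha> = 0 \<Longrightarrow> exec (WHILE e DO c) \<sigma> \<alpha> (steps e + 1) \<sigma> \<alpha>"
| Repeat: "fits e \<sigma> \<alpha> \<Longrightarrow> val e \<sigma> \<alpha> \<noteq> 0 \<Longrightarrow> exec c \<sigma> \<alpha> t \<sigma>' \<alpha>' \<Longrightarrow>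
    exec (WHILE e DO c) \<sigma>' \<alpha>' t' \<sigma>'' \<alpha>'' \<Longrightarrow> exec (WHILE e DO c) \<sigma> \<alpha> (steps e + 1 + t + t') \<sigma>'' \<alpha>''"

lemma run_then_step:
  assumes "simulates r \<sigma> \<alpha>" "fits e \<sigma> \<alpha>"
    and "\<And>r'. simulates r' \<sigma> \<alpha> \<Longrightarrow> reg r' (treg 0) = val e \<sigma> \<alpha> \<Longrightarrow>
      \<exists>r''. simulates r'' \<sigma>' \<alpha>' \<and> step w (i # K, r') = return_pmf (K', r'')"
  shows "\<exists>r''. simulates r'' \<sigma>' \<alpha>' \<and>
    run w (steps e + 1) (compile_expr e 0 @ i # K, r) = return_pmf (K', r'')"
proof -
  obtain r' where evaluated: "simulates r' \<sigma> \<alpha>" "reg r' (treg 0) = val e \<sigma> \<alpha>"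
    "run w (steps e) (compile_expr e 0 @ i # K, r) = return_pmf (i # K, r')"
    using evaluatesD[OF evaluates_compile_expr[OF assms(2)] assms(1), of 0] by blast
  obtain r'' where stepped: "simulates r'' \<sigma>' \<alpha>'" "run w 1 (i # K, r') = return_pmf (K', r'')"
    using assms(3)[OF evaluated(1,2)] unfolding run_1 by blast
  show ?thesis using run_trans[OF evaluated(3) stepped(2)] stepped(1) by blast
qed

lemma run_compile_Update:
  assumes "simulates r \<sigma> \<alpha>" "fits (a\<langle>i, j\<rangle>) \<sigma> \<alpha>" "fits e \<sigma> \<alpha>"
  shows "\<exists>r'. simulates r' \<sigma> (upd \<alpha> a (val i \<sigma> \<alpha>) (val j \<sigma> \<alpha>) (val e \<sigma> \<alpha>)) \<and>
    run w (steps (a\<langle>i, j\<rangle>) + steps e) (compile (a\<langle>i, j\<rangle> \<leftarrow> e) @ K, r) = return_pmf (K, r')"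
proof -
  let ?store = "Store (treg 0) (treg 1)"
  let ?addr = "addr a (val i \<sigma> \<alpha>) (val j \<sigma> \<alpha>)"
  have address: "fits i \<sigma> \<alpha>" "fits j \<sigma> \<alpha>" "in_range a (val i \<sigma> \<alpha>) (val j \<sigma> \<alpha>)"
    using assms(2) by simp_all
  have "evaluates (compile_expr i 0 @ compile_expr j (Suc 0) @ locate a 0) 0 ?addr
      (steps i + steps j + 9) \<sigma> \<alpha>"
    by (intro evaluates_locate evaluates_compile_expr address)
  then obtain r1 where pair: "simulates r1 \<sigma> \<alpha>" "reg r1 (treg 0) = ?addr"
    "reg r1 (treg (Suc 0)) = val e \<sigma> \<alpha>"
    "run w (steps i + steps j + 9 + steps e) ((compile_expr i 0 @ compile_expr j (Suc 0) @ locate a 0) @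
      compile_expr e (Suc 0) @ ?store # K, r) = return_pmf (?store # K, r1)"
    using run_evaluates_pair[OF _ evaluates_compile_expr[OF assms(3)] assms(1)] by metis
  have "run w 1 (?store # K, r1) = return_pmf (K, set_mem ?addr (val e \<sigma> \<alpha>) r1)"
    using pair(2,3) by (simp only: run_1) (simp add: One_nat_def)
  from run_trans[OF pair(4) this] show ?thesis
    using simulates_set_mem[OF pair(1) address(3)] by (auto simp: One_nat_def ac_simps)
qed

lemma run_compile_IF:
  assumes "simulates r \<sigma> \<alpha>" "fits e \<sigma> \<alpha>"
  shows "\<exists>r'. simulates r' \<sigma> \<alpha> \<and> run w (steps e + 1) (compile (IF e THEN c ELSE c') @ K, r)
    = return_pmf (compile (if val e \<sigma> \<alpha> \<noteq> 0 then c else c') @ K, r')"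
  unfolding compile.simps append_assoc append_Cons append_Nil
  by (rule run_then_step[OF assms]) auto

lemma run_compile_WHILE:
  assumes "simulates r \<sigma> \<alpha>" "fits e \<sigma> \<alpha>"
  shows "\<exists>r'. simulates r' \<sigma> \<alpha> \<and> run w (steps e + 1) (compile (WHILE e DO c) @ K, r)
    = return_pmf (if val e \<sigma> \<alpha> \<noteq> 0 then compile c @ compile (WHILE e DO c) @ K else K, r')"
  unfolding compile.simps append_assoc append_Cons append_Nil
  by (rule run_then_step[OF assms]) auto

lemma run_compile:
  assumes "exec c \<sigma> \<alpha> t \<sigma>' \<alpha>'" "simulates r \<sigma> \<alpha>"
  shows "\<exists>r'. simulates r' \<sigma>' \<alpha>' \<and> run w t (compile c @ K, r) = return_pmf (K, r')"
  using assms
proof (induction arbitrary: r K)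
  case (Assign e \<sigma> \<alpha> x)
  show ?case
    unfolding compile.simps append_assoc append_Cons append_Nil
    by (rule run_then_step[OF Assign.prems Assign.hyps]) (simp add: simulates_set_vreg del: fun_upd_apply)
next
  case (Update a i j \<sigma> \<alpha> e)
  then show ?case by (intro run_compile_Update)
next
  case (Seq c \<sigma> \<alpha> t \<sigma>' \<alpha>' c' t' \<sigma>'' \<alpha>'')
  obtain r1 where first: "simulates r1 \<sigma>' \<alpha>'"
    "run w t (compile c @ compile c' @ K, r) = return_pmf (compile c' @ K, r1)"
    using Seq.IH(1)[OF Seq.prems] by blast
  obtain r2 where second: "simulates r2 \<sigma>'' \<alpha>''" "run w t' (compile c' @ K, r1) = return_pmf (K, r2)"
    using Seq.IH(2)[OF first(1)] by blast
  show ?case using run_trans[OF first(2) second(2)] second(1) by auto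
next
  case (Branch e \<sigma> \<alpha> c c' t \<sigma>' \<alpha>')
  let ?c = "if val e \<sigma> \<alpha> \<noteq> 0 then c else c'"
  obtain r1 where first: "simulates r1 \<sigma> \<alpha>"
    "run w (steps e + 1) (compile (IF e THEN c ELSE c') @ K, r) = return_pmf (compile ?c @ K, r1)"
    using run_compile_IF[OF Branch.prems Branch.hyps(1)] by blast
  obtain r2 where second: "simulates r2 \<sigma>' \<alpha>'" "run w t (compile ?c @ K, r1) = return_pmf (K, r2)"
    using Branch.IH[OF first(1)] by blast
  show ?case using run_trans[OF first(2) second(2)] second(1) by blast
next
  case (Exit e \<sigma> \<alpha> c)
  then show ?case using run_compile_WHILE[OF Exit.prems Exit.hyps(1), of c K] by simp
next
  case (Repeat e \<sigma> \<alpha> c t \<sigma>' \<alpha>' t' \<sigma>'' \<alpha>'')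
  let ?loop = "compile (WHILE e DO c)"
  obtain r1 where first: "simulates r1 \<sigma> \<alpha>"
    "run w (steps e + 1) (?loop @ K, r) = return_pmf (compile c @ ?loop @ K, r1)"
    using run_compile_WHILE[OF Repeat.prems Repeat.hyps(1), of c K] Repeat.hyps(2) by auto
  obtain r2 where second: "simulates r2 \<sigma>' \<alpha>'"
    "run w t (compile c @ ?loop @ K, r1) = return_pmf (?loop @ K, r2)"
    using Repeat.IH(1)[OF first(1)] by blast
  obtain r3 where third: "simulates r3 \<sigma>'' \<alpha>''" "run w t' (?loop @ K, r2) = return_pmf (K, r3)"
    using Repeat.IH(2)[OF second(1)] by blast
  show ?case using run_trans[OF run_trans[OF first(2) second(2)] third(2)] third(1) by blast
qed (auto simp: run_0)

lemma exec_frame: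
  "exec c \<sigma> \<alpha> t \<sigma>' \<alpha>' \<Longrightarrow> (\<forall>x. x \<notin> assigned c \<longrightarrow> \<sigma>' x = \<sigma> x) \<and> (\<forall>a. a \<notin> stored c \<longrightarrow> \<alpha>' a = \<alpha> a)"
  by (induction rule: exec.induct) (auto split: if_splits)

subsection \<open>Weakest preconditions with a step budget\<close>

text \<open>\<open>T\<close> is the budget; the postcondition sees what is left of it.\<close>

definition wp :: "com \<Rightarrow> (nat \<Rightarrow> store \<Rightarrow> arrays \<Rightarrow> bool) \<Rightarrow> nat \<Rightarrow> store \<Rightarrow> arrays \<Rightarrow> bool" where
  "wp c Q T \<sigma> \<alpha> \<longleftrightarrow> (\<exists>t \<sigma>' \<alpha>'. exec c \<sigma> \<alpha> t \<sigma>' \<alpha>' \<and> t \<le> T \<and> Q (T - t) \<sigma>' \<alpha>')"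

lemma wpI: "exec c \<sigma> \<alpha> t \<sigma>' \<alpha>' \<Longrightarrow> t \<le> T \<Longrightarrow> Q (T - t) \<sigma>' \<alpha>' \<Longrightarrow> wp c Q T \<sigma> \<alpha>"
  unfolding wp_def by blast

inductive_simps exec_SKIP: "exec SKIP \<sigma> \<alpha> t \<sigma>' \<alpha>'"
inductive_simps exec_Assign: "exec (x ::= e) \<sigma> \<alpha> t \<sigma>' \<alpha>'"
inductive_simps exec_Update: "exec (a\<langle>i, j\<rangle> \<leftarrow> e) \<sigma> \<alpha> t \<sigma>' \<alpha>'"
inductive_simps exec_Seq: "exec (c;; c') \<sigma> \<alpha> t \<sigma>' \<alpha>'"
inductive_simps exec_Branch: "exec (IF e THEN c ELSE c') \<sigma> \<alpha> t \<sigma>' \<alpha>'"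

lemma wp_SKIP: "wp SKIP Q T \<sigma> \<alpha> \<longleftrightarrow> Q T \<sigma> \<alpha>"
  by (simp add: wp_def exec_SKIP)

lemma wp_Assign:
  "wp (x ::= e) Q T \<sigma> \<alpha> \<longleftrightarrow>
     fits e \<sigma> \<alpha> \<and> steps e + 1 \<le> T \<and> Q (T - (steps e + 1)) (\<sigma>(x := val e \<sigma> \<alpha>)) \<alpha>"
  by (auto simp: wp_def exec_Assign)

lemma wp_Update:
  "wp (a\<langle>i, j\<rangle> \<leftarrow> e) Q T \<sigma> \<alpha> \<longleftrightarrow>
     fits (a\<langle>i, j\<rangle>) \<sigma> \<alpha> \<and> fits e \<sigma> \<alpha> \<and> steps (a\<langle>i, j\<rangle>) + steps e \<le> T \<and>
     Q (T - (steps (a\<langle>i, j\<rangle>) + steps e)) \<sigma> (upd \<alpha> a (val i \<sigma> \<alpha>) (val j \<sigma> \<alpha>) (val e \<sigma> \<alpha>))"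
  by (auto simp: wp_def exec_Update)

lemma wp_Seq: "wp (c;; c') Q T \<sigma> \<alpha> \<longleftrightarrow> wp c (wp c' Q) T \<sigma> \<alpha>"
proof
  assume "wp (c;; c') Q T \<sigma> \<alpha>"
  then obtain t t' \<sigma>' \<alpha>' \<sigma>'' \<alpha>'' where "exec c \<sigma> \<alpha> t \<sigma>' \<alpha>'" "exec c' \<sigma>' \<alpha>' t' \<sigma>'' \<alpha>''"
    "t + t' \<le> T" "Q (T - (t + t')) \<sigma>'' \<alpha>''"
    by (auto simp: wp_def exec_Seq)
  then show "wp c (wp c' Q) T \<sigma> \<alpha>"
    by (intro wpI[of c _ _ t \<sigma>' \<alpha>'] wpI[of c' _ _ t' \<sigma>'' \<alpha>'']) auto
next
  assume "wp c (wp c' Q) T \<sigma> \<alpha>"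
  then obtain t t' \<sigma>' \<alpha>' \<sigma>'' \<alpha>'' where "exec c \<sigma> \<alpha> t \<sigma>' \<alpha>'" "exec c' \<sigma>' \<alpha>' t' \<sigma>'' \<alpha>''"
    "t \<le> T" "t' \<le> T - t" "Q (T - t - t') \<sigma>'' \<alpha>''"
    by (auto simp: wp_def)
  then show "wp (c;; c') Q T \<sigma> \<alpha>"
    by (intro wpI[OF exec.Seq]) auto
qed

lemma wp_Branch:
  "wp (IF e THEN c ELSE c') Q T \<sigma> \<alpha> \<longleftrightarrow> fits e \<sigma> \<alpha> \<and> steps e + 1 \<le> T \<and>
     (val e \<sigma> \<alpha> \<noteq> 0 \<longrightarrow> wp c Q (T - (steps e + 1)) \<sigma> \<alpha>) \<and>
     (val e \<sigma> \<alpha> = 0 \<longrightarrow> wp c' Q (T - (steps e + 1)) \<sigma> \<alpha>)"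
  (is "?lhs \<longleftrightarrow> ?rhs")
proof
  assume ?lhs
  then obtain t \<sigma>' \<alpha>' where "exec (if val e \<sigma> \<alpha> \<noteq> 0 then c else c') \<sigma> \<alpha> t \<sigma>' \<alpha>'" "fits e \<sigma> \<alpha>"
    "steps e + 1 + t \<le> T" "Q (T - (steps e + 1 + t)) \<sigma>' \<alpha>'"
    by (auto simp: wp_def exec_Branch)
  then show ?rhs by (cases "val e \<sigma> \<alpha> = 0") (auto intro!: wpI)
next
  assume ?rhs
  then obtain t \<sigma>' \<alpha>' where "exec (if val e \<sigma> \<alpha> \<noteq> 0 then c else c') \<sigma> \<alpha> t \<sigma>' \<alpha>'" "fits e \<sigma> \<alpha>"
    "steps e + 1 \<le> T" "t \<le> T - (steps e + 1)" "Q (T - (steps e + 1) - t) \<sigma>' \<alpha>'"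
    unfolding wp_def by (cases "val e \<sigma> \<alpha> = 0") auto
  then show ?lhs
    by (intro wpI[OF exec.Branch]) auto
qed

lemmas wp_simps = wp_SKIP wp_Assign wp_Update wp_Seq wp_Branch Nat.le_diff_conv2

lemma wp_conseq:
  assumes "wp c (\<lambda>_. Q') C \<sigma> \<alpha>" "C \<le> T"
    and "\<And>t \<sigma>' \<alpha>'. T \<le> t + C \<Longrightarrow> t \<le> T \<Longrightarrow> (\<And>x. x \<notin> assigned c \<Longrightarrow> \<sigma>' x = \<sigma> x) \<Longrightarrow>
      (\<And>a. a \<notin> stored c \<Longrightarrow> \<alpha>' a = \<alpha> a) \<Longrightarrow> Q' \<sigma>' \<alpha>' \<Longrightarrow> Q t \<sigma>' \<alpha>'"
  shows "wp c Q T \<sigma> \<alpha>"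
proof -
  obtain t \<sigma>' \<alpha>' where run: "exec c \<sigma> \<alpha> t \<sigma>' \<alpha>'" "t \<le> C" "Q' \<sigma>' \<alpha>'"
    using assms(1) unfolding wp_def by blast
  have "Q (T - t) \<sigma>' \<alpha>'"
    by (rule assms(3)) (use run assms(2) exec_frame[OF run(1)] in auto)
  then show ?thesis using run assms(2) by (intro wpI[OF run(1)]) auto
qed

text \<open>The potential \<open>\<Phi>\<close> bounds the remaining running time of the loop.\<close>

lemma wp_While:
  assumes inv: "I \<sigma> \<alpha>" and potential: "\<Phi> \<sigma> \<alpha> \<le> T"
    and step: "\<And>\<sigma>' \<alpha>'. (\<And>x. x \<notin> assigned c \<Longrightarrow> \<sigma>' x = \<sigma> x) \<Longrightarrow> (\<And>a. a \<notin> stored c \<Longrightarrow> \<alpha>' a = \<alpha> a) \<Longrightarrow>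
      I \<sigma>' \<alpha>' \<Longrightarrow> fits e \<sigma>' \<alpha>' \<and> steps e + 1 \<le> \<Phi> \<sigma>' \<alpha>' \<and>
      (val e \<sigma>' \<alpha>' \<noteq> 0 \<longrightarrow> wp c (\<lambda>t \<sigma>'' \<alpha>''. I \<sigma>'' \<alpha>'' \<and> \<Phi> \<sigma>'' \<alpha>'' \<le> t) (\<Phi> \<sigma>' \<alpha>' - (steps e + 1)) \<sigma>' \<alpha>')"
  shows "wp (WHILE e DO c) (\<lambda>_ \<sigma>' \<alpha>'. I \<sigma>' \<alpha>' \<and> val e \<sigma>' \<alpha>' = 0) T \<sigma> \<alpha>"
proof -
  have "\<exists>t \<sigma>' \<alpha>'. exec (WHILE e DO c) \<sigma>1 \<alpha>1 t \<sigma>' \<alpha>' \<and> t \<le> \<Phi> \<sigma>1 \<alpha>1 \<and> I \<sigma>' \<alpha>' \<and> val e \<sigma>' \<alpha>' = 0"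
    if "I \<sigma>1 \<alpha>1" "\<forall>x. x \<notin> assigned c \<longrightarrow> \<sigma>1 x = \<sigma> x" "\<forall>a. a \<notin> stored c \<longrightarrow> \<alpha>1 a = \<alpha> a" for \<sigma>1 \<alpha>1
    using that
  proof (induction "\<Phi> \<sigma>1 \<alpha>1" arbitrary: \<sigma>1 \<alpha>1 rule: less_induct)
    case less
    have guard: "fits e \<sigma>1 \<alpha>1" "steps e + 1 \<le> \<Phi> \<sigma>1 \<alpha>1" using step[of \<sigma>1 \<alpha>1] less.prems by auto
    show ?case
    proof (cases "val e \<sigma>1 \<alpha>1 = 0")
      case True
      then show ?thesis using guard(2) less.prems(1) exec.Exit[OF guard(1) True] by blast
    next
      case False
      then obtain t \<sigma>2 \<alpha>2 where body: "exec c \<sigma>1 \<alpha>1 t \<sigma>2 \<alpha>2" "t \<le> \<Phi> \<sigma>1 \<alpha>1 - (steps e + 1)" "I \<sigma>2 \<alpha>2"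
        "\<Phi> \<sigma>2 \<alpha>2 \<le> \<Phi> \<sigma>1 \<alpha>1 - (steps e + 1) - t"
        using step[of \<sigma>1 \<alpha>1] less.prems unfolding wp_def by blast
      have "\<Phi> \<sigma>2 \<alpha>2 < \<Phi> \<sigma>1 \<alpha>1" using body(4) guard(2) by simp
      then obtain t' \<sigma>3 \<alpha>3 where "exec (WHILE e DO c) \<sigma>2 \<alpha>2 t' \<sigma>3 \<alpha>3" "t' \<le> \<Phi> \<sigma>2 \<alpha>2" "I \<sigma>3 \<alpha>3"
        "val e \<sigma>3 \<alpha>3 = 0"
        using less.hyps[OF _ body(3)] exec_frame[OF body(1)] less.prems(2,3)
        by (metis (no_types, lifting))
      then show ?thesis
        using body guard(2) exec.Repeat[OF guard(1) False body(1)]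
        by (intro exI[of _ "steps e + 1 + t + t'"] exI[of _ \<sigma>3] exI[of _ \<alpha>3]) simp
    qed
  qed
  from this[OF inv] show ?thesis using potential unfolding wp_def by (meson le_trans)
qed

lemma wp_For:
  assumes bound: "\<And>\<sigma>' \<alpha>'. (\<And>y. y \<noteq> x \<Longrightarrow> y \<notin> assigned c \<Longrightarrow> \<sigma>' y = \<sigma> y) \<Longrightarrow> fits e \<sigma>' \<alpha>' \<and> val e \<sigma>' \<alpha>' = N"
    and word: "N < 2 ^ w" and fresh: "x \<notin> assigned c"
    and cost: "N * (C + steps e + 7) + steps e + 5 \<le> T"
    and indep: "\<And>j \<sigma>' \<alpha>' b. I j (\<sigma>'(x := b)) \<alpha>' \<longleftrightarrow> I j \<sigma>' \<alpha>'"
    and init: "I 0 \<sigma> \<alpha>"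
    and step: "\<And>j \<sigma>' \<alpha>'. j < N \<Longrightarrow> \<sigma>' x = j \<Longrightarrow> (\<And>y. y \<noteq> x \<Longrightarrow> y \<notin> assigned c \<Longrightarrow> \<sigma>' y = \<sigma> y) \<Longrightarrow>
      (\<And>a. a \<notin> stored c \<Longrightarrow> \<alpha>' a = \<alpha> a) \<Longrightarrow> I j \<sigma>' \<alpha>' \<Longrightarrow> wp c (\<lambda>_. I (Suc j)) C \<sigma>' \<alpha>'"
  shows "wp (FOR x < e DO c) (\<lambda>_. I N) T \<sigma> \<alpha>"
proof -
  let ?c = "c;; x ::= V x \<oplus> Lit 1"
  let ?J = "\<lambda>\<sigma>' \<alpha>'. \<sigma>' x \<le> N \<and> I (\<sigma>' x) \<sigma>' \<alpha>'"
  let ?\<Phi> = "\<lambda>\<sigma>' (\<alpha>' :: arrays). (N - \<sigma>' x) * (C + steps e + 7) + steps e + 3"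
  have loop: "wp (WHILE V x \<prec> e DO ?c) (\<lambda>_ \<sigma>' \<alpha>'. ?J \<sigma>' \<alpha>' \<and> val (V x \<prec> e) \<sigma>' \<alpha>' = 0)
      (T - 2) (\<sigma>(x := 0)) \<alpha>"
  proof (rule wp_While[where \<Phi> = ?\<Phi>])
    show "?J (\<sigma>(x := 0)) \<alpha>" "?\<Phi> (\<sigma>(x := 0)) \<alpha> \<le> T - 2" using init cost by (simp_all add: indep)
    fix \<sigma>' \<alpha>'
    assume frame: "\<And>y. y \<notin> assigned ?c \<Longrightarrow> \<sigma>' y = (\<sigma>(x := 0)) y" "\<And>a. a \<notin> stored ?c \<Longrightarrow> \<alpha>' a = \<alpha> a"
      and inv: "?J \<sigma>' \<alpha>'"
    define j where "j = \<sigma>' x"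
    have limit: "fits e \<sigma>' \<alpha>'" "val e \<sigma>' \<alpha>' = N" using bound[of \<sigma>' \<alpha>'] frame(1) by auto
    have "wp ?c (\<lambda>t \<sigma>'' \<alpha>''. ?J \<sigma>'' \<alpha>'' \<and> ?\<Phi> \<sigma>'' \<alpha>'' \<le> t) (?\<Phi> \<sigma>' \<alpha>' - (steps e + 3)) \<sigma>' \<alpha>'" if "j < N"
    proof -
      have "N - j = Suc (N - Suc j)" using that by simp
      then have cost: "?\<Phi> \<sigma>' \<alpha>' = (N - Suc j) * (C + steps e + 7) + (C + steps e + 7) + steps e + 3"
        by (simp add: j_def)
      have body: "wp c (\<lambda>_. I (Suc j)) C \<sigma>' \<alpha>'"
        using frame inv that by (intro step) (auto simp: j_def)
      show ?thesis
        unfolding wp_Seq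
      proof (rule wp_conseq[OF body], goal_cases budget post)
        case (post t \<sigma>'' \<alpha>'')
        have "\<sigma>'' x = j" using post(3) fresh by (simp add: j_def)
        then show ?case
          using post(1,5) that word cost by (simp add: wp_simps indep Suc_eq_plus1)
      qed (use cost in simp)
    qed
    then show "fits (V x \<prec> e) \<sigma>' \<alpha>' \<and> steps (V x \<prec> e) + 1 \<le> ?\<Phi> \<sigma>' \<alpha>' \<and>
      (val (V x \<prec> e) \<sigma>' \<alpha>' \<noteq> 0 \<longrightarrow>
       wp ?c (\<lambda>t \<sigma>'' \<alpha>''. ?J \<sigma>'' \<alpha>'' \<and> ?\<Phi> \<sigma>'' \<alpha>'' \<le> t) (?\<Phi> \<sigma>' \<alpha>' - (steps (V x \<prec> e) + 1)) \<sigma>' \<alpha>')"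
      using limit by (simp add: j_def)
  qed
  have "val e \<sigma>' \<alpha>' = N" if "\<And>y. y \<notin> assigned ?c \<Longrightarrow> \<sigma>' y = (\<sigma>(x := 0)) y" for \<sigma>' \<alpha>'
    using bound[of \<sigma>' \<alpha>'] that by auto
  then have "wp (WHILE V x \<prec> e DO ?c) (\<lambda>_. I N) (T - 2) (\<sigma>(x := 0)) \<alpha>"
    by (intro wp_conseq[OF loop]) (auto split: if_splits)
  then show ?thesis using cost by (simp add: For_def wp_simps)
qed

end

section \<open>All-pairs shortest paths\<close>

abbreviation unreached :: expr where "unreached \<equiv> NumV \<oplus> NumV"

definition build_adjacency :: com where
  "build_adjacency = FOR Edge < NumE \<oplus> NumE DO
     (Mid ::= Ends\<langle>V Edge\<rangle>;;
      Prev\<langle>V Edge\<rangle> \<leftarrow> Head\<langle>V Mid\<rangle>;;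
      Head\<langle>V Mid\<rangle> \<leftarrow> V Edge \<oplus> Lit 1)"

definition visit :: com where
  "visit =
     (IF Dist\<langle>V Src, V Dst\<rangle> \<doteq> unreached
      THEN (Dist\<langle>V Src, V Dst\<rangle> \<leftarrow> V Level;;
            Queue\<langle>V Src, V Last\<rangle> \<leftarrow> V Dst;;
            Last ::= V Last \<oplus> Lit 1)
      ELSE SKIP)"

definition scan_edge :: com where
  "scan_edge =
     (Edge ::= V Edge \<ominus> Lit 1;;
      Dst ::= Ends\<langle>V Edge \<oplus> Lit 1 \<ominus> Lit 2 \<otimes> Opr OpMod (V Edge) (Lit 2)\<rangle>;;
      visit;;
      Edge ::= Prev\<langle>V Edge\<rangle>)"

definition scan_edges :: com where
  "scan_edges = WHILE V Edge DO scan_edge"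

definition expand :: com where
  "expand =
     (Mid ::= Queue\<langle>V Src, V First\<rangle>;;
      Level ::= Dist\<langle>V Src, V Mid\<rangle> \<oplus> Lit 1;;
      Edge ::= Head\<langle>V Mid\<rangle>;;
      scan_edges;;
      First ::= V First \<oplus> Lit 1)"

definition bfs_setup :: com where
  "bfs_setup =
     ((FOR Dst < NumV DO
        (Dist\<langle>V Src, V Dst\<rangle> \<leftarrow> unreached;;
         Queue\<langle>V Src, V Dst\<rangle> \<leftarrow> V Src));;
      Dist\<langle>V Src, V Src\<rangle> \<leftarrow> Lit 0;;
      First ::= Lit 0;;
      Last ::= Lit 1)"

definition bfs :: com where
  "bfs =
     (bfs_setup;;
      (WHILE V First \<prec> V Last DO expand);;
      Ample\<langle>V Src\<rangle> \<leftarrow> Lit 1 \<ominus> (V Last \<prec> V Row_len))"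

definition all_pairs :: com where
  "all_pairs = (build_adjacency;; (FOR Src < NumV DO bfs))"

lemma assigned_apsp [simp]:
  "assigned build_adjacency = {Edge, Mid}"
  "assigned visit = {Last}"
  "assigned scan_edge = {Edge, Dst, Last}"
  "assigned scan_edges = {Edge, Dst, Last}"
  "assigned expand = {Mid, Level, Edge, Dst, Last, First}"
  "assigned bfs_setup = {Dst, First, Last}"
  "assigned bfs = {Dst, First, Last, Mid, Level, Edge}"
  "assigned all_pairs = {Src, Dst, First, Last, Mid, Level, Edge}"
  by (auto simp: build_adjacency_def visit_def scan_edge_def scan_edges_def expand_def bfs_setup_def
    bfs_def all_pairs_def)

lemma stored_apsp [simp]:
  "stored build_adjacency = {Prev, Head}"
  "stored visit = {Dist, Queue}"
  "stored scan_edge = {Dist, Queue}"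
  "stored scan_edges = {Dist, Queue}"
  "stored expand = {Dist, Queue}"
  "stored bfs_setup = {Dist, Queue}"
  "stored bfs = {Dist, Queue, Ample}"
  "stored all_pairs = {Prev, Head, Dist, Queue, Ample}"
  by (auto simp: build_adjacency_def visit_def scan_edge_def scan_edges_def expand_def bfs_setup_def
    bfs_def all_pairs_def)

locale graph_input = finite_graph n E + machine n m w for n E m w +
  fixes es :: "(nat \<times> nat) list"
  assumes listing: "edge_listing E es" and m_eq: "m = length es"
begin

text \<open>Each edge of the input consists of the half-edges \<open>2 * i\<close> and \<open>2 * i + 1\<close>.\<close>

definition ep :: "nat \<Rightarrow> nat" where
  "ep e = (if even e then fst (es ! (e div 2)) else snd (es ! (e div 2)))"

abbreviation opposite :: "nat \<Rightarrow> nat" where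
  "opposite e \<equiv> e + 1 - 2 * (e mod 2)"

lemma E_eq: "E = (\<lambda>x. {fst x, snd x}) ` set es"
  using listing by (simp add: edge_listing_def case_prod_beta)

lemma half_edge:
  assumes "e < 2 * m"
  shows "{ep e, ep (opposite e)} \<in> E"
proof -
  have listed: "es ! (e div 2) \<in> set es" using assms m_eq by (intro nth_mem) linarith
  show ?thesis
  proof (cases "even e")
    case True
    then have "opposite e = e + 1" "odd (e + 1)" "(e + 1) div 2 = e div 2"
      by (auto simp: even_iff_mod_2_eq_zero)
    then show ?thesis using imageI[OF listed] True by (simp add: E_eq ep_def)
  next
    case False
    then have "opposite e = e - 1" "even (e - 1)" "(e - 1) div 2 = e div 2" by (auto elim!: oddE)
    then show ?thesis using imageI[OF listed] False by (simp add: E_eq ep_def insert_commute)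
  qed
qed

lemma half_edge_ex:
  assumes "{u, v} \<in> E"
  obtains e where "e < 2 * m" "ep e = u" "ep (opposite e) = v"
proof -
  obtain x where listed: "x \<in> set es" "{u, v} = {fst x, snd x}" using assms by (auto simp: E_eq)
  then obtain i where index: "i < m" "es ! i = x" by (auto simp: in_set_conv_nth m_eq)
  have "ep (2 * i) = fst x" "ep (2 * i + 1) = snd x" using index by (auto simp: ep_def)
  moreover have "opposite (2 * i) = 2 * i + 1" "opposite (2 * i + 1) = 2 * i" by auto
  moreover have "u = fst x \<and> v = snd x \<or> u = snd x \<and> v = fst x"
    using listed by (auto simp: doubleton_eq_iff)
  ultimately show thesis
    using index that[of "2 * i"] that[of "2 * i + 1"] by auto
qed

lemma ep_less: "e < 2 * m \<Longrightarrow> ep e < n"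
  using half_edge edge_less by blast

definition adjacency :: "arrays \<Rightarrow> bool" where
  "adjacency \<alpha> \<longleftrightarrow> (\<forall>e<2 * m. \<alpha> Ends 0 e = ep e \<and> \<alpha> Prev 0 e = prev ep e (ep e)) \<and>
     (\<forall>v<n. \<alpha> Head 0 v = prev ep (2 * m) v)"

lemma adjacency_cong: "(\<And>a. a \<notin> {Dist, Queue, Ample} \<Longrightarrow> \<alpha>' a = \<alpha> a) \<Longrightarrow> adjacency \<alpha> \<Longrightarrow> adjacency \<alpha>'"
  by (simp add: adjacency_def)

lemma wp_build_adjacency:
  assumes "\<And>e. e < 2 * m \<Longrightarrow> \<alpha> Ends 0 e = ep e" "\<And>v. v < n \<Longrightarrow> \<alpha> Head 0 v = 0"
  shows "wp build_adjacency (\<lambda>_ _. adjacency) (m * 124 + 10) \<sigma> \<alpha>"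
proof -
  let ?I = "\<lambda>j (\<sigma>' :: store) \<alpha>'. (\<forall>e<j. \<alpha>' Prev 0 e = prev ep e (ep e)) \<and>
      (\<forall>v<n. \<alpha>' Head 0 v = prev ep j v)"
  have "wp build_adjacency (\<lambda>_. ?I (2 * m)) (m * 124 + 10) \<sigma> \<alpha>"
    unfolding build_adjacency_def
  proof (rule wp_For[where N = "2 * m" and C = 52 and I = ?I],
      goal_cases bound word fresh cost indep init step)
    case (step e \<sigma>' \<alpha>')
    have "\<alpha>' Ends = \<alpha> Ends" using step(4)[of Ends] by simp
    moreover have "e + 1 < 2 ^ w" using step(1) by (intro less_word) simp
    ultimately show ?case using step assms(1) ep_less
      by (simp add: wp_simps less_Suc_eq flip: Suc_eq_plus1)
  qed (use assms(2) in \<open>auto intro!: less_word\<close>)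
  then show ?thesis
    by (rule wp_conseq) (use assms(1) in \<open>auto simp: adjacency_def build_adjacency_def\<close>)
qed

definition bfs_state :: "nat \<Rightarrow> nat \<Rightarrow> nat \<Rightarrow> arrays \<Rightarrow> bool" where
  "bfs_state s qh qt \<alpha> \<longleftrightarrow> bfs_queue s qt (\<alpha> Queue s) (\<alpha> Dist s) \<and> bfs_head s qh qt (\<alpha> Queue s) \<and>
     (\<forall>i<n. \<alpha> Queue s i < n)"

definition queue_extends :: "nat \<Rightarrow> nat \<Rightarrow> arrays \<Rightarrow> arrays \<Rightarrow> bool" where
  "queue_extends s qt \<alpha> \<alpha>' \<longleftrightarrow> (\<forall>r. r \<noteq> s \<longrightarrow> \<alpha>' Dist r = \<alpha> Dist r \<and> \<alpha>' Queue r = \<alpha> Queue r) \<and>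
     (\<forall>i<qt. \<alpha>' Queue s i = \<alpha> Queue s i)"

lemma queue_extends_image:
  "queue_extends s qt \<alpha> \<alpha>' \<Longrightarrow> i \<le> qt \<Longrightarrow> \<alpha>' Queue s ` {..<i} = \<alpha> Queue s ` {..<i}"
  by (intro image_cong) (auto simp: queue_extends_def)

lemma wp_visit:
  assumes vars: "\<sigma> Src = s" "\<sigma> Dst = u" "\<sigma> Last = qt" "\<sigma> Level = d s (\<alpha> Queue s qh) + 1"
    and state: "bfs_state s qh qt \<alpha>" "qh < qt" and edge: "{\<alpha> Queue s qh, u} \<in> E" and s_less: "s < n"
  shows "wp visit (\<lambda>_ \<sigma>' \<alpha>'. bfs_state s qh (\<sigma>' Last) \<alpha>' \<and> qt \<le> \<sigma>' Last \<and> u \<in> \<alpha>' Queue s ` {..<\<sigma>' Last} \<and>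
     queue_extends s qt \<alpha> \<alpha>') 50 \<sigma> \<alpha>"
proof -
  have queue: "bfs_queue s qt (\<alpha> Queue s) (\<alpha> Dist s)" and head: "bfs_head s qh qt (\<alpha> Queue s)"
    using state(1) by (simp_all add: bfs_state_def)
  have u_less: "u < n" using edge by (rule edge_less)
  have reached: "\<alpha> Dist s u = 2 * n \<longleftrightarrow> u \<notin> \<alpha> Queue s ` {..<qt}"
    using queue u_less by (auto simp: bfs_queue_def)
  have two_n: "2 * n < 2 ^ w" using n_pos by (intro less_word) simp
  show ?thesis
  proof (cases "\<alpha> Dist s u = 2 * n")
    case False
    then show ?thesis
      using reached assms u_less two_n by (simp add: visit_def wp_simps queue_extends_def)
  next
    case True
    then have "u \<notin> \<alpha> Queue s ` {..<qt}" using reached by simp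
    note push = bfs_push[OF queue head state(2) s_less edge this, folded Suc_eq_plus1]
    have "qt < n" using bfs_queue_le[OF push(1)] by simp
    moreover from this have "Suc qt < 2 ^ w" by (intro less_word) simp
    ultimately show ?thesis
      using True vars s_less u_less state push two_n
      by (simp add: visit_def wp_simps queue_extends_def bfs_state_def flip: Suc_eq_plus1)
  qed
qed

definition scan_inv :: "nat \<Rightarrow> nat \<Rightarrow> nat \<Rightarrow> arrays \<Rightarrow> store \<Rightarrow> arrays \<Rightarrow> bool" where
  "scan_inv s qh v \<alpha> \<sigma>' \<alpha>' \<longleftrightarrow> bfs_state s qh (\<sigma>' Last) \<alpha>' \<and> qh < \<sigma>' Last \<and> queue_extends s (Suc qh) \<alpha> \<alpha>' \<and>
     (\<exists>j\<le>2 * m. \<sigma>' Edge = prev ep j v \<and>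
       (\<forall>e<2 * m. j \<le> e \<longrightarrow> ep e = v \<longrightarrow> ep (opposite e) \<in> \<alpha>' Queue s ` {..<\<sigma>' Last}))"

lemma scan_inv_step:
  assumes "scan_inv s qh v \<alpha> \<sigma>' \<alpha>'" "\<sigma>' Edge = Suc e"
  shows "e < 2 * m" "ep e = v" "out_degree ep (Suc e) v = out_degree ep e v + 1"
    "\<And>e'. e' < 2 * m \<Longrightarrow> prev ep e v \<le> e' \<Longrightarrow> ep e' = v \<Longrightarrow>
      e' = e \<or> ep (opposite e') \<in> \<alpha>' Queue s ` {..<\<sigma>' Last}"
proof -
  obtain j where pointer: "j \<le> 2 * m" "prev ep j v = Suc e"
    "\<And>e. e < 2 * m \<Longrightarrow> j \<le> e \<Longrightarrow> ep e = v \<Longrightarrow> ep (opposite e) \<in> \<alpha>' Queue s ` {..<\<sigma>' Last}"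
    using assms unfolding scan_inv_def by auto
  show "e < 2 * m" "ep e = v" using pointer(1,2) prev_le[of ep j v] prev_leaves[OF pointer(2)] by auto
  then show "out_degree ep (Suc e) v = out_degree ep e v + 1" by simp
  fix e' assume later: "e' < 2 * m" "prev ep e v \<le> e'" "ep e' = v"
  have "\<not> e' < e" using prev_last[OF later(2)] later(3) by blast
  moreover have "\<not> (Suc e \<le> e' \<and> e' < j)" using prev_last[of ep j v e'] pointer(2) later(3) by auto
  ultimately show "e' = e \<or> ep (opposite e') \<in> \<alpha>' Queue s ` {..<\<sigma>' Last}"
    using pointer(3)[OF later(1) _ later(3)] by (cases "e' = e"; cases "j \<le> e'") auto
qed

lemma wp_scan_edge:
  assumes inv: "scan_inv s qh v \<alpha> \<sigma>' \<alpha>'" "\<alpha> Queue s qh = v" and edge: "\<sigma>' Edge = Suc e"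
    and vars': "\<sigma>' Src = s" "\<sigma>' Level = d s v + 1" and adj: "adjacency \<alpha>'" and s_less: "s < n"
  shows "wp scan_edge (\<lambda>_ \<sigma>'' \<alpha>''. scan_inv s qh v \<alpha> \<sigma>'' \<alpha>'' \<and> \<sigma>'' Edge = prev ep e v) 88 \<sigma>' \<alpha>'"
proof -
  note edge = edge scan_inv_step[OF inv(1) edge]
  have state: "bfs_state s qh (\<sigma>' Last) \<alpha>'" "qh < \<sigma>' Last" "queue_extends s (Suc qh) \<alpha> \<alpha>'"
    using inv(1) by (simp_all add: scan_inv_def)
  have front: "\<alpha>' Queue s qh = v" using state(3) inv(2) by (simp add: queue_extends_def)
  have opposite: "2 * (e mod 2) \<le> e + 1" "opposite e < 2 * m" using edge(2) by presburger+
  have bounds: "Suc e < 2 ^ w" "e + 1 < 2 ^ w" "2 * (e mod 2) < 2 ^ w" "2 < (2::nat) ^ w"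
    using edge(2) opposite(1) by (intro less_word; simp)+
  define \<sigma>1 where "\<sigma>1 = \<sigma>'(Edge := e, Dst := ep (opposite e))"
  have visit: "wp visit (\<lambda>_ \<sigma>'' \<alpha>''. bfs_state s qh (\<sigma>'' Last) \<alpha>'' \<and> \<sigma>' Last \<le> \<sigma>'' Last \<and>
      ep (opposite e) \<in> \<alpha>'' Queue s ` {..<\<sigma>'' Last} \<and> queue_extends s (\<sigma>' Last) \<alpha>' \<alpha>'') 50 \<sigma>1 \<alpha>'"
    using vars' front state s_less half_edge[OF edge(2)] edge(3)
    by (intro wp_visit) (simp_all add: \<sigma>1_def)
  have "wp (visit;; Edge ::= Prev\<langle>V Edge\<rangle>)
      (\<lambda>_ \<sigma>'' \<alpha>''. scan_inv s qh v \<alpha> \<sigma>'' \<alpha>'' \<and> \<sigma>'' Edge = prev ep e v) 63 \<sigma>1 \<alpha>'"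
    unfolding wp_Seq
  proof (rule wp_conseq[OF visit], goal_cases budget post)
    case (post t \<sigma>'' \<alpha>'')
    have "queue_extends s (Suc qh) \<alpha> \<alpha>''" using post(5) state(2,3) by (simp add: queue_extends_def)
    moreover have "\<alpha>' Queue s ` {..<\<sigma>' Last} \<subseteq> \<alpha>'' Queue s ` {..<\<sigma>'' Last}"
      using post(5) queue_extends_image[of s "\<sigma>' Last" \<alpha>' \<alpha>'', OF _ le_refl]
      by (metis image_mono lessThan_subset_iff)
    then have "ep (opposite e') \<in> \<alpha>'' Queue s ` {..<\<sigma>'' Last}" if "e' < 2 * m" "e \<le> e'" "ep e' = v" for e'
      using edge(5)[OF that(1) _ that(3)] that(2) post(5) prev_le[of ep e v] by (auto dest: subsetD)
    moreover have "\<alpha>'' Prev 0 e = prev ep e v" "\<sigma>'' Edge = e"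
      using post(3,4) adj edge(2,3) by (auto simp: adjacency_def \<sigma>1_def)
    ultimately show ?case
      using post(1,5) state(2) edge(2) by (auto simp: wp_simps scan_inv_def intro!: exI[of _ e])
  qed simp
  then show ?thesis
    using edge opposite bounds vars' adj
    by (simp add: scan_edge_def wp_Seq wp_Assign adjacency_def \<sigma>1_def)
qed

lemma scan_inv_exit:
  assumes "scan_inv s qh v \<alpha> \<sigma>' \<alpha>'" "\<sigma>' Edge = 0" "{v, u} \<in> E"
  shows "u \<in> \<alpha>' Queue s ` {..<\<sigma>' Last}"
proof -
  obtain e where edge: "e < 2 * m" "ep e = v" "ep (opposite e) = u" using half_edge_ex[OF assms(3)]
    by blast
  obtain j where "prev ep j v = 0"
    "\<And>e. e < 2 * m \<Longrightarrow> j \<le> e \<Longrightarrow> ep e = v \<Longrightarrow> ep (opposite e) \<in> \<alpha>' Queue s ` {..<\<sigma>' Last}"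
    using assms(1,2) unfolding scan_inv_def by auto
  then show ?thesis using prev_last[of ep j v e] edge by (cases "j \<le> e") auto
qed

lemma wp_scan_edges:
  assumes vars: "\<sigma> Src = s" "\<sigma> Level = d s v + 1" "\<sigma> Edge = prev ep (2 * m) v"
    and adj: "adjacency \<alpha>" and s_less: "s < n"
    and state: "bfs_state s qh (\<sigma> Last) \<alpha>" "qh < \<sigma> Last" "\<alpha> Queue s qh = v"
  shows "wp scan_edges (\<lambda>_ \<sigma>' \<alpha>'. bfs_state s qh (\<sigma>' Last) \<alpha>' \<and> qh < \<sigma>' Last \<and>
      queue_extends s (Suc qh) \<alpha> \<alpha>' \<and>
     (\<forall>u. {v, u} \<in> E \<longrightarrow> u \<in> \<alpha>' Queue s ` {..<\<sigma>' Last})) (out_degree ep (2 * m) v * 90 + 2) \<sigma> \<alpha>"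
proof -
  let ?\<Phi> = "\<lambda>\<sigma>' (\<alpha>' :: arrays). out_degree ep (\<sigma>' Edge) v * 90 + 2"
  have "wp scan_edges (\<lambda>_ \<sigma>' \<alpha>'. scan_inv s qh v \<alpha> \<sigma>' \<alpha>' \<and> val (V Edge) \<sigma>' \<alpha>' = 0)
      (out_degree ep (2 * m) v * 90 + 2) \<sigma> \<alpha>"
    unfolding scan_edges_def
  proof (rule wp_While[where \<Phi> = ?\<Phi>], goal_cases init cost step)
    case init
    show ?case using state vars(3) by (auto simp: scan_inv_def queue_extends_def)
  next
    case (step \<sigma>' \<alpha>')
    have adj': "adjacency \<alpha>'" using adj by (rule adjacency_cong[rotated]) (use step(2) in simp)
    show ?case
    proof (cases "\<sigma>' Edge")
      case (Suc e)
      have "\<sigma>' Src = s" "\<sigma>' Level = d s v + 1" using step(1) vars by simp_all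
      note body = wp_scan_edge[where \<sigma>' = \<sigma>', OF step(3) state(3) Suc this adj' s_less]
      have "out_degree ep (\<sigma>' Edge) v = out_degree ep e v + 1"
        using scan_inv_step(3)[OF step(3) Suc] Suc by simp
      then show ?thesis using step by (auto intro!: wp_conseq[OF body])
    qed (use step in simp)
  qed (use vars(3) in simp)
  then show ?thesis
  proof (rule wp_conseq, goal_cases budget post)
    case (post t \<sigma>' \<alpha>')
    then have inv: "scan_inv s qh v \<alpha> \<sigma>' \<alpha>'" "\<sigma>' Edge = 0" by simp_all
    show ?case using inv(1) scan_inv_exit[OF inv] by (simp add: scan_inv_def)
  qed simp
qed

lemma wp_expand:
  assumes vars: "\<sigma> Src = s" "\<sigma> First = qh" "qh < \<sigma> Last"
    and adj: "adjacency \<alpha>" and s_less: "s < n" and state: "bfs_state s qh (\<sigma> Last) \<alpha>"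
  shows "wp expand (\<lambda>_ \<sigma>' \<alpha>'. \<sigma>' First = Suc qh \<and> Suc qh \<le> \<sigma>' Last \<and> bfs_state s (Suc qh) (\<sigma>' Last) \<alpha>' \<and>
     queue_extends s (Suc qh) \<alpha> \<alpha>') (out_degree ep (2 * m) (\<alpha> Queue s qh) * 90 + 50) \<sigma> \<alpha>"
proof -
  define v where "v = \<alpha> Queue s qh"
  define \<sigma>1 where "\<sigma>1 = \<sigma>(Mid := v, Level := d s v + 1, Edge := prev ep (2 * m) v)"
  have queue: "bfs_queue s (\<sigma> Last) (\<alpha> Queue s) (\<alpha> Dist s)" using state by (simp add: bfs_state_def)
  have front: "v < n" "\<alpha> Dist s v = d s v" "d s v < 2 * n" and "qh < n"
    using queue vars(3) bfs_queueD(2,3)[OF queue] bfs_queue_le[OF queue]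
    by (auto simp: bfs_queue_def v_def)
  then have bounds: "d s v + 1 < 2 ^ w" "qh + 1 < 2 ^ w" by (intro less_word; simp)+
  have scan: "wp scan_edges (\<lambda>_ \<sigma>' \<alpha>'. bfs_state s qh (\<sigma>' Last) \<alpha>' \<and> qh < \<sigma>' Last \<and>
      queue_extends s (Suc qh) \<alpha> \<alpha>' \<and> (\<forall>u. {v, u} \<in> E \<longrightarrow> u \<in> \<alpha>' Queue s ` {..<\<sigma>' Last}))
      (out_degree ep (2 * m) v * 90 + 2) \<sigma>1 \<alpha>"
    using vars adj s_less state by (intro wp_scan_edges) (simp_all add: \<sigma>1_def v_def)
  have "wp (scan_edges;; First ::= V First \<oplus> Lit 1)
      (\<lambda>_ \<sigma>' \<alpha>'. \<sigma>' First = Suc qh \<and> Suc qh \<le> \<sigma>' Last \<and> bfs_state s (Suc qh) (\<sigma>' Last) \<alpha>' \<and>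
       queue_extends s (Suc qh) \<alpha> \<alpha>') T \<sigma>1 \<alpha>" if time: "out_degree ep (2 * m) v * 90 + 6 \<le> T" for T
    unfolding wp_Seq
  proof (rule wp_conseq[OF scan], goal_cases budget post)
    case (post t \<sigma>' \<alpha>')
    have queue': "bfs_queue s (\<sigma>' Last) (\<alpha>' Queue s) (\<alpha>' Dist s)" "bfs_head s qh (\<sigma>' Last) (\<alpha>' Queue s)"
      "qh < \<sigma>' Last"
      using post(5) by (simp_all add: bfs_state_def)
    have "\<alpha>' Queue s qh = v" using post(5) by (simp add: queue_extends_def v_def)
    then have "bfs_head s (Suc qh) (\<sigma>' Last) (\<alpha>' Queue s)"
      using bfs_advance[OF queue' s_less] post(5) by simp
    moreover have "\<sigma>' First = qh" using post(3)[of First] vars(2) by (simp add: \<sigma>1_def)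
    ultimately show ?case
      using post(1,5) time bounds by (simp add: wp_simps bfs_state_def)
  qed (use time in simp)
  moreover have "\<alpha> Head 0 v = prev ep (2 * m) v" using adj front(1) by (simp add: adjacency_def)
  ultimately show ?thesis
    using vars front s_less \<open>qh < n\<close> bounds by (simp add: expand_def wp_Seq wp_Assign \<sigma>1_def flip: v_def)
qed

lemma sum_diff_image_Suc:
  fixes f :: "nat \<Rightarrow> nat"
  assumes "finite A" "inj_on g {..<N}" "i < N" "g i \<in> A"
  shows "sum f (A - g ` {..<i}) = f (g i) + sum f (A - g ` {..<Suc i})"
proof -
  have "g i \<notin> g ` {..<i}" using assms(3) inj_onD[OF assms(2)] by force
  then have "A - g ` {..<i} = insert (g i) (A - g ` {..<Suc i})" "g i \<notin> A - g ` {..<Suc i}"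
    using assms(4) by (auto simp: lessThan_Suc)
  then show ?thesis using assms(1) by (simp only: sum.insert finite_Diff not_False_eq_True)
qed

lemma wp_expand_loop:
  assumes vars: "\<sigma> Src = s" "\<sigma> First = 0" "\<sigma> Last = 1"
    and adj: "adjacency \<alpha>" and s_less: "s < n" and state: "bfs_state s 0 1 \<alpha>"
  shows "wp (WHILE V First \<prec> V Last DO expand) (\<lambda>_ \<sigma>' \<alpha>'. bfs_state s (\<sigma>' Last) (\<sigma>' Last) \<alpha>' \<and>
     queue_extends s 0 \<alpha> \<alpha>') (180 * m + 60 * n + 4) \<sigma> \<alpha>"
proof -
  define weight where "weight v = out_degree ep (2 * m) v * 90 + 60" for v
  define unread where "unread \<sigma>' \<alpha>' = {..<n} - \<alpha>' Queue s ` {..<\<sigma>' First}" for \<sigma>' :: store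
    and \<alpha>' :: arrays
  let ?I = "\<lambda>\<sigma>' \<alpha>'. bfs_state s (\<sigma>' First) (\<sigma>' Last) \<alpha>' \<and> \<sigma>' First \<le> \<sigma>' Last \<and> queue_extends s 0 \<alpha> \<alpha>'"
  let ?\<Phi> = "\<lambda>\<sigma>' \<alpha>'. sum weight (unread \<sigma>' \<alpha>') + 4"
  have "sum weight {..<n} = 180 * m + 60 * n"
    using sum_out_degree[of "2 * m" ep n] ep_less
    by (simp add: weight_def sum.distrib flip: sum_distrib_right)
  then have "wp (WHILE V First \<prec> V Last DO expand) (\<lambda>_ \<sigma>' \<alpha>'. ?I \<sigma>' \<alpha>' \<and> val (V First \<prec> V Last) \<sigma>' \<alpha>' = 0)
      (180 * m + 60 * n + 4) \<sigma> \<alpha>"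
  proof (intro wp_While[where \<Phi> = ?\<Phi>], goal_cases init cost step)
    case (step \<sigma>' \<alpha>')
    define qh where "qh = \<sigma>' First"
    have "wp expand (\<lambda>t \<sigma>'' \<alpha>''. ?I \<sigma>'' \<alpha>'' \<and> ?\<Phi> \<sigma>'' \<alpha>'' \<le> t) (?\<Phi> \<sigma>' \<alpha>' - 4) \<sigma>' \<alpha>'" if "qh < \<sigma>' Last"
    proof -
      have state': "bfs_state s qh (\<sigma>' Last) \<alpha>'" using step(4) by (simp add: qh_def)
      then have queue: "bfs_queue s (\<sigma>' Last) (\<alpha>' Queue s) (\<alpha>' Dist s)" by (simp add: bfs_state_def)
      have "sum weight (unread \<sigma>' \<alpha>') = weight (\<alpha>' Queue s qh)
          + sum weight ({..<n} - \<alpha>' Queue s ` {..<Suc qh})"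
        unfolding unread_def qh_def[symmetric] using bfs_queueD(1,2)[OF queue] that
        by (intro sum_diff_image_Suc) auto
      note cost = this[unfolded weight_def[of "\<alpha>' Queue s qh"]]
      have adj': "adjacency \<alpha>'" using adj by (rule adjacency_cong[rotated]) (use step(3) in simp)
      have "\<sigma>' Src = s" using step(2) vars(1) by simp
      note body = wp_expand[where \<sigma> = \<sigma>', OF this qh_def[symmetric] that adj' s_less state']
      show ?thesis
      proof (rule wp_conseq[OF body], goal_cases budget post)
        case (post t \<sigma>'' \<alpha>'')
        then have "\<alpha>'' Queue s ` {..<Suc qh} = \<alpha>' Queue s ` {..<Suc qh}"
          by (intro queue_extends_image) auto
        then have "?\<Phi> \<sigma>'' \<alpha>'' \<le> t" using post(1,5) cost by (simp add: unread_def)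
        then show ?case using post(5) step(4) by (simp add: queue_extends_def)
      qed (use cost in simp)
    qed
    then show ?case by (simp add: qh_def)
  qed (use vars state in \<open>simp_all add: unread_def queue_extends_def\<close>)
  then show ?thesis by (rule wp_conseq) auto
qed

lemma wp_bfs_setup:
  assumes vars: "\<sigma> Src = s" and s_less: "s < n"
  shows "wp bfs_setup (\<lambda>_ \<sigma>' \<alpha>'. \<sigma>' First = 0 \<and> \<sigma>' Last = 1 \<and> bfs_state s 0 1 \<alpha>' \<and> queue_extends s 0 \<alpha> \<alpha>')
    (n * 36 + 25) \<sigma> \<alpha>"
proof -
  let ?I = "\<lambda>j (\<sigma>' :: store) \<alpha>'. (\<forall>u<j. \<alpha>' Dist s u = 2 * n \<and> \<alpha>' Queue s u = s) \<and> queue_extends s 0 \<alpha> \<alpha>'"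
  have two_n: "2 * n < 2 ^ w" using n_pos by (intro less_word) simp
  have fill: "wp (FOR Dst < NumV DO (Dist\<langle>V Src, V Dst\<rangle> \<leftarrow> unreached;; Queue\<langle>V Src, V Dst\<rangle> \<leftarrow> V Src))
      (\<lambda>_. ?I n) (n * 36 + 6) \<sigma> \<alpha>"
  proof (rule wp_For[where N = n and C = 28 and I = ?I], goal_cases bound word fresh cost indep init step)
    case (step j \<sigma>' \<alpha>')
    then show ?case using vars s_less two_n by (simp add: wp_simps queue_extends_def less_Suc_eq)
  qed (use two_n in \<open>simp_all add: queue_extends_def\<close>)
  show ?thesis
    unfolding bfs_setup_def wp_Seq
  proof (rule wp_conseq[OF fill], goal_cases budget post)
    case (post t \<sigma>' \<alpha>')
    let ?\<alpha> = "upd \<alpha>' Dist s s 0"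
    have "bfs_queue s 1 (?\<alpha> Queue s) (?\<alpha> Dist s)" "bfs_head s 0 1 (?\<alpha> Queue s)"
      using post(5) s_less n_pos by (intro bfs_init; simp)+
    then have "bfs_state s 0 1 ?\<alpha>" using post(5) s_less by (simp add: bfs_state_def)
    then show ?case using post(1,3,5) vars s_less by (simp add: wp_simps queue_extends_def)
  qed simp
qed

definition row_computed :: "nat \<Rightarrow> nat \<Rightarrow> arrays \<Rightarrow> bool" where
  "row_computed q s \<alpha> \<longleftrightarrow> (\<forall>u<n. \<alpha> Dist s u = d s u) \<and> (\<forall>i<n. \<alpha> Queue s i < n) \<and>
     near_row q s (\<alpha> Queue s) (\<alpha> Ample 0 s \<noteq> 0)"

lemma wp_bfs:
  assumes vars: "\<sigma> Src = s" "\<sigma> Row_len = q" and adj: "adjacency \<alpha>" and s_less: "s < n"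
  shows "wp bfs (\<lambda>_ \<sigma>' \<alpha>'. row_computed q s \<alpha>' \<and> queue_extends s 0 \<alpha> \<alpha>' \<and>
    (\<forall>r. r \<noteq> s \<longrightarrow> \<alpha>' Ample 0 r = \<alpha> Ample 0 r)) (180 * m + 96 * n + 50) \<sigma> \<alpha>"
  unfolding bfs_def wp_Seq
proof (rule wp_conseq[OF wp_bfs_setup[where \<sigma> = \<sigma>, OF vars(1) s_less]], goal_cases budget post)
  case (post t1 \<sigma>1 \<alpha>1)
  note init = post
  have adj1: "adjacency \<alpha>1" using adj by (rule adjacency_cong[rotated]) (use post(4) in simp)
  have start_vars: "\<sigma>1 Src = s" "\<sigma>1 Row_len = q" "\<sigma>1 First = 0" "\<sigma>1 Last = 1" "bfs_state s 0 1 \<alpha>1"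
    using post(3,5) vars by simp_all
  show ?case
  proof (rule wp_conseq[OF wp_expand_loop[where \<sigma> = \<sigma>1, OF start_vars(1,3,4) adj1 s_less start_vars(5)]],
      goal_cases budget post)
    case (post t2 \<sigma>2 \<alpha>2)
    have queue: "bfs_queue s (\<sigma>2 Last) (\<alpha>2 Queue s) (\<alpha>2 Dist s)"
      and head: "bfs_head s (\<sigma>2 Last) (\<sigma>2 Last) (\<alpha>2 Queue s)"
      using post(5) by (simp_all add: bfs_state_def)
    have "row_computed q s (upd \<alpha>2 Ample 0 s (1 - of_bool (\<sigma>2 Last < q)))"
      using post(5) bfs_labels[OF queue head s_less] bfs_near_row[OF queue head s_less, of q]
      by (cases "q \<le> \<sigma>2 Last") (simp_all add: row_computed_def bfs_state_def)
    then show ?case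
      using post init(1,5) init(4)[of Ample] start_vars s_less by (simp add: wp_simps queue_extends_def)
  qed (use post(1) in simp)
qed simp

definition "all_pairs_cost = n * (180 * m + 96 * n + 58) + m * 124 + 16"

lemma wp_all_pairs:
  assumes "\<And>e. e < 2 * m \<Longrightarrow> \<alpha> Ends 0 e = ep e" "\<And>v. v < n \<Longrightarrow> \<alpha> Head 0 v = 0" "\<sigma> Row_len = q"
  shows "wp all_pairs (\<lambda>_ \<sigma>' \<alpha>'. \<forall>s<n. row_computed q s \<alpha>') all_pairs_cost \<sigma> \<alpha>"
  unfolding all_pairs_def wp_Seq
proof (rule wp_conseq[OF wp_build_adjacency[where \<alpha> = \<alpha>, OF assms(1,2)]],
    goal_cases ends head budget post)
  case (post t \<sigma>1 \<alpha>1)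
  note adj = post
  let ?I = "\<lambda>j (\<sigma>' :: store) \<alpha>'. \<forall>s<j. row_computed q s \<alpha>'"
  show ?case
  proof (rule wp_For[where N = n and C = "180 * m + 96 * n + 50" and I = ?I],
      goal_cases bound word fresh cost indep init step)
    case cost
    then show ?case using adj(1) by (simp add: all_pairs_cost_def algebra_simps)
  next
    case (step s \<sigma>2 \<alpha>2)
    have adj2: "adjacency \<alpha>2" using adj(5) by (rule adjacency_cong[rotated]) (use step(4) in simp)
    have "\<sigma>2 Row_len = q" using step(3) adj(3) assms(3) by simp
    from wp_bfs[where \<sigma> = \<sigma>2, OF step(2) this adj2 step(1)] show ?case
      by (rule wp_conseq) (use step(5) in \<open>auto simp: row_computed_def queue_extends_def less_Suc_eq\<close>)
  qed (use less_word in auto)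
qed (auto simp: all_pairs_cost_def)

end

section \<open>A greedy hitting set\<close>

definition count_row :: com where
  "count_row = FOR Pos < V Row_len DO
     (Mid ::= Queue\<langle>V Src, V Pos\<rangle>;;
      Count\<langle>V Mid\<rangle> \<leftarrow> Count\<langle>V Mid\<rangle> \<oplus> Lit 1)"

definition count_rows :: com where
  "count_rows =
     ((FOR Pos < NumV DO Count\<langle>V Pos\<rangle> \<leftarrow> Lit 0);;
      (FOR Src < NumV DO IF Ample\<langle>V Src\<rangle> THEN count_row ELSE SKIP))"

definition find_max :: com where
  "find_max =
     (Best ::= Lit 0;; Best_at ::= Lit 0;;
      (FOR Src < NumV DO
         IF V Best \<prec> Count\<langle>V Src\<rangle> THEN (Best ::= Count\<langle>V Src\<rangle>;; Best_at ::= V Src) ELSE SKIP))"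

definition clear_row :: com where
  "clear_row = FOR Pos < V Row_len DO
     IF Queue\<langle>V Src, V Pos\<rangle> \<doteq> V Best_at THEN Ample\<langle>V Src\<rangle> \<leftarrow> Lit 0 ELSE SKIP"

definition clear_rows :: com where
  "clear_rows = FOR Src < NumV DO clear_row"

definition add_hitter :: com where
  "add_hitter = (Hitter\<langle>V Num_hit\<rangle> \<leftarrow> V Best_at;; Num_hit ::= V Num_hit \<oplus> Lit 1;; clear_rows)"

definition greedy_round :: com where
  "greedy_round = (count_rows;; find_max;; (IF V Best THEN add_hitter ELSE SKIP))"

definition greedy :: com where
  "greedy = (Num_hit ::= Lit 0;; Best ::= Lit 1;; (WHILE V Best DO greedy_round))"

lemma assigned_greedy [simp]:
  "assigned count_row = {Pos, Mid}"
  "assigned count_rows = {Pos, Mid, Src}"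
  "assigned find_max = {Best, Best_at, Src}"
  "assigned clear_row = {Pos}"
  "assigned clear_rows = {Src, Pos}"
  "assigned add_hitter = {Num_hit, Src, Pos}"
  "assigned greedy_round = {Pos, Mid, Src, Best, Best_at, Num_hit}"
  "assigned greedy = {Pos, Mid, Src, Best, Best_at, Num_hit}"
  by (auto simp: count_row_def count_rows_def find_max_def clear_row_def clear_rows_def
      add_hitter_def greedy_round_def greedy_def)

lemma stored_greedy [simp]:
  "stored count_row = {Count}"
  "stored count_rows = {Count}"
  "stored find_max = {}"
  "stored clear_row = {Ample}"
  "stored clear_rows = {Ample}"
  "stored add_hitter = {Hitter, Ample}"
  "stored greedy_round = {Count, Hitter, Ample}"
  "stored greedy = {Count, Hitter, Ample}"
  by (auto simp: count_row_def count_rows_def find_max_def clear_row_def clear_rows_def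
      add_hitter_def greedy_round_def greedy_def)

lemma card_less_Suc_filter: "card {i. i < Suc j \<and> P i} = card {i. i < j \<and> P i} + of_bool (P j)"
proof -
  have "{i. i < Suc j \<and> P i} = (if P j then insert j {i. i < j \<and> P i} else {i. i < j \<and> P i})"
    by (auto simp: less_Suc_eq)
  then show ?thesis by simp
qed

lemma card_less_filter_le: "card {i. i < (j :: nat) \<and> P i} \<le> j"
  using card_mono[of "{..<j}" "{i. i < j \<and> P i}"] by auto

locale row_input = graph_input +
  fixes q :: nat
  assumes q_pos: "1 \<le> q" and q_le: "q \<le> n"
begin

definition row_set :: "arrays \<Rightarrow> nat \<Rightarrow> nat set" where
  "row_set \<alpha> v = \<alpha> Queue v ` {..<q}"

definition unhit :: "arrays \<Rightarrow> nat set" where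
  "unhit \<alpha> = {v. v < n \<and> \<alpha> Ample 0 v \<noteq> 0}"

definition rows_valid :: "arrays \<Rightarrow> bool" where
  "rows_valid \<alpha> \<longleftrightarrow> (\<forall>v<n. \<forall>i<q. \<alpha> Queue v i < n) \<and> (\<forall>v\<in>unhit \<alpha>. inj_on (\<alpha> Queue v) {..<q})"

definition frequency :: "arrays \<Rightarrow> nat \<Rightarrow> nat \<Rightarrow> nat" where
  "frequency \<alpha> j u = card {v. v < j \<and> \<alpha> Ample 0 v \<noteq> 0 \<and> u \<in> row_set \<alpha> v}"

lemma finite_unhit [simp]: "finite (unhit \<alpha>)"
  by (simp add: unhit_def)

lemma frequency_eq: "frequency \<alpha> n u = card {v\<in>unhit \<alpha>. u \<in> row_set \<alpha> v}"
  by (simp add: frequency_def unhit_def conj_assoc)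

lemma frequency_le: "frequency \<alpha> j u \<le> j"
  unfolding frequency_def by (rule card_less_filter_le)

lemma wp_count_row:
  assumes vars: "\<sigma> Src = v" "\<sigma> Row_len = q" and rows: "rows_valid \<alpha>" "v \<in> unhit \<alpha>"
    and small: "\<And>u. u < n \<Longrightarrow> \<alpha> Count 0 u \<le> n"
  shows "wp count_row (\<lambda>_ \<sigma>' \<alpha>'. \<forall>u<n. \<alpha>' Count 0 u = \<alpha> Count 0 u + of_bool (u \<in> row_set \<alpha> v))
    (q * 47 + 6) \<sigma> \<alpha>"
proof -
  have row: "v < n" "inj_on (\<alpha> Queue v) {..<q}" using rows by (auto simp: rows_valid_def unhit_def)
  show ?thesis
    unfolding count_row_def row_set_def
  proof (rule wp_For[where N = q and C = 39 and
      I = "\<lambda>j \<sigma>' \<alpha>'. \<forall>u<n. \<alpha>' Count 0 u = \<alpha> Count 0 u + of_bool (u \<in> \<alpha> Queue v ` {..<j})"],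
      goal_cases bound word fresh cost indep init step)
    case (step i \<sigma>' \<alpha>')
    define u where "u = \<alpha> Queue v i"
    have u_less: "u < n" using rows(1) row(1) step(1) by (simp add: rows_valid_def u_def)
    have "u \<notin> \<alpha> Queue v ` {..<i}" using inj_onD[OF row(2)] step(1) by (force simp: u_def)
    moreover have "\<alpha>' Queue = \<alpha> Queue" using step(4) by simp
    moreover have "\<alpha> Count 0 u + 1 < 2 ^ w" using small[OF u_less] by (intro less_word) simp
    ultimately show ?case
      using step vars row(1) u_less q_le by (simp add: wp_simps lessThan_Suc flip: u_def)
  qed (use vars q_le less_word in auto)
qed

lemma wp_clear_counts:
  "wp (FOR Pos < NumV DO Count\<langle>V Pos\<rangle> \<leftarrow> Lit 0) (\<lambda>_ \<sigma>' \<alpha>'. \<forall>u<n. \<alpha>' Count 0 u = 0) (n * 21 + 6) \<sigma> \<alpha>"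
proof (rule wp_For[where N = n and C = 13 and I = "\<lambda>j \<sigma>' \<alpha>'. \<forall>u<j. \<alpha>' Count 0 u = 0"],
    goal_cases bound word fresh cost indep init step)
  case (step j \<sigma>' \<alpha>')
  then show ?case by (simp add: wp_simps less_Suc_eq)
qed (use less_word in auto)

lemma wp_count_row_if_ample:
  assumes vars: "\<sigma> Row_len = q" "\<sigma> Src = v" "v < n" and rows: "rows_valid \<alpha>"
    and counts: "\<And>u. u < n \<Longrightarrow> \<alpha> Count 0 u = frequency \<alpha> v u"
  shows "wp (IF Ample\<langle>V Src\<rangle> THEN count_row ELSE SKIP)
    (\<lambda>_ \<sigma>' \<alpha>'. \<forall>u<n. \<alpha>' Count 0 u = frequency \<alpha> (Suc v) u) (q * 47 + 19) \<sigma> \<alpha>"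
proof (cases "\<alpha> Ample 0 v = 0")
  case True
  then show ?thesis using vars counts by (simp add: wp_simps frequency_def card_less_Suc_filter)
next
  case False
  then have "v \<in> unhit \<alpha>" using vars(3) by (simp add: unhit_def)
  moreover have "\<alpha> Count 0 u \<le> n" if "u < n" for u
    using counts[OF that] vars(3) frequency_le[of \<alpha> v u] by simp
  ultimately have row: "wp count_row (\<lambda>_ \<sigma>' \<alpha>'.
      \<forall>u<n. \<alpha>' Count 0 u = \<alpha> Count 0 u + of_bool (u \<in> row_set \<alpha> v))
      (q * 47 + 6) \<sigma> \<alpha>"
    using vars rows by (intro wp_count_row) simp_all
  have "wp count_row (\<lambda>_ \<sigma>' \<alpha>'. \<forall>u<n. \<alpha>' Count 0 u = frequency \<alpha> (Suc v) u) T \<sigma> \<alpha>"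
    if "q * 47 + 6 \<le> T" for T
    by (rule wp_conseq[OF row that])
      (use counts False in \<open>simp_all add: frequency_def card_less_Suc_filter\<close>)
  then show ?thesis using False vars by (simp add: wp_simps)
qed

lemma wp_count_rows:
  assumes vars: "\<sigma> Row_len = q" and rows: "rows_valid \<alpha>"
  shows "wp count_rows (\<lambda>_ \<sigma>' \<alpha>'. \<forall>u<n. \<alpha>' Count 0 u = frequency \<alpha> n u) (n * (q * 47 + 48) + 12) \<sigma> \<alpha>"
  unfolding count_rows_def wp_Seq
proof (rule wp_conseq[OF wp_clear_counts], goal_cases budget post)
  case (post t \<sigma>1 \<alpha>1)
  note zeroed = post
  show ?case
  proof (rule wp_For[where N = n and C = "q * 47 + 19" and
      I = "\<lambda>j \<sigma>' \<alpha>'. \<forall>u<n. \<alpha>' Count 0 u = frequency \<alpha> j u"],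
      goal_cases bound word fresh cost indep init step)
    case cost
    then show ?case using zeroed(1) by (simp add: algebra_simps)
  next
    case init
    then show ?case using zeroed(5) by (simp add: frequency_def)
  next
    case (step v \<sigma>' \<alpha>')
    have "\<alpha>' Queue = \<alpha> Queue" "\<alpha>' Ample = \<alpha> Ample" "\<sigma>' Row_len = q"
      using step(3,4) zeroed(3,4) vars by simp_all
    then have same: "rows_valid \<alpha>'" "frequency \<alpha>' = frequency \<alpha>" "\<sigma>' Row_len = q"
      using rows by (simp_all add: rows_valid_def unhit_def row_set_def frequency_def[abs_def])
    then show ?case
      using wp_count_row_if_ample[where \<sigma> = \<sigma>' and \<alpha> = \<alpha>', OF same(3) step(2,1) same(1)] step(5) by simp
  qed (use less_word in auto)
qed (simp add: algebra_simps)

lemma wp_find_max: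
  "wp find_max (\<lambda>_ \<sigma>' \<alpha>'. \<sigma>' Best_at < n \<and> (\<forall>u<n. \<alpha> Count 0 u \<le> \<sigma>' Best) \<and>
     (\<sigma>' Best \<noteq> 0 \<longrightarrow> \<alpha> Count 0 (\<sigma>' Best_at) = \<sigma>' Best)) (n * 38 + 10) \<sigma> \<alpha>"
proof -
  let ?I = "\<lambda>j \<sigma>' (\<alpha>' :: arrays). \<sigma>' Best_at < n \<and> (\<forall>u<j. \<alpha> Count 0 u \<le> \<sigma>' Best) \<and>
     (\<sigma>' Best \<noteq> 0 \<longrightarrow> \<alpha> Count 0 (\<sigma>' Best_at) = \<sigma>' Best)"
  have "wp (FOR Src < NumV DO
        IF V Best \<prec> Count\<langle>V Src\<rangle> THEN (Best ::= Count\<langle>V Src\<rangle>;; Best_at ::= V Src) ELSE SKIP)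
      (\<lambda>_. ?I n) T (\<sigma>(Best := 0, Best_at := 0)) \<alpha>" if "n * 38 + 6 \<le> T" for T
  proof (rule wp_For[where N = n and C = 30 and I = ?I], goal_cases bound word fresh cost indep init step)
    case (step j \<sigma>' \<alpha>')
    have "\<alpha>' = \<alpha>" using step(4) by auto
    then show ?case using step(1,2,5) by (auto simp: wp_simps less_Suc_eq)
  qed (use that n_pos less_word in auto)
  then show ?thesis by (simp add: find_max_def wp_simps)
qed

lemma wp_clear_row:
  assumes vars: "\<sigma> Row_len = q" "\<sigma> Best_at = u" "\<sigma> Src = v" "v < n"
  shows "wp clear_row (\<lambda>_ \<sigma>' \<alpha>'. \<forall>v'<n. \<alpha>' Ample 0 v' =
      (if v' = v \<and> u \<in> row_set \<alpha> v then 0 else \<alpha> Ample 0 v'))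
    (q * 36 + 6) \<sigma> \<alpha>"
proof -
  let ?I = "\<lambda>i (\<sigma>' :: store) \<alpha>'. \<forall>v'<n. \<alpha>' Ample 0 v' =
      (if v' = v \<and> u \<in> \<alpha> Queue v ` {..<i} then 0 else \<alpha> Ample 0 v')"
  have "wp clear_row (\<lambda>_. ?I q) (q * 36 + 6) \<sigma> \<alpha>"
    unfolding clear_row_def
  proof (rule wp_For[where N = q and C = 28 and I = ?I], goal_cases bound word fresh cost indep init step)
    case (step i \<sigma>' \<alpha>')
    have "\<alpha>' Queue = \<alpha> Queue" "\<sigma>' Src = v" "\<sigma>' Best_at = u" using step(3,4) vars by simp_all
    then show ?case using step(1,2,5) vars(4) q_le by (auto simp: wp_simps lessThan_Suc)
  qed (use vars q_le less_word in auto)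
  then show ?thesis by (simp add: row_set_def)
qed

lemma wp_clear_rows:
  assumes vars: "\<sigma> Row_len = q" "\<sigma> Best_at = u"
  shows "wp clear_rows (\<lambda>_ \<sigma>' \<alpha>'. \<forall>v<n. \<alpha>' Ample 0 v = (if u \<in> row_set \<alpha> v then 0 else \<alpha> Ample 0 v))
    (n * (q * 36 + 14) + 6) \<sigma> \<alpha>"
proof -
  let ?I = "\<lambda>j (\<sigma>' :: store) \<alpha>'. \<forall>v<n. \<alpha>' Ample 0 v =
      (if v < j \<and> u \<in> row_set \<alpha> v then 0 else \<alpha> Ample 0 v)"
  have "wp clear_rows (\<lambda>_. ?I n) (n * (q * 36 + 14) + 6) \<sigma> \<alpha>"
    unfolding clear_rows_def
  proof (rule wp_For[where N = n and C = "q * 36 + 6" and I = ?I],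
      goal_cases bound word fresh cost indep init step)
    case (step v \<sigma>' \<alpha>')
    have "row_set \<alpha>' v = row_set \<alpha> v" "\<sigma>' Row_len = q" "\<sigma>' Best_at = u"
      using step(3,4) vars by (simp_all add: row_set_def)
    then show ?case
      using wp_conseq[OF wp_clear_row[where \<sigma> = \<sigma>' and \<alpha> = \<alpha>', OF _ _ step(2,1)] le_refl] step(1,5)
      by (auto simp: less_Suc_eq)
  qed (use less_word in auto)
  then show ?thesis by (rule wp_conseq) auto
qed

text \<open>\<open>\<alpha>\<close> is the memory before the first round; a row that has been hit is no longer marked.\<close>

definition greedy_inv :: "arrays \<Rightarrow> store \<Rightarrow> arrays \<Rightarrow> bool" where
  "greedy_inv \<alpha> \<sigma>' \<alpha>' \<longleftrightarrow> \<sigma>' Num_hit + card (unhit \<alpha>') \<le> n \<and>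
     real (\<sigma>' Num_hit) + greedy_potential n q (card (unhit \<alpha>')) \<le> greedy_potential n q n \<and>
     (\<forall>j<\<sigma>' Num_hit. \<alpha>' Hitter 0 j < n) \<and>
     (\<forall>v<n. \<alpha>' Ample 0 v = \<alpha> Ample 0 v \<or>
       \<alpha>' Ample 0 v = 0 \<and> (\<exists>j<\<sigma>' Num_hit. \<alpha>' Hitter 0 j \<in> row_set \<alpha> v))"

definition "max_hitters = nat \<lfloor>greedy_potential n q n\<rfloor>"

lemma greedy_inv_unhit: "greedy_inv \<alpha> \<sigma>' \<alpha>' \<Longrightarrow> unhit \<alpha>' \<subseteq> unhit \<alpha>"
  by (auto simp: greedy_inv_def unhit_def)

lemma greedy_inv_Num_hit_le:
  assumes "greedy_inv \<alpha> \<sigma>' \<alpha>'"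
  shows "\<sigma>' Num_hit \<le> max_hitters"
proof -
  have "real (\<sigma>' Num_hit) \<le> greedy_potential n q n"
    using assms greedy_potential_nonneg[of n q "card (unhit \<alpha>')"] by (simp add: greedy_inv_def)
  then show ?thesis unfolding max_hitters_def by (simp add: le_nat_floor)
qed

lemma greedy_inv_init: "\<sigma>' Num_hit = 0 \<Longrightarrow> greedy_inv \<alpha> \<sigma>' \<alpha>"
proof -
  have "card (unhit \<alpha>) \<le> n" unfolding unhit_def by (rule card_less_filter_le)
  then show "\<sigma>' Num_hit = 0 \<Longrightarrow> ?thesis" using greedy_potential_mono by (simp add: greedy_inv_def)
qed

lemma card_unhit_le_frequency:
  assumes "rows_valid \<alpha>" "\<And>u. u < n \<Longrightarrow> frequency \<alpha> n u \<le> b"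
  shows "card (unhit \<alpha>) * q \<le> n * b"
proof -
  have "card (unhit \<alpha>) * q \<le> card {..<n} * b"
  proof (rule card_le_of_frequency_le)
    show "row_set \<alpha> v \<subseteq> {..<n} \<and> card (row_set \<alpha> v) = q" if "v \<in> unhit \<alpha>" for v
      using assms(1) that by (auto simp: rows_valid_def row_set_def unhit_def card_image)
    show "card {v\<in>unhit \<alpha>. u \<in> row_set \<alpha> v} \<le> b" if "u \<in> {..<n}" for u
      using assms(2)[of u] that by (simp add: frequency_eq)
  qed simp_all
  then show ?thesis by simp
qed

lemma greedy_inv_step:
  assumes inv: "greedy_inv \<alpha> \<sigma>' \<alpha>'" and best: "u < n" "frequency \<alpha>' n u = b" "b \<noteq> 0"
    and most: "card (unhit \<alpha>') * q \<le> n * b" and same: "row_set \<alpha>' = row_set \<alpha>"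
    and vars'': "\<sigma>'' Num_hit = \<sigma>' Num_hit + 1" "\<alpha>'' Hitter 0 = (\<alpha>' Hitter 0)(\<sigma>' Num_hit := u)"
    and ample: "\<And>v. v < n \<Longrightarrow> \<alpha>'' Ample 0 v = (if u \<in> row_set \<alpha>' v then 0 else \<alpha>' Ample 0 v)"
  shows "greedy_inv \<alpha> \<sigma>'' \<alpha>''"
proof -
  let ?hit = "{v\<in>unhit \<alpha>'. u \<in> row_set \<alpha>' v}"
  have hit: "card ?hit = b" using best(2) by (simp add: frequency_eq)
  have b_le: "b \<le> card (unhit \<alpha>')" unfolding hit[symmetric] by (intro card_mono) auto
  have "unhit \<alpha>'' = unhit \<alpha>' - ?hit" using ample by (auto simp: unhit_def split: if_splits)
  then have card: "card (unhit \<alpha>'') = card (unhit \<alpha>') - b"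
    using hit card_Diff_subset[of ?hit "unhit \<alpha>'"] by simp
  have "greedy_potential n q (card (unhit \<alpha>'')) + 1 \<le> greedy_potential n q (card (unhit \<alpha>'))"
    unfolding card by (rule greedy_potential_step) (use b_le best(3) most q_pos q_le in simp_all)
  moreover have "\<alpha>'' Ample 0 v = \<alpha> Ample 0 v \<or>
      \<alpha>'' Ample 0 v = 0 \<and> (\<exists>j<\<sigma>'' Num_hit. \<alpha>'' Hitter 0 j \<in> row_set \<alpha> v)" if v_less: "v < n" for v
  proof (cases "u \<in> row_set \<alpha> v")
    case True
    then show ?thesis using ample[OF v_less] vars'' same
      by (intro disjI2 conjI exI[of _ "\<sigma>' Num_hit"]) simp_all
  next
    case False
    then have unchanged: "\<alpha>'' Ample 0 v = \<alpha>' Ample 0 v" using ample[OF v_less] same by simp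
    have "\<alpha>' Ample 0 v = \<alpha> Ample 0 v \<or>
        \<alpha>' Ample 0 v = 0 \<and> (\<exists>j<\<sigma>' Num_hit. \<alpha>' Hitter 0 j \<in> row_set \<alpha> v)"
      using inv v_less by (simp add: greedy_inv_def)
    then show ?thesis
    proof (elim disjE conjE exE)
      fix j assume "\<alpha>' Ample 0 v = 0" "j < \<sigma>' Num_hit" "\<alpha>' Hitter 0 j \<in> row_set \<alpha> v"
      then show ?thesis using unchanged vars'' by (intro disjI2 conjI exI[of _ j]) simp_all
    qed (use unchanged in simp)
  qed
  moreover have "\<alpha>'' Hitter 0 j < n" if "j < \<sigma>'' Num_hit" for j
    using that inv best(1) vars'' by (cases "j = \<sigma>' Num_hit") (simp_all add: greedy_inv_def)
  moreover have "\<sigma>'' Num_hit + card (unhit \<alpha>'') \<le> n"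
    using inv b_le card best(3) vars''(1) unfolding greedy_inv_def by linarith
  ultimately show ?thesis using inv vars''(1) by (simp add: greedy_inv_def)
qed

lemma wp_add_hitter:
  assumes inv: "greedy_inv \<alpha> \<sigma>' \<alpha>'" and best: "u < n" "frequency \<alpha>' n u = b" "b \<noteq> 0"
    and most: "card (unhit \<alpha>') * q \<le> n * b" and same: "row_set \<alpha>' = row_set \<alpha>"
    and vars': "\<sigma>' Row_len = q" "\<sigma>' Best_at = u"
  shows "wp add_hitter (\<lambda>_ \<sigma>'' \<alpha>''. greedy_inv \<alpha> \<sigma>'' \<alpha>'' \<and> \<sigma>'' Num_hit = \<sigma>' Num_hit + 1)
    (n * (q * 36 + 14) + 23) \<sigma>' \<alpha>'"
proof -
  define sz where "sz = \<sigma>' Num_hit"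
  define \<sigma>1 where "\<sigma>1 = \<sigma>'(Num_hit := sz + 1)"
  define \<alpha>1 where "\<alpha>1 = upd \<alpha>' Hitter 0 sz u"
  have "unhit \<alpha>' \<noteq> {}" using best(2,3) by (auto simp: frequency_eq)
  then have "sz < n" using inv card_gt_0_iff[of "unhit \<alpha>'"] by (simp add: greedy_inv_def sz_def)
  have "wp clear_rows (\<lambda>_ \<sigma>'' \<alpha>''. greedy_inv \<alpha> \<sigma>'' \<alpha>'' \<and> \<sigma>'' Num_hit = sz + 1) T \<sigma>1 \<alpha>1"
    if "n * (q * 36 + 14) + 6 \<le> T" for T
  proof (rule wp_conseq[OF wp_clear_rows[where \<sigma> = \<sigma>1 and u = u]], goal_cases row_len best budget post)
    case (post t \<sigma>'' \<alpha>'')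
    have "\<sigma>'' Num_hit = sz + 1" using post(3) by (simp add: \<sigma>1_def)
    moreover have "\<alpha>'' Hitter 0 = (\<alpha>' Hitter 0)(sz := u)" using post(4) by (simp add: \<alpha>1_def)
    moreover have "\<alpha>'' Ample 0 v = (if u \<in> row_set \<alpha>' v then 0 else \<alpha>' Ample 0 v)" if "v < n" for v
      using post(5) that by (simp add: \<alpha>1_def row_set_def)
    ultimately show ?case using greedy_inv_step[OF inv best most same] by (simp add: sz_def)
  qed (use vars' that in \<open>simp_all add: \<sigma>1_def\<close>)
  moreover have "sz + 1 < 2 ^ w" using \<open>sz < n\<close> by (intro less_word) simp
  ultimately show ?thesis
    using \<open>sz < n\<close> vars' by (simp add: add_hitter_def wp_simps \<sigma>1_def \<alpha>1_def flip: sz_def)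
qed

definition "greedy_round_cost = n * (q * 83 + 100) + 60"

lemma wp_greedy_round:
  assumes vars: "\<sigma>' Row_len = q" and rows: "rows_valid \<alpha>" "\<alpha>' Queue = \<alpha> Queue"
    and inv: "greedy_inv \<alpha> \<sigma>' \<alpha>'"
  shows "wp greedy_round (\<lambda>_ \<sigma>'' \<alpha>''. greedy_inv \<alpha> \<sigma>'' \<alpha>'' \<and>
      (if \<sigma>'' Best = 0 then unhit \<alpha>'' = {} else \<sigma>'' Num_hit = \<sigma>' Num_hit + 1)) greedy_round_cost \<sigma>' \<alpha>'"
proof -
  have valid: "rows_valid \<alpha>'" using rows greedy_inv_unhit[OF inv] by (auto simp: rows_valid_def)
  show ?thesis
    unfolding greedy_round_def wp_Seq
  proof (rule wp_conseq[OF wp_count_rows[where \<sigma> = \<sigma>', OF vars valid]], goal_cases budget post)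
    case (post t1 \<sigma>1 \<alpha>1)
    note counted = post
    show ?case
    proof (rule wp_conseq[OF wp_find_max], goal_cases budget post)
      case (post t2 \<sigma>2 \<alpha>2)
      define b where "b = \<sigma>2 Best"
      have best: "\<sigma>2 Best_at < n" "b \<noteq> 0 \<Longrightarrow> frequency \<alpha>' n (\<sigma>2 Best_at) = b"
        "\<And>u. u < n \<Longrightarrow> frequency \<alpha>' n u \<le> b"
        using post(5) counted(5) by (auto simp: b_def)
      have most: "card (unhit \<alpha>') * q \<le> n * b" using card_unhit_le_frequency[OF valid best(3)] .
      have same: "\<sigma>2 Num_hit = \<sigma>' Num_hit" "\<sigma>2 Row_len = q" "\<alpha>2 Ample = \<alpha>' Ample" "\<alpha>2 Hitter = \<alpha>' Hitter"
        "\<alpha>2 Queue = \<alpha> Queue"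
        using post(3,4) counted(3,4) vars rows(2) by simp_all
      have inv2: "greedy_inv \<alpha> \<sigma>2 \<alpha>2" using inv same by (simp add: greedy_inv_def unhit_def)
      have time: "n * (q * 36 + 14) + 25 \<le> t2"
        using post(1) counted(1) by (simp add: greedy_round_cost_def algebra_simps)
      show ?case
      proof (cases "b = 0")
        case True
        then have "unhit \<alpha>' = {}" using most q_pos by simp
        then show ?thesis using True time same inv2 by (simp add: wp_simps unhit_def flip: b_def)
      next
        case False
        have "frequency \<alpha>2 n (\<sigma>2 Best_at) = b" "card (unhit \<alpha>2) * q \<le> n * b" "row_set \<alpha>2 = row_set \<alpha>"
          using best(2)[OF False] most same rows(2)
          by (simp_all add: frequency_def unhit_def row_set_def[abs_def])
        note add = wp_add_hitter[OF inv2 best(1) this(1) False this(2,3) same(2) refl]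
        have "wp add_hitter (\<lambda>_ \<sigma>'' \<alpha>''. greedy_inv \<alpha> \<sigma>'' \<alpha>'' \<and>
            (if \<sigma>'' Best = 0 then unhit \<alpha>'' = {} else \<sigma>'' Num_hit = \<sigma>' Num_hit + 1)) (t2 - 2) \<sigma>2 \<alpha>2"
          by (rule wp_conseq[OF add]) (use time False same in \<open>auto simp: b_def\<close>)
        then show ?thesis using False time by (simp add: wp_simps flip: b_def)
      qed
    qed (use counted(1) in \<open>simp add: greedy_round_cost_def algebra_simps\<close>)
  qed (simp add: greedy_round_cost_def algebra_simps)
qed

definition "greedy_cost = (max_hitters + 1) * (greedy_round_cost + 2) + 10"

lemma wp_greedy:
  assumes vars: "\<sigma> Row_len = q" and valid: "rows_valid \<alpha>"
  shows "wp greedy (\<lambda>_ \<sigma>' \<alpha>'. \<sigma>' Num_hit \<le> max_hitters \<and> \<sigma>' Num_hit \<le> n \<and>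
      (\<forall>j<\<sigma>' Num_hit. \<alpha>' Hitter 0 j < n) \<and>
      (\<forall>v\<in>unhit \<alpha>. \<exists>j<\<sigma>' Num_hit. \<alpha>' Hitter 0 j \<in> row_set \<alpha> v)) greedy_cost \<sigma> \<alpha>"
proof -
  let ?I = "\<lambda>\<sigma>' \<alpha>'. greedy_inv \<alpha> \<sigma>' \<alpha>' \<and> (\<sigma>' Best = 0 \<longrightarrow> unhit \<alpha>' = {})"
  let ?\<Phi> = "\<lambda>\<sigma>' (\<alpha>' :: arrays).
      (if \<sigma>' Best = 0 then 0 else (max_hitters + 1 - \<sigma>' Num_hit) * (greedy_round_cost + 2)) + 2"
  have loop: "wp (WHILE V Best DO greedy_round) (\<lambda>_ \<sigma>' \<alpha>'. ?I \<sigma>' \<alpha>' \<and> val (V Best) \<sigma>' \<alpha>' = 0)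
      (greedy_cost - 4) (\<sigma>(Num_hit := 0, Best := 1)) \<alpha>"
  proof (rule wp_While[where \<Phi> = ?\<Phi>], goal_cases init cost step)
    case (step \<sigma>' \<alpha>')
    have row: "\<sigma>' Row_len = q" "\<alpha>' Queue = \<alpha> Queue" using step(1,2) vars by simp_all
    have inv: "greedy_inv \<alpha> \<sigma>' \<alpha>'" using step(3) by blast
    define left where "left = max_hitters - \<sigma>' Num_hit"
    have left: "max_hitters + 1 - \<sigma>' Num_hit = Suc left"
      using greedy_inv_Num_hit_le[OF inv] by (simp add: left_def)
    have "wp greedy_round (\<lambda>t \<sigma>'' \<alpha>''. ?I \<sigma>'' \<alpha>'' \<and> ?\<Phi> \<sigma>'' \<alpha>'' \<le> t) (?\<Phi> \<sigma>' \<alpha>' - 2) \<sigma>' \<alpha>'" if "\<sigma>' Best \<noteq> 0"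
    proof (rule wp_conseq[OF wp_greedy_round[where \<sigma>' = \<sigma>', OF row(1) valid row(2) inv]],
        goal_cases budget post)
      case (post t \<sigma>'' \<alpha>'')
      have "?\<Phi> \<sigma>'' \<alpha>'' \<le> t" using post(1,5) that left by (auto simp: left_def)
      then show ?case using post(5) by auto
    qed (use that left in simp)
    then show ?case using left by simp
  qed (auto simp: greedy_inv_init greedy_cost_def)
  have "wp (WHILE V Best DO greedy_round) (\<lambda>_ \<sigma>' \<alpha>'. \<sigma>' Num_hit \<le> max_hitters \<and> \<sigma>' Num_hit \<le> n \<and>
      (\<forall>j<\<sigma>' Num_hit. \<alpha>' Hitter 0 j < n) \<and> (\<forall>v\<in>unhit \<alpha>. \<exists>j<\<sigma>' Num_hit. \<alpha>' Hitter 0 j \<in> row_set \<alpha> v))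
      (greedy_cost - 4) (\<sigma>(Num_hit := 0, Best := 1)) \<alpha>"
  proof (rule wp_conseq[OF loop], goal_cases budget post)
    case (post t \<sigma>' \<alpha>')
    then have "greedy_inv \<alpha> \<sigma>' \<alpha>'" "\<forall>v<n. \<alpha>' Ample 0 v = 0" by (auto simp: unhit_def)
    then show ?case using greedy_inv_Num_hit_le by (auto simp: greedy_inv_def unhit_def)
  qed simp
  then show ?thesis by (simp add: greedy_def wp_simps greedy_cost_def)
qed

end

section \<open>Distances to the hitting set\<close>

definition near_hitter :: com where
  "near_hitter =
     (Best ::= unreached;; Best_at ::= Lit 0;;
      (FOR Pos < V Num_hit DO
        (Margin ::= Dist\<langle>V Src, Hitter\<langle>V Pos\<rangle>\<rangle>;;
         (IF V Margin \<prec> V Best THEN (Best ::= V Margin;; Best_at ::= V Pos) ELSE SKIP))))"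

definition near_hitters :: com where
  "near_hitters = FOR Src < NumV DO
     (near_hitter;; HitDist\<langle>V Src\<rangle> \<leftarrow> V Best;; HitNear\<langle>V Src\<rangle> \<leftarrow> V Best_at)"

lemma assigned_near_hitters [simp]:
  "assigned near_hitter = {Best, Best_at, Pos, Margin}"
  "assigned near_hitters = {Src, Best, Best_at, Pos, Margin}"
  by (auto simp: near_hitter_def near_hitters_def)

lemma stored_near_hitters [simp]: "stored near_hitter = {}" "stored near_hitters = {HitDist, HitNear}"
  by (auto simp: near_hitter_def near_hitters_def)

context row_input begin

text \<open>The distance \<open>b\<close> of \<open>z\<close> to \<open>S 0, \<dots>, S (j - 1)\<close> is attained at \<open>S p\<close> if it is finite.\<close>

definition nearest_among :: "(nat \<Rightarrow> nat) \<Rightarrow> nat \<Rightarrow> nat \<Rightarrow> nat \<Rightarrow> nat \<Rightarrow> bool" where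
  "nearest_among S j z b p \<longleftrightarrow> b \<le> 2 * n \<and> p < n \<and> (\<forall>i<j. b \<le> d z (S i)) \<and>
     (b < 2 * n \<longrightarrow> p < j \<and> d z (S p) = b)"

definition distances :: "arrays \<Rightarrow> bool" where
  "distances \<alpha> \<longleftrightarrow> (\<forall>s<n. \<forall>u<n. \<alpha> Dist s u = d s u)"

lemma distancesD: "distances \<alpha> \<Longrightarrow> s < n \<Longrightarrow> u < n \<Longrightarrow> \<alpha> Dist s u = d s u"
  by (simp add: distances_def)

lemma wp_near_hitter:
  assumes vars: "\<sigma> Num_hit = sz" "\<sigma> Src = z" "z < n" "sz \<le> n"
    and dists: "distances \<alpha>" "\<And>j. j < sz \<Longrightarrow> \<alpha> Hitter 0 j < n"
  shows "wp near_hitter (\<lambda>_ \<sigma>' \<alpha>'. nearest_among (\<alpha> Hitter 0) sz z (\<sigma>' Best) (\<sigma>' Best_at))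
      (sz * 40 + 12) \<sigma> \<alpha>"
proof -
  let ?I = "\<lambda>j \<sigma>' (\<alpha>' :: arrays). nearest_among (\<alpha> Hitter 0) j z (\<sigma>' Best) (\<sigma>' Best_at)"
  have two_n: "2 * n < 2 ^ w" using n_pos by (intro less_word) simp
  have "wp (FOR Pos < V Num_hit DO
        (Margin ::= Dist\<langle>V Src, Hitter\<langle>V Pos\<rangle>\<rangle>;;
         (IF V Margin \<prec> V Best THEN (Best ::= V Margin;; Best_at ::= V Pos) ELSE SKIP)))
      (\<lambda>_. ?I sz) T (\<sigma>(Best := n + n, Best_at := 0)) \<alpha>" if "sz * 40 + 6 \<le> T" for T
  proof (rule wp_For[where N = sz and C = 32 and I = ?I],
      goal_cases bound word fresh cost indep init step)
    case (step j \<sigma>' \<alpha>')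
    define s where "s = \<alpha> Hitter 0 j"
    have "\<alpha>' = \<alpha>" using step(4) by auto
    moreover have "\<alpha> Dist z s = d z s" "s < n" "d z s \<le> 2 * n"
      using distancesD[OF dists(1) vars(3)] dists(2)[OF step(1)] d_le_inf[OF vars(3)]
      by (simp_all add: s_def)
    ultimately show ?case
      using step(1-3,5) vars by (auto simp: wp_simps nearest_among_def less_Suc_eq simp flip: s_def)
  qed (use that vars n_pos less_word in \<open>auto simp: nearest_among_def\<close>)
  then show ?thesis using two_n by (simp add: near_hitter_def wp_simps flip: mult_2)
qed

lemma wp_near_hitters:
  assumes vars: "\<sigma> Num_hit = sz" "sz \<le> n" and dists: "distances \<alpha>" "\<And>j. j < sz \<Longrightarrow> \<alpha> Hitter 0 j < n"
  shows "wp near_hitters (\<lambda>_ \<sigma>' \<alpha>'. \<forall>z<n. nearest_among (\<alpha> Hitter 0) sz z (\<alpha>' HitDist 0 z)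
      (\<alpha>' HitNear 0 z))
    (n * (sz * 40 + 46) + 6) \<sigma> \<alpha>"
  unfolding near_hitters_def
proof (rule wp_For[where N = n and C = "sz * 40 + 38" and
    I = "\<lambda>j \<sigma>' \<alpha>'. \<forall>z<j. nearest_among (\<alpha> Hitter 0) sz z (\<alpha>' HitDist 0 z) (\<alpha>' HitNear 0 z)"],
      goal_cases bound word fresh cost indep init step)
  case (step z \<sigma>' \<alpha>')
  note outer = step
  have same: "\<sigma>' Num_hit = sz" "\<alpha>' Hitter = \<alpha> Hitter" "\<alpha>' Dist = \<alpha> Dist"
    using step(3,4) vars by simp_all
  show ?case
    unfolding wp_Seq
  proof (rule wp_conseq[OF wp_near_hitter[where \<sigma> = \<sigma>' and \<alpha> = \<alpha>', OF same(1) step(2,1) vars(2)]],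
      goal_cases dists hitters budget post)
    case (post t \<sigma>'' \<alpha>'')
    have "\<alpha>'' = \<alpha>'" "\<sigma>'' Src = z" using post(3,4) outer(2) by auto
    then show ?case using post(1,5) outer(1,5) same by (simp add: wp_simps less_Suc_eq)
  qed (use dists same in \<open>simp_all add: distances_def\<close>)
qed (use less_word in auto)

end

section \<open>The search tree\<close>

fun beyond_expr :: "nat \<Rightarrow> expr" where
  "beyond_expr 0 = Lit 1"
| "beyond_expr (Suc i) = beyond_expr i \<otimes> (V Limit \<prec> Dist\<langle>V (Choice i), V Probe\<rangle>)"

definition find_farthest :: "nat \<Rightarrow> com" where
  "find_farthest i =
     (Best ::= Lit 0;; Farthest i ::= Lit 0;;
      (FOR Probe < NumV DO
        IF beyond_expr i \<otimes> (V Best \<prec> HitDist\<langle>V Probe\<rangle> \<oplus> Lit 1)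
        THEN (Best ::= HitDist\<langle>V Probe\<rangle> \<oplus> Lit 1;; Farthest i ::= V Probe)
        ELSE SKIP))"

fun save_choices :: "nat \<Rightarrow> com" where
  "save_choices 0 = SKIP"
| "save_choices (Suc l) = (save_choices l;; Center l ::= V (Choice l))"

definition record_solution :: "nat \<Rightarrow> com" where
  "record_solution i =
     (IF V Valid THEN (Found ::= Lit 1;; save_choices i;; Center i ::= V Pick) ELSE SKIP)"

definition check_directly :: "nat \<Rightarrow> com" where
  "check_directly i =
     (Valid ::= Lit 1;;
      (FOR Probe < NumV DO
        IF beyond_expr i \<otimes> (V Limit \<prec> Dist\<langle>V Pick, V Probe\<rangle>) THEN Valid ::= Lit 0 ELSE SKIP))"

definition last_from_row :: "nat \<Rightarrow> com" where
  "last_from_row i = FOR Pos < V Row_len DO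
     (Pick ::= Queue\<langle>V (Farthest i), V Pos\<rangle>;; check_directly i;; record_solution i)"

definition mark_needed :: "nat \<Rightarrow> com" where
  "mark_needed i =
     ((FOR Pos < V Num_hit DO Needed\<langle>V Pos\<rangle> \<leftarrow> Lit 0);;
      (FOR Probe < NumV DO
        IF beyond_expr i THEN Needed\<langle>HitNear\<langle>V Probe\<rangle>\<rangle> \<leftarrow> Lit 1 ELSE SKIP))"

definition check_needed :: com where
  "check_needed =
     (Valid ::= Lit 1;;
      (FOR Pos < V Num_hit DO
        IF Needed\<langle>V Pos\<rangle> \<otimes> (V Guess \<oplus> V Half \<prec> Dist\<langle>V Pick, Hitter\<langle>V Pos\<rangle>\<rangle>)
        THEN Valid ::= Lit 0 ELSE SKIP))"

definition last_from_all :: "nat \<Rightarrow> com" where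
  "last_from_all i = FOR Pick < NumV DO (check_needed;; record_solution i)"

definition choose_last :: "nat \<Rightarrow> com" where
  "choose_last i =
     (Limit ::= V Target;; find_farthest i;;
      (IF V Half \<oplus> Lit 1 \<prec> V Best THEN last_from_row i ELSE (mark_needed i;; last_from_all i)))"

definition select :: "nat \<Rightarrow> com" where
  "select i =
     (IF V (Cursor i) \<prec> V Num_hit THEN Choice i ::= Hitter\<langle>V (Cursor i)\<rangle>
      ELSE Choice i ::= Queue\<langle>V (Farthest i), V (Cursor i) \<ominus> V Num_hit\<rangle>)"

fun search :: "nat \<Rightarrow> nat \<Rightarrow> com" where
  "search i 0 = choose_last i"
| "search i (Suc r) =
     (Limit ::= V Guess \<oplus> Lit (2 * i) \<otimes> V Gap \<ominus> V Gap;; find_farthest i;;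
      (FOR Cursor i < V Num_hit \<oplus> V Row_len DO (select i;; search (Suc i) r)))"

lemma steps_beyond_expr [simp]: "steps (beyond_expr i) = 15 * i + 1"
  by (induction i) auto

lemma assigned_save_choices [simp]: "assigned (save_choices i) = Center ` {..<i}"
  by (induction i) (auto simp: lessThan_Suc)

lemma stored_save_choices [simp]: "stored (save_choices i) = {}"
  by (induction i) auto

lemma assigned_search_parts [simp]:
  "assigned (find_farthest i) = {Best, Farthest i, Probe}"
  "assigned (record_solution i) = insert Found (Center ` {..i})"
  "assigned (check_directly i) = {Valid, Probe}"
  "assigned (last_from_row i) = {Pos, Pick, Valid, Probe, Found} \<union> Center ` {..i}"
  "assigned (mark_needed i) = {Pos, Probe}"
  "assigned check_needed = {Valid, Pos}"
  "assigned (last_from_all i) = {Pick, Valid, Pos, Found} \<union> Center ` {..i}"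
  "assigned (select i) = {Choice i}"
  by (auto simp: find_farthest_def record_solution_def check_directly_def last_from_row_def
      mark_needed_def check_needed_def last_from_all_def select_def)

lemma stored_search_parts [simp]:
  "stored (find_farthest i) = {}"
  "stored (record_solution i) = {}"
  "stored (check_directly i) = {}"
  "stored (last_from_row i) = {}"
  "stored (mark_needed i) = {Needed}"
  "stored check_needed = {}"
  "stored (last_from_all i) = {}"
  "stored (select i) = {}"
  by (auto simp: find_farthest_def record_solution_def check_directly_def last_from_row_def
      mark_needed_def check_needed_def last_from_all_def select_def)

lemma assigned_choose_last [simp]:
  "assigned (choose_last i) =
    {Limit, Best, Farthest i, Probe, Pos, Pick, Valid, Found} \<union> Center ` {..i}"
  by (auto simp: choose_last_def)

lemma assigned_search: "assigned (search i r) \<subseteq>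
    {Found, Limit, Best, Probe, Pos, Pick, Valid} \<union> range Center \<union>
    (Choice ` {i..} \<union> Cursor ` {i..} \<union> Farthest ` {i..})"
proof (induction r arbitrary: i)
  case (Suc r)
  have "Choice ` {Suc i..} \<subseteq> Choice ` {i..}" "Cursor ` {Suc i..} \<subseteq> Cursor ` {i..}"
    "Farthest ` {Suc i..} \<subseteq> Farthest ` {i..}" by auto
  then show ?case using Suc[of "Suc i"] by auto
qed auto

lemma stored_choose_last [simp]: "stored (choose_last i) = {Needed}"
  by (simp add: choose_last_def)

lemma stored_search [simp]: "stored (search i r) = {Needed}"
  by (induction r arbitrary: i) simp_all

locale search_tables = row_input +
  fixes k sz :: nat and \<tau> :: arrays
  assumes k_pos: "1 \<le> k" and k_le: "k \<le> n" and sz_le: "sz \<le> n"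
    and dist: "distances \<tau>"
    and hitter_less: "\<And>j. j < sz \<Longrightarrow> \<tau> Hitter 0 j < n"
    and row_less: "\<And>v i. v < n \<Longrightarrow> i < q \<Longrightarrow> \<tau> Queue v i < n"
    and nearest: "\<And>z. z < n \<Longrightarrow> nearest_among (\<tau> Hitter 0) sz z (\<tau> HitDist 0 z) (\<tau> HitNear 0 z)"
    and row_ball: "\<And>v r x. v < n \<Longrightarrow> r < 2 * n \<Longrightarrow> r < \<tau> HitDist 0 v \<Longrightarrow> x < n \<Longrightarrow> d v x \<le> r \<Longrightarrow>
      x \<in> row_set \<tau> v"
    and HitDist_eq_0: "\<And>v. v < n \<Longrightarrow> k = 1 \<Longrightarrow> \<tau> HitDist 0 v = 0"
begin

definition tables :: "arrays \<Rightarrow> bool" where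
  "tables \<alpha> \<longleftrightarrow> (\<forall>a. a \<noteq> Needed \<longrightarrow> \<alpha> a = \<tau> a)"

lemma tablesD:
  assumes "tables \<alpha>"
  shows "\<alpha> Dist = \<tau> Dist" "\<alpha> Queue = \<tau> Queue" "\<alpha> Hitter = \<tau> Hitter" "\<alpha> HitDist = \<tau> HitDist"
    "\<alpha> HitNear = \<tau> HitNear"
  using assms by (simp_all add: tables_def)

lemma tables_cong: "tables \<alpha> \<Longrightarrow> (\<And>a. a \<noteq> Needed \<Longrightarrow> \<alpha>' a = \<alpha> a) \<Longrightarrow> tables \<alpha>'"
  by (simp add: tables_def)

abbreviation hitters :: "nat set" where "hitters \<equiv> \<tau> Hitter 0 ` {..<sz}"

abbreviation choices :: "store \<Rightarrow> nat \<Rightarrow> nat" where "choices \<sigma> \<equiv> \<lambda>l. \<sigma> (Choice l)"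

definition "pass_cost = 15 * k + 100"
definition "branching = 2 * (sz + q) + 4"

lemma HitDist_le: "z < n \<Longrightarrow> \<tau> HitDist 0 z \<le> 2 * n"
  using nearest[of z] by (simp add: nearest_among_def)

lemma HitNear_less: "z < n \<Longrightarrow> \<tau> HitNear 0 z < n"
  using nearest[of z] by (simp add: nearest_among_def)

lemma HitNear_nearest:
  assumes "z < n" "\<tau> HitDist 0 z < 2 * n"
  shows "\<tau> HitNear 0 z < sz" "d z (\<tau> Hitter 0 (\<tau> HitNear 0 z)) = \<tau> HitDist 0 z"
  using nearest[OF assms(1)] assms(2) by (simp_all add: nearest_among_def)

lemma Dist_eq: "tables \<alpha> \<Longrightarrow> s < n \<Longrightarrow> u < n \<Longrightarrow> \<alpha> Dist s u = d s u"
  using distancesD[OF dist] by (simp add: tablesD)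

lemma beyond_expr_correct:
  assumes "tables \<alpha>" "\<sigma> Probe < n" "\<And>l. l < i \<Longrightarrow> \<sigma> (Choice l) < n"
  shows "fits (beyond_expr i) \<sigma> \<alpha>" "val (beyond_expr i) \<sigma> \<alpha> =
      of_bool (beyond i (choices \<sigma>) (\<sigma> Limit) (\<sigma> Probe))"
proof -
  have "fits (beyond_expr i) \<sigma> \<alpha> \<and>
      val (beyond_expr i) \<sigma> \<alpha> = of_bool (beyond i (choices \<sigma>) (\<sigma> Limit) (\<sigma> Probe))"
    using assms(3)
  proof (induction i)
    case (Suc i)
    then show ?case using assms(1,2) by (auto simp: Dist_eq beyond_Suc)
  qed simp
  then show "fits (beyond_expr i) \<sigma> \<alpha>"
    "val (beyond_expr i) \<sigma> \<alpha> = of_bool (beyond i (choices \<sigma>) (\<sigma> Limit) (\<sigma> Probe))" by simp_all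
qed

end

locale search_round = search_tables +
  fixes R :: nat
  assumes R_less: "R < n"
begin

sublocale cs: center_search n E k hitters "row_set \<tau>" "\<tau> HitDist 0" R
proof unfold_locales
  show "1 \<le> k" "R < n" by (rule k_pos, rule R_less)
  show "s < n" if "s \<in> hitters" for s using that hitter_less by auto
  show "row_set \<tau> v \<noteq> {}" for v using q_pos by (simp add: row_set_def lessThan_empty_iff)
  show "\<tau> HitDist 0 v \<le> d v s" if "v < n" "s \<in> hitters" for v s
    using nearest[OF that(1)] that(2) by (auto simp: nearest_among_def)
  show "\<exists>s\<in>hitters. d v s = \<tau> HitDist 0 v" if "v < n" "\<tau> HitDist 0 v < 2 * n" for v
    using HitNear_nearest[OF that] by auto
qed (use HitDist_le row_ball HitDist_eq_0 in auto)

definition round_params :: "store \<Rightarrow> bool" where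
  "round_params \<sigma> \<longleftrightarrow> \<sigma> Row_len = q \<and> \<sigma> Num_hit = sz \<and> \<sigma> Guess = R \<and> \<sigma> Gap = cs.h \<and> \<sigma> Target = cs.D \<and>
     \<sigma> Half = cs.rho"

lemma round_paramsD:
  assumes "round_params \<sigma>"
  shows "\<sigma> Row_len = q" "\<sigma> Num_hit = sz" "\<sigma> Guess = R" "\<sigma> Gap = cs.h" "\<sigma> Target = cs.D" "\<sigma> Half = cs.rho"
  using assms by (simp_all add: round_params_def)

lemma round_params_cong:
  "round_params \<sigma> \<Longrightarrow> (\<And>x. x \<in> {Row_len, Num_hit, Guess, Gap, Target, Half} \<Longrightarrow> \<sigma>' x = \<sigma> x) \<Longrightarrow> round_params \<sigma>'"
  by (simp add: round_params_def)

definition covering :: "store \<Rightarrow> bool" where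
  "covering \<sigma> \<longleftrightarrow> (\<forall>l<k. \<sigma> (Center l) < n) \<and> (\<forall>z<n. \<exists>l<k. d (\<sigma> (Center l)) z \<le> cs.D)"

text \<open>Until a covering has been found, the old centers \<open>Y\<close> are kept.\<close>

definition solution_inv :: "(nat \<Rightarrow> nat) \<Rightarrow> store \<Rightarrow> bool" where
  "solution_inv Y \<sigma> \<longleftrightarrow> (if \<sigma> Found = 0 then \<forall>l<k. \<sigma> (Center l) = Y l else covering \<sigma>)"

definition found_if :: "(nat \<Rightarrow> nat) \<Rightarrow> store \<Rightarrow> bool \<Rightarrow> store \<Rightarrow> bool" where
  "found_if Y \<sigma> P \<sigma>' \<longleftrightarrow> solution_inv Y \<sigma>' \<and> (\<sigma> Found \<noteq> 0 \<or> P \<longrightarrow> \<sigma>' Found \<noteq> 0)"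

lemma solution_inv_cong:
  assumes "\<sigma>' Found = \<sigma> Found" "\<And>l. \<sigma>' (Center l) = \<sigma> (Center l)"
  shows "solution_inv Y \<sigma>' \<longleftrightarrow> solution_inv Y \<sigma>"
  using assms by (simp add: solution_inv_def covering_def)

lemma solution_inv_upd [simp]:
  "x \<noteq> Found \<Longrightarrow> (\<And>l. x \<noteq> Center l) \<Longrightarrow> solution_inv Y (\<sigma>(x := b)) \<longleftrightarrow> solution_inv Y \<sigma>"
  by (rule solution_inv_cong) auto

lemma found_if_upd [simp]:
  "x \<noteq> Found \<Longrightarrow> (\<And>l. x \<noteq> Center l) \<Longrightarrow> found_if Y \<sigma> P (\<sigma>'(x := b)) \<longleftrightarrow> found_if Y \<sigma> P \<sigma>'"
  by (simp add: found_if_def)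

lemma found_if_trans:
  "found_if Y \<sigma> P \<sigma>1 \<Longrightarrow> \<sigma>2 Found = \<sigma>1 Found \<Longrightarrow> found_if Y \<sigma>2 P' \<sigma>' \<Longrightarrow> found_if Y \<sigma> (P \<or> P') \<sigma>'"
  by (auto simp: found_if_def)

lemma found_if_weaken:
  "found_if Y \<sigma> P \<sigma>' \<Longrightarrow> \<sigma>1 Found = \<sigma> Found \<Longrightarrow> (P' \<Longrightarrow> P) \<Longrightarrow> found_if Y \<sigma>1 P' \<sigma>'"
  by (auto simp: found_if_def)

definition finishes :: "nat \<Rightarrow> (nat \<Rightarrow> nat) \<Rightarrow> nat \<Rightarrow> bool" where
  "finishes i X u \<longleftrightarrow> (\<forall>z<n. beyond i X cs.D z \<longrightarrow> d u z \<le> cs.D)"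

lemma wp_find_farthest:
  assumes tables: "tables \<alpha>" and chosen: "\<And>l. l < i \<Longrightarrow> \<sigma> (Choice l) < n" and i_less: "i < k"
  shows "wp (find_farthest i) (\<lambda>_ \<sigma>' \<alpha>'. cs.farthest i (choices \<sigma>) (\<sigma> Limit) (\<sigma>' Best) (\<sigma>' (Farthest i)))
    (n * pass_cost + 10) \<sigma> \<alpha>"
proof -
  let ?beyond = "beyond i (choices \<sigma>) (\<sigma> Limit)"
  let ?I = "\<lambda>j \<sigma>' (\<alpha>' :: arrays). \<sigma>' (Farthest i) < n \<and> (\<forall>z<j. ?beyond z \<longrightarrow> \<tau> HitDist 0 z < \<sigma>' Best) \<and>
     (\<sigma>' Best \<noteq> 0 \<longrightarrow> \<sigma>' Best = \<tau> HitDist 0 (\<sigma>' (Farthest i)) + 1 \<and> ?beyond (\<sigma>' (Farthest i)))"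
  have "wp (FOR Probe < NumV DO
        IF beyond_expr i \<otimes> (V Best \<prec> HitDist\<langle>V Probe\<rangle> \<oplus> Lit 1)
        THEN (Best ::= HitDist\<langle>V Probe\<rangle> \<oplus> Lit 1;; Farthest i ::= V Probe) ELSE SKIP)
      (\<lambda>_. ?I n) T (\<sigma>(Best := 0, Farthest i := 0)) \<alpha>" if "n * pass_cost + 6 \<le> T" for T
  proof (rule wp_For[where N = n and C = "15 * k + 92" and I = ?I],
      goal_cases bound word fresh cost indep init step)
    case (step z \<sigma>' \<alpha>')
    have unchanged: "\<alpha>' = \<alpha>" using step(4) by auto
    have same: "\<sigma>' (Choice l) = \<sigma> (Choice l)" "\<sigma>' Limit = \<sigma> Limit" for l using step(3) by auto
    have test: "fits (beyond_expr i) \<sigma>' \<alpha>" "val (beyond_expr i) \<sigma>' \<alpha> = of_bool (?beyond z)"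
      using beyond_expr_correct[OF tables, of \<sigma>' i] chosen step(1,2) by (simp_all add: same)
    have hit_dist: "\<alpha> HitDist 0 z = \<tau> HitDist 0 z" "\<tau> HitDist 0 z + 1 < 2 ^ w"
      using tablesD[OF tables] HitDist_le[OF step(1)] by (simp, intro less_word, simp)
    have less: "\<tau> HitDist 0 z' < \<sigma>' Best" if "z' < z" "?beyond z'" for z' using step(5) that by blast
    show ?case
    proof (cases "?beyond z \<and> \<sigma>' Best < \<tau> HitDist 0 z + 1")
      case True
      have "\<tau> HitDist 0 z' < \<tau> HitDist 0 z + 1" if "z' < Suc z" "?beyond z'" for z'
        using less[of z'] True that by (cases "z' = z") simp_all
      then show ?thesis unfolding unchanged using step(1,2) test hit_dist i_less True
        by (simp add: wp_simps)
    next
      case False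
      then have "\<tau> HitDist 0 z' < \<sigma>' Best" if "z' < Suc z" "?beyond z'" for z'
        using less[of z'] that by (cases "z' = z") auto
      moreover have "of_bool (?beyond z) * of_bool (\<sigma>' Best < \<tau> HitDist 0 z + 1) = (0::nat)"
        using False by auto
      ultimately show ?thesis unfolding unchanged using step(1,2,5) test hit_dist i_less
        by (simp add: wp_simps)
    qed
  qed (use that n_pos less_word in \<open>auto simp: pass_cost_def algebra_simps\<close>)
  then show ?thesis by (simp add: find_farthest_def wp_simps cs.farthest_def)
qed

lemma wp_farthest_then:
  assumes tables: "tables \<alpha>" and chosen: "\<And>l. l < i \<Longrightarrow> \<sigma> (Choice l) < n" and i_less: "i < k"
    and round: "round_params \<sigma>" and inv: "solution_inv Y \<sigma>" and limit: "fits e \<sigma> \<alpha>" "val e \<sigma> \<alpha> = b"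
    and time: "n * pass_cost + 11 + steps e \<le> T"
    and rest: "\<And>\<sigma>1 t. T \<le> t + (n * pass_cost + 11 + steps e) \<Longrightarrow> round_params \<sigma>1 \<Longrightarrow> solution_inv Y \<sigma>1 \<Longrightarrow>
      (\<And>l. \<sigma>1 (Choice l) = \<sigma> (Choice l)) \<Longrightarrow> \<sigma>1 Found = \<sigma> Found \<Longrightarrow> \<sigma>1 Limit = b \<Longrightarrow>
      cs.farthest i (choices \<sigma>) b (\<sigma>1 Best) (\<sigma>1 (Farthest i)) \<Longrightarrow> wp c Q t \<sigma>1 \<alpha>"
  shows "wp (Limit ::= e;; find_farthest i;; c) Q T \<sigma> \<alpha>"
proof -
  let ?\<sigma> = "\<sigma>(Limit := b)"
  have "wp (find_farthest i;; c) Q (T - (steps e + 1)) ?\<sigma> \<alpha>"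
    unfolding wp_Seq
  proof (rule wp_conseq[OF wp_find_farthest[OF tables]], goal_cases chosen level budget post)
    case (post t \<sigma>1 \<alpha>1)
    have unchanged: "\<alpha>1 = \<alpha>" using post(4) by auto
    have frame: "\<sigma>1 x = ?\<sigma> x" if "x \<notin> {Best, Farthest i, Probe}" for x using post(3)[of x] that by simp
    show ?case
      unfolding unchanged
    proof (rule rest)
      show "round_params \<sigma>1" using round by (rule round_params_cong) (auto simp: frame)
      show "solution_inv Y \<sigma>1" using inv by (subst solution_inv_cong[of _ \<sigma>]) (simp_all add: frame)
    qed (use post(1,5) in \<open>simp_all add: frame\<close>)
  qed (use chosen i_less time in simp_all)
  then show ?thesis using limit time by (simp add: wp_Seq[of "Limit ::= _"] wp_Assign)
qed

lemma wp_save_choices: "wp (save_choices i) (\<lambda>_ \<sigma>' \<alpha>'. \<forall>l<i. \<sigma>' (Center l) = \<sigma> (Choice l)) (2 * i) \<sigma> \<alpha>"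
proof (induction i)
  case (Suc i)
  show ?case
    unfolding save_choices.simps wp_Seq
  proof (rule wp_conseq[OF Suc], goal_cases budget post)
    case (post t \<sigma>' \<alpha>')
    have "\<sigma>' (Choice i) = \<sigma> (Choice i)" using post(3) by auto
    then show ?case using post(1,5) by (auto simp: wp_simps less_Suc_eq)
  qed simp
qed (simp add: wp_simps)

lemma covering_if_finishes:
  assumes last: "Suc i = k" and chosen: "\<And>l. l < i \<Longrightarrow> X l < n" and finishing: "u < n" "finishes i X u"
    and center: "\<And>l. l < i \<Longrightarrow> \<sigma> (Center l) = X l" "\<sigma> (Center i) = u"
  shows "covering \<sigma>"
  unfolding covering_def
proof (intro conjI allI impI)
  show "\<sigma> (Center l) < n" if "l < k" for l
    using that last chosen finishing(1) center by (cases "l = i") simp_all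
  show "\<exists>l<k. d (\<sigma> (Center l)) z \<le> cs.D" if z_less: "z < n" for z
  proof (cases "beyond i X cs.D z")
    case True
    then have "d (\<sigma> (Center i)) z \<le> cs.D" using finishing(2) z_less center(2) by (simp add: finishes_def)
    then show ?thesis using last by blast
  next
    case False
    then obtain l where "l < i" "d (X l) z \<le> cs.D" by (auto simp: beyond_def not_less)
    then show ?thesis using center(1) last by (intro exI[of _ l]) simp
  qed
qed

lemma wp_record_solution:
  assumes last: "Suc i = k" and chosen: "\<And>l. l < i \<Longrightarrow> \<sigma> (Choice l) < n" and pick: "\<sigma> Pick < n"
    and inv: "solution_inv Y \<sigma>"
    and valid: "\<sigma> Valid \<noteq> 0 \<Longrightarrow> finishes i (choices \<sigma>) (\<sigma> Pick)"
  shows "wp (record_solution i) (\<lambda>_ \<sigma>' \<alpha>'. found_if Y \<sigma> (\<sigma> Valid \<noteq> 0) \<sigma>') (2 * k + 10) \<sigma> \<alpha>"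
proof (cases "\<sigma> Valid = 0")
  case True
  then show ?thesis using inv by (simp add: record_solution_def wp_simps found_if_def)
next
  case False
  have "wp (save_choices i;; Center i ::= V Pick) (\<lambda>_ \<sigma>' \<alpha>'. found_if Y \<sigma> True \<sigma>') T (\<sigma>(Found := 1)) \<alpha>"
    if time: "2 * k + 2 \<le> T" for T
    unfolding wp_Seq
  proof (rule wp_conseq[OF wp_save_choices], goal_cases budget post)
    case (post t \<sigma>1 \<alpha>1)
    define \<sigma>' where "\<sigma>' = \<sigma>1(Center i := \<sigma> Pick)"
    have same: "\<sigma>1 Found = 1" "\<sigma>1 Pick = \<sigma> Pick"
      using post(3)[of Found] post(3)[of Pick] by (simp_all add: image_iff)
    have "covering \<sigma>'"
      by (rule covering_if_finishes[OF last chosen pick valid[OF False]])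
        (use post(5) in \<open>simp_all add: \<sigma>'_def\<close>)
    then have "found_if Y \<sigma> True \<sigma>'" using same by (simp add: found_if_def solution_inv_def \<sigma>'_def)
    then show ?case using post(1) time last same by (simp add: wp_simps \<sigma>'_def)
  qed (use time last in simp)
  then show ?thesis using False by (simp add: record_solution_def wp_simps)
qed

lemma wp_check_then_record:
  assumes check: "wp c (\<lambda>_ \<sigma>' \<alpha>'. \<sigma>' Valid = of_bool b) C \<sigma> \<alpha>" "assigned c \<subseteq> {Valid, Pos, Probe}"
    and sound: "b \<Longrightarrow> finishes i (choices \<sigma>) (\<sigma> Pick)"
    and last: "Suc i = k" and chosen: "\<And>l. l < i \<Longrightarrow> \<sigma> (Choice l) < n" and pick: "\<sigma> Pick < n"
    and inv: "solution_inv Y \<sigma>"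
  shows "wp (c;; record_solution i) (\<lambda>_ \<sigma>' \<alpha>'. found_if Y \<sigma> b \<sigma>') (C + 2 * k + 10) \<sigma> \<alpha>"
  unfolding wp_Seq
proof (rule wp_conseq[OF check(1)], goal_cases budget post)
  case (post t \<sigma>1 \<alpha>1)
  have same: "\<sigma>1 x = \<sigma> x" if "x \<notin> {Valid, Pos, Probe}" for x
    using post(3)[of x] that check(2) by blast
  have "wp (record_solution i) (\<lambda>_ \<sigma>' \<alpha>'. found_if Y \<sigma>1 (\<sigma>1 Valid \<noteq> 0) \<sigma>') (2 * k + 10) \<sigma>1 \<alpha>1"
  proof (rule wp_record_solution[OF last])
    show "solution_inv Y \<sigma>1" using inv by (subst solution_inv_cong[of _ \<sigma>]) (simp_all add: same)
  qed (use chosen pick sound post(5) in \<open>simp_all add: same\<close>)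
  then show ?case
    by (rule wp_conseq) (use post(1,5) same[of Found] in \<open>simp_all add: found_if_def\<close>)
qed simp

lemma wp_check_directly:
  assumes tables: "tables \<alpha>" and chosen: "\<And>l. l < i \<Longrightarrow> \<sigma> (Choice l) < n" and i_less: "i < k"
    and pick: "\<sigma> Pick = u" "u < n" and limit: "\<sigma> Limit = cs.D"
  shows "wp (check_directly i) (\<lambda>_ \<sigma>' \<alpha>'. \<sigma>' Valid = of_bool (finishes i (choices \<sigma>) u))
      (n * pass_cost + 8) \<sigma> \<alpha>"
proof -
  let ?beyond = "beyond i (choices \<sigma>) cs.D"
  let ?I = "\<lambda>j \<sigma>' (\<alpha>' :: arrays). \<sigma>' Valid = of_bool (\<forall>z<j. ?beyond z \<longrightarrow> d u z \<le> cs.D)"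
  have "wp (FOR Probe < NumV DO
        IF beyond_expr i \<otimes> (V Limit \<prec> Dist\<langle>V Pick, V Probe\<rangle>) THEN Valid ::= Lit 0 ELSE SKIP)
      (\<lambda>_. ?I n) T (\<sigma>(Valid := 1)) \<alpha>" if "n * pass_cost + 6 \<le> T" for T
  proof (rule wp_For[where N = n and C = "15 * k + 92" and I = ?I],
      goal_cases bound word fresh cost indep init step)
    case (step z \<sigma>' \<alpha>')
    have unchanged: "\<alpha>' = \<alpha>" using step(4) by auto
    have same: "\<sigma>' (Choice l) = \<sigma> (Choice l)" "\<sigma>' Limit = cs.D" "\<sigma>' Pick = u" for l
      using step(3) limit pick by auto
    have test: "fits (beyond_expr i) \<sigma>' \<alpha>" "val (beyond_expr i) \<sigma>' \<alpha> = of_bool (?beyond z)"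
      using beyond_expr_correct[OF tables, of \<sigma>' i] chosen step(1,2) by (simp_all add: same)
    have "(\<forall>z'<Suc z. ?beyond z' \<longrightarrow> d u z' \<le> cs.D) \<longleftrightarrow>
        (\<forall>z'<z. ?beyond z' \<longrightarrow> d u z' \<le> cs.D) \<and> \<not> (?beyond z \<and> cs.D < d u z)"
      by (auto simp: less_Suc_eq not_less)
    then show ?case
      unfolding unchanged using step(1,2,5) test i_less pick(2)
      by (simp add: wp_simps same Dist_eq[OF tables])
  qed (use that less_word in \<open>auto simp: pass_cost_def algebra_simps\<close>)
  then show ?thesis by (simp add: check_directly_def wp_simps finishes_def)
qed

lemma wp_found_if_Suc:
  assumes "found_if Y \<sigma> (\<exists>p<j. P p) \<sigma>'" "\<sigma>'' Found = \<sigma>' Found"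
    and "wp c (\<lambda>_ \<sigma>1 \<alpha>1. found_if Y \<sigma>'' (P j) \<sigma>1) C \<sigma>'' \<alpha>" "C \<le> T"
  shows "wp c (\<lambda>_ \<sigma>1 \<alpha>1. found_if Y \<sigma> (\<exists>p<Suc j. P p) \<sigma>1) T \<sigma>'' \<alpha>"
proof (rule wp_conseq[OF assms(3,4)], goal_cases post)
  case (post t \<sigma>1 \<alpha>1)
  have "(\<exists>p<Suc j. P p) \<longleftrightarrow> (\<exists>p<j. P p) \<or> P j" by (auto simp: less_Suc_eq)
  then show ?case using found_if_trans[OF assms(1,2) post(5)] by simp
qed

lemma wp_last_from_row:
  assumes tables: "tables \<alpha>" and chosen: "\<And>l. l < i \<Longrightarrow> \<sigma> (Choice l) < n" and last: "Suc i = k"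
    and farthest: "\<sigma> (Farthest i) = v" "v < n" and vars: "\<sigma> Limit = cs.D" "\<sigma> Row_len = q"
    and inv: "solution_inv Y \<sigma>"
  shows "wp (last_from_row i) (\<lambda>_ \<sigma>' \<alpha>'. found_if Y \<sigma> (\<exists>u\<in>row_set \<tau> v. finishes i (choices \<sigma>) u) \<sigma>')
    (q * (n * pass_cost + pass_cost) + 6) \<sigma> \<alpha>"
proof -
  let ?I = "\<lambda>j \<sigma>' (\<alpha>' :: arrays). found_if Y \<sigma> (\<exists>p<j. finishes i (choices \<sigma>) (\<tau> Queue v p)) \<sigma>'"
  have "wp (last_from_row i) (\<lambda>_. ?I q) (q * (n * pass_cost + pass_cost) + 6) \<sigma> \<alpha>"
    unfolding last_from_row_def
  proof (rule wp_For[where N = q and C = "n * pass_cost + 8 + 2 * k + 10 + 13" and I = ?I],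
      goal_cases bound word fresh cost indep init step)
    case (step p \<sigma>' \<alpha>')
    define u where "u = \<tau> Queue v p"
    define \<sigma>1 where "\<sigma>1 = \<sigma>'(Pick := u)"
    have unchanged: "\<alpha>' = \<alpha>" using step(4) by auto
    have frame: "\<sigma>' x = \<sigma> x" if "x \<notin> {Pos, Pick, Valid, Probe, Found} \<union> range Center" for x
      using step(3)[of x] that by auto
    have same: "choices \<sigma>1 = choices \<sigma>" "\<sigma>1 Limit = cs.D" "\<sigma>1 Pick = u" "\<sigma>' (Farthest i) = v"
      using vars farthest by (simp_all add: \<sigma>1_def frame image_iff)
    have u_less: "u < n" using row_less[OF farthest(2) step(1)] by (simp add: u_def)
    have "solution_inv Y \<sigma>1" using step(5) by (simp add: \<sigma>1_def found_if_def)
    moreover have "wp (check_directly i) (\<lambda>_ \<sigma>'' \<alpha>''. \<sigma>'' Valid = of_bool (finishes i (choices \<sigma>) u))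
        (n * pass_cost + 8) \<sigma>1 \<alpha>"
      unfolding same(1)[symmetric] by (rule wp_check_directly)
        (use tables chosen last u_less in \<open>simp_all add: same(2-) fun_cong[OF same(1)]\<close>)
    ultimately have found: "wp (check_directly i;; record_solution i)
        (\<lambda>_ \<sigma>'' \<alpha>''. found_if Y \<sigma>1 (finishes i (choices \<sigma>) u) \<sigma>'') (n * pass_cost + 8 + 2 * k + 10) \<sigma>1 \<alpha>"
      by (intro wp_check_then_record[OF _ _ _ last])
        (use chosen u_less in \<open>simp_all add: same fun_cong[OF same(1)]\<close>)
    have "\<sigma>1 Found = \<sigma>' Found" by (simp add: \<sigma>1_def)
    note found_Suc = wp_found_if_Suc[where P = "\<lambda>p. finishes i (choices \<sigma>) (\<tau> Queue v p)" and
        \<sigma>' = \<sigma>' and \<sigma>'' = \<sigma>1, OF step(5) this, folded u_def, OF found]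
    then show ?case
      unfolding unchanged wp_Seq[of "Pick ::= _"] using found_Suc step(1,2) farthest(2) q_le
      by (simp add: wp_Assign same tablesD[OF tables] \<sigma>1_def flip: u_def)
  qed (use vars q_le less_word inv in \<open>auto simp: pass_cost_def algebra_simps found_if_def\<close>)
  moreover have "(\<exists>p<q. finishes i (choices \<sigma>) (\<tau> Queue v p)) \<longleftrightarrow>
      (\<exists>u\<in>row_set \<tau> v. finishes i (choices \<sigma>) u)"
    by (auto simp: row_set_def)
  ultimately show ?thesis by simp
qed

definition needed :: "nat \<Rightarrow> (nat \<Rightarrow> nat) \<Rightarrow> nat \<Rightarrow> bool" where
  "needed i X j \<longleftrightarrow> (\<exists>z<n. beyond i X cs.D z \<and> \<tau> HitNear 0 z = j)"

lemma wp_mark_needed: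
  assumes tables: "tables \<alpha>" and chosen: "\<And>l. l < i \<Longrightarrow> \<sigma> (Choice l) < n" and i_less: "i < k"
    and vars: "\<sigma> Limit = cs.D" "\<sigma> Num_hit = sz"
  shows "wp (mark_needed i) (\<lambda>_ \<sigma>' \<alpha>'. \<forall>j<sz. \<alpha>' Needed 0 j = of_bool (needed i (choices \<sigma>) j))
    (sz * pass_cost + n * pass_cost + 12) \<sigma> \<alpha>"
proof -
  let ?beyond = "beyond i (choices \<sigma>) cs.D"
  let ?I = "\<lambda>p (\<sigma>' :: store) \<alpha>'. \<forall>j<sz. \<alpha>' Needed 0 j = of_bool (\<exists>z<p. ?beyond z \<and> \<tau> HitNear 0 z = j)"
  have zero: "wp (FOR Pos < V Num_hit DO Needed\<langle>V Pos\<rangle> \<leftarrow> Lit 0) (\<lambda>_. ?I 0) (sz * pass_cost + 6) \<sigma> \<alpha>"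
  proof (rule wp_For[where N = sz and C = 92 and
      I = "\<lambda>j \<sigma>' \<alpha>'. \<forall>j'<j. \<alpha>' Needed 0 j' = 0", THEN wp_conseq], goal_cases bound word fresh cost indep init step)
    case (step j \<sigma>' \<alpha>')
    then show ?case using sz_le by (simp add: wp_simps less_Suc_eq)
  qed (use vars sz_le less_word in \<open>auto simp: pass_cost_def algebra_simps\<close>)
  show ?thesis
    unfolding mark_needed_def wp_Seq
  proof (rule wp_conseq[OF zero], goal_cases budget post)
    case (post t \<sigma>1 \<alpha>1)
    note zeroed = post
    have "wp (FOR Probe < NumV DO IF beyond_expr i THEN Needed\<langle>HitNear\<langle>V Probe\<rangle>\<rangle> \<leftarrow> Lit 1 ELSE SKIP)
        (\<lambda>_. ?I n) t \<sigma>1 \<alpha>1"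
    proof (rule wp_For[where N = n and C = "15 * k + 92" and I = ?I],
        goal_cases bound word fresh cost indep init step)
      case (step z \<sigma>' \<alpha>')
      have tables': "tables \<alpha>'" by (rule tables_cong[OF tables]) (use step(4) zeroed(4) in simp)
      have same: "\<sigma>' (Choice l) = \<sigma> (Choice l)" "\<sigma>' Limit = cs.D" for l
        using step(3) zeroed(3) vars by simp_all
      have test: "fits (beyond_expr i) \<sigma>' \<alpha>'" "val (beyond_expr i) \<sigma>' \<alpha>' = of_bool (?beyond z)"
        using beyond_expr_correct[OF tables', of \<sigma>' i] chosen step(1,2) by (simp_all add: same)
      have split: "(\<exists>z'<Suc z. ?beyond z' \<and> \<tau> HitNear 0 z' = j) \<longleftrightarrow>
          (\<exists>z'<z. ?beyond z' \<and> \<tau> HitNear 0 z' = j) \<or> ?beyond z \<and> \<tau> HitNear 0 z = j" for j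
        by (auto simp: less_Suc_eq)
      show ?case
        using step(1,2,5) test i_less HitNear_less[OF step(1)]
        by (simp add: wp_simps split tablesD[OF tables'])
    qed (use zeroed(1,5) less_word in \<open>auto simp: pass_cost_def algebra_simps\<close>)
    then show ?case by (simp add: needed_def)
  qed simp
qed

definition reaches :: "(nat \<Rightarrow> bool) \<Rightarrow> nat \<Rightarrow> bool" where
  "reaches P u \<longleftrightarrow> (\<forall>j<sz. P j \<longrightarrow> d u (\<tau> Hitter 0 j) \<le> R + cs.rho)"

lemma wp_check_needed:
  assumes tables: "tables \<alpha>" "\<And>j. j < sz \<Longrightarrow> \<alpha> Needed 0 j = of_bool (P j)" and pick: "\<sigma> Pick = u" "u < n"
    and vars: "\<sigma> Num_hit = sz" "\<sigma> Guess = R" "\<sigma> Half = cs.rho"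
  shows "wp check_needed (\<lambda>_ \<sigma>' \<alpha>'. \<sigma>' Valid = of_bool (reaches P u))
    (sz * pass_cost + 8) \<sigma> \<alpha>"
proof -
  let ?ok = "\<lambda>j. P j \<longrightarrow> d u (\<tau> Hitter 0 j) \<le> R + cs.rho"
  let ?I = "\<lambda>j \<sigma>' (\<alpha>' :: arrays). \<sigma>' Valid = of_bool (\<forall>j'<j. ?ok j')"
  have "wp (FOR Pos < V Num_hit DO
        IF Needed\<langle>V Pos\<rangle> \<otimes> (V Guess \<oplus> V Half \<prec> Dist\<langle>V Pick, Hitter\<langle>V Pos\<rangle>\<rangle>)
        THEN Valid ::= Lit 0 ELSE SKIP)
      (\<lambda>_. ?I sz) T (\<sigma>(Valid := 1)) \<alpha>" if "sz * pass_cost + 6 \<le> T" for T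
  proof (rule wp_For[where N = sz and C = 92 and I = ?I],
      goal_cases bound word fresh cost indep init step)
    case (step j \<sigma>' \<alpha>')
    have unchanged: "\<alpha>' = \<alpha>" using step(4) by auto
    have same: "\<sigma>' Pick = u" "\<sigma>' Guess = R" "\<sigma>' Half = cs.rho" using step(3) vars pick by simp_all
    have "(\<forall>j'<Suc j. ?ok j') \<longleftrightarrow> (\<forall>j'<j. ?ok j') \<and> \<not> (P j \<and> R + cs.rho < d u (\<tau> Hitter 0 j))"
      by (auto simp: less_Suc_eq not_less)
    moreover have "R + cs.rho < 2 ^ w" using cs.rho_le R_less by (intro less_word) simp
    ultimately show ?case
      unfolding unchanged using step(1,2,5) pick(2) tables(2)[OF step(1)] hitter_less[OF step(1)] sz_le
      by (simp add: wp_simps same tablesD[OF tables(1)] distancesD[OF dist])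
  qed (use that vars sz_le less_word in \<open>auto simp: pass_cost_def algebra_simps\<close>)
  then show ?thesis by (simp add: check_needed_def wp_simps reaches_def)
qed

lemma wp_last_from_all:
  assumes tables: "tables \<alpha>" "\<And>j. j < sz \<Longrightarrow> \<alpha> Needed 0 j = of_bool (P j)"
    and chosen: "\<And>l. l < i \<Longrightarrow> \<sigma> (Choice l) < n" and last: "Suc i = k"
    and sound: "\<And>u. u < n \<Longrightarrow> reaches P u \<Longrightarrow> finishes i (choices \<sigma>) u"
    and vars: "\<sigma> Num_hit = sz" "\<sigma> Guess = R" "\<sigma> Half = cs.rho" and inv: "solution_inv Y \<sigma>"
  shows "wp (last_from_all i) (\<lambda>_ \<sigma>' \<alpha>'. found_if Y \<sigma> (\<exists>u<n. reaches P u) \<sigma>')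
    (n * (sz * pass_cost + pass_cost) + 6) \<sigma> \<alpha>"
  unfolding last_from_all_def
proof (rule wp_For[where N = n and C = "sz * pass_cost + 8 + 2 * k + 10" and
    I = "\<lambda>j \<sigma>' \<alpha>'. found_if Y \<sigma> (\<exists>u<j. reaches P u) \<sigma>'"],
      goal_cases bound word fresh cost indep init step)
  case (step u \<sigma>' \<alpha>')
  have unchanged: "\<alpha>' = \<alpha>" using step(4) by auto
  have frame: "\<sigma>' x = \<sigma> x" if "x \<notin> {Pos, Pick, Valid, Found} \<union> range Center" for x
    using step(3)[of x] that by auto
  have same: "choices \<sigma>' = choices \<sigma>" by (simp add: frame image_iff)
  have "wp check_needed (\<lambda>_ \<sigma>'' \<alpha>''. \<sigma>'' Valid = of_bool (reaches P u)) (sz * pass_cost + 8) \<sigma>' \<alpha>"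
    by (rule wp_check_needed) (use tables step(1,2) vars in \<open>simp_all add: frame image_iff\<close>)
  moreover have "solution_inv Y \<sigma>'" using step(5) by (simp add: found_if_def)
  ultimately have "wp (check_needed;; record_solution i) (\<lambda>_ \<sigma>'' \<alpha>''. found_if Y \<sigma>' (reaches P u) \<sigma>'')
      (sz * pass_cost + 8 + 2 * k + 10) \<sigma>' \<alpha>"
    using sound[OF step(1)] chosen step(1,2)
    by (intro wp_check_then_record[OF _ _ _ last]) (simp_all add: same fun_cong[OF same])
  from wp_found_if_Suc[where P = "reaches P" and \<sigma>' = \<sigma>' and \<sigma>'' = \<sigma>', OF step(5) refl this le_refl]
    show ?case by (simp add: unchanged)
qed (use inv less_word in \<open>auto simp: pass_cost_def algebra_simps found_if_def\<close>)

lemma finishes_if_reaches_needed: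
  assumes near: "\<And>z. z < n \<Longrightarrow> beyond i X cs.D z \<Longrightarrow> \<tau> HitDist 0 z \<le> cs.rho"
    and reaching: "reaches (needed i X) u"
  shows "finishes i X u"
  unfolding finishes_def
proof (intro allI impI)
  fix z assume z_beyond: "z < n" "beyond i X cs.D z"
  have z_near: "\<tau> HitDist 0 z \<le> cs.rho" by (rule near[OF z_beyond])
  have "\<tau> HitDist 0 z < 2 * n" using z_near cs.rho_le R_less by simp
  note hit = HitNear_nearest[OF z_beyond(1) this]
  have "needed i X (\<tau> HitNear 0 z)" using z_beyond by (auto simp: needed_def)
  then have "d u (\<tau> Hitter 0 (\<tau> HitNear 0 z)) \<le> R + cs.rho" using reaching hit(1)
    by (simp add: reaches_def)
  then show "d u z \<le> cs.D" by (rule cs.last_center_near_sound[OF z_beyond(1), rotated])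
    (use hit(2) z_near in simp)
qed

lemma reaches_needed_if_completable:
  assumes near: "\<And>z. z < n \<Longrightarrow> beyond i X cs.D z \<Longrightarrow> \<tau> HitDist 0 z \<le> cs.rho"
    and compl: "cs.completable i X" and last: "Suc i = k"
  shows "\<exists>u<n. reaches (needed i X) u"
proof -
  obtain c where cover: "c < n" "\<And>v. v < n \<Longrightarrow> beyond i X cs.D v \<Longrightarrow> d v c \<le> R"
    using cs.completable_last[OF compl last] by blast
  have "reaches (needed i X) c"
    unfolding reaches_def
  proof (intro allI impI)
    fix j assume "needed i X j"
    then obtain z where z_beyond: "z < n" "beyond i X cs.D z" "\<tau> HitNear 0 z = j"
      by (auto simp: needed_def)
    have z_near: "\<tau> HitDist 0 z \<le> cs.rho" by (rule near[OF z_beyond(1,2)])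
    then have "\<tau> HitDist 0 z < 2 * n" using cs.rho_le R_less by simp
    then show "d c (\<tau> Hitter 0 j) \<le> R + cs.rho"
      using cs.last_center_near_complete[OF z_beyond(1) _ cover(1) cover(2)[OF z_beyond(1,2)]]
        HitNear_nearest(2)[OF z_beyond(1)] z_near z_beyond(3)
      by simp
  qed
  then show ?thesis using cover(1) by blast
qed

lemma wp_last_near:
  assumes tables: "tables \<alpha>" and chosen: "\<And>l. l < i \<Longrightarrow> \<sigma> (Choice l) < n" and last: "Suc i = k"
    and round: "round_params \<sigma>" "\<sigma> Limit = cs.D" and inv: "solution_inv Y \<sigma>"
    and near: "\<And>z. z < n \<Longrightarrow> beyond i (choices \<sigma>) cs.D z \<Longrightarrow> \<tau> HitDist 0 z \<le> cs.rho"
  shows "wp (mark_needed i;; last_from_all i) (\<lambda>_ \<sigma>' \<alpha>'. found_if Y \<sigma> (cs.completable i (choices \<sigma>)) \<sigma>')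
    (sz * pass_cost + n * pass_cost + 12 + (n * (sz * pass_cost + pass_cost) + 6)) \<sigma> \<alpha>"
proof -
  note params = round_paramsD[OF round(1)]
  let ?needed = "needed i (choices \<sigma>)"
  have mark: "wp (mark_needed i) (\<lambda>_ \<sigma>' \<alpha>'. \<forall>j<sz. \<alpha>' Needed 0 j = of_bool (?needed j))
      (sz * pass_cost + n * pass_cost + 12) \<sigma> \<alpha>"
    by (rule wp_mark_needed) (use tables chosen last round(2) params in simp_all)
  show ?thesis
    unfolding wp_Seq
  proof (rule wp_conseq[OF mark], goal_cases budget post)
    case (post t \<sigma>1 \<alpha>1)
    have tables': "tables \<alpha>1" by (rule tables_cong[OF tables]) (use post(4) in simp)
    have same: "\<sigma>1 x = \<sigma> x" if "x \<notin> {Pos, Probe}" for x using post(3)[of x] that by simp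
    have "solution_inv Y \<sigma>1" using inv by (subst solution_inv_cong[of _ \<sigma>]) (simp_all add: same)
    then have all: "wp (last_from_all i) (\<lambda>_ \<sigma>' \<alpha>'. found_if Y \<sigma>1 (\<exists>u<n. reaches ?needed u) \<sigma>')
        (n * (sz * pass_cost + pass_cost) + 6) \<sigma>1 \<alpha>1"
      by (intro wp_last_from_all[OF tables'])
        (use post(5) chosen last params finishes_if_reaches_needed[OF near] in \<open>simp_all add: same\<close>)
    have "\<exists>u<n. reaches ?needed u" if "cs.completable i (choices \<sigma>)"
      by (rule reaches_needed_if_completable[OF near that last])
    then show ?case by (intro wp_conseq[OF all])
      (use post(1) same[of Found] in \<open>auto intro: found_if_weaken\<close>)
  qed simp
qed

lemma wp_last_far:
  assumes tables: "tables \<alpha>" and chosen: "\<And>l. l < i \<Longrightarrow> \<sigma> (Choice l) < n" and last: "Suc i = k"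
    and round: "round_params \<sigma>" "\<sigma> Limit = cs.D" and inv: "solution_inv Y \<sigma>"
    and far: "\<sigma> (Farthest i) < n" "beyond i (choices \<sigma>) cs.D (\<sigma> (Farthest i))"
      "cs.rho < \<tau> HitDist 0 (\<sigma> (Farthest i))"
  shows "wp (last_from_row i) (\<lambda>_ \<sigma>' \<alpha>'. found_if Y \<sigma> (cs.completable i (choices \<sigma>)) \<sigma>')
    (q * (n * pass_cost + pass_cost) + 6) \<sigma> \<alpha>"
proof -
  have "\<exists>u\<in>row_set \<tau> (\<sigma> (Farthest i)). finishes i (choices \<sigma>) u" if compl: "cs.completable i (choices \<sigma>)"
  proof -
    obtain c where cover: "c < n" "\<And>z. z < n \<Longrightarrow> beyond i (choices \<sigma>) cs.D z \<Longrightarrow> d z c \<le> R"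
      using cs.completable_last[OF compl last] by blast
    from cs.last_center_far_complete[OF cover far] show ?thesis by (simp add: finishes_def)
  qed
  then show ?thesis
    by (intro wp_conseq[OF wp_last_from_row[OF tables chosen last refl far(1) round(2)
          round_paramsD(1)[OF round(1)] inv]])
      (auto intro: found_if_weaken)
qed

lemma last_budget:
  assumes "n * pass_cost * branching \<le> T + n * pass_cost + 19"
  shows "sz * pass_cost + n * pass_cost + 12 + (n * (sz * pass_cost + pass_cost) + 6) \<le> T"
    "q * (n * pass_cost + pass_cost) + 6 \<le> T" "n * pass_cost + 10 \<le> T"
proof -
  have "1 * 100 \<le> n * pass_cost" "1 * (q * pass_cost) \<le> n * (q * pass_cost)"
    "1 * (sz * pass_cost) \<le> n * (sz * pass_cost)"
    using n_pos by (intro mult_le_mono; simp add: pass_cost_def)+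
  moreover have expand: "n * pass_cost * branching =
      2 * (n * (sz * pass_cost)) + 2 * (n * (q * pass_cost)) + 4 * (n * pass_cost)"
    "n * (sz * pass_cost + pass_cost) = n * (sz * pass_cost) + n * pass_cost"
    "q * (n * pass_cost + pass_cost) = n * (q * pass_cost) + q * pass_cost"
    unfolding branching_def by algebra+
  ultimately show "sz * pass_cost + n * pass_cost + 12 + (n * (sz * pass_cost + pass_cost) + 6) \<le> T"
    "q * (n * pass_cost + pass_cost) + 6 \<le> T" "n * pass_cost + 10 \<le> T"
    using assms unfolding expand mult_1 by linarith+
qed

lemma find_farthest_budget: "n * pass_cost + 12 \<le> n * pass_cost * branching"
  using last_budget(3)[of "n * pass_cost * branching - 2"] by linarith

lemma wp_choose_last:
  assumes tables: "tables \<alpha>" and chosen: "\<And>l. l < i \<Longrightarrow> \<sigma> (Choice l) < n" and last: "Suc i = k"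
    and round: "round_params \<sigma>" and inv: "solution_inv Y \<sigma>"
  shows "wp (choose_last i) (\<lambda>_ \<sigma>' \<alpha>'. found_if Y \<sigma> (cs.completable i (choices \<sigma>)) \<sigma>')
    (n * pass_cost * branching) \<sigma> \<alpha>"
  unfolding choose_last_def
proof (rule wp_farthest_then[where b = cs.D, OF tables chosen _ round inv],
    goal_cases chosen level fits val time rest)
  case (rest \<sigma>1 t)
  have far: "cs.farthest i (choices \<sigma>) cs.D (\<sigma>1 Best) (\<sigma>1 (Farthest i))" by (rule rest(7))
  have "cs.rho + 1 < 2 ^ w" using cs.rho_le R_less by (intro less_word) simp
  then have test: "fits (V Half \<oplus> Lit 1 \<prec> V Best) \<sigma>1 \<alpha>"
    "val (V Half \<oplus> Lit 1 \<prec> V Best) \<sigma>1 \<alpha> = of_bool (cs.rho + 1 < \<sigma>1 Best)"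
    using round_paramsD(6)[OF rest(2)] by simp_all
  have budget: "n * pass_cost * branching \<le> t - 6 + n * pass_cost + 19" using rest(1) by simp
  have step: "wp c (\<lambda>_ \<sigma>' \<alpha>'. found_if Y \<sigma> (cs.completable i (choices \<sigma>)) \<sigma>') (t - 6) \<sigma>1 \<alpha>"
    if "wp c (\<lambda>_ \<sigma>' \<alpha>'. found_if Y \<sigma>1 (cs.completable i (choices \<sigma>1)) \<sigma>') C \<sigma>1 \<alpha>" "C \<le> t - 6" for c C
    by (rule wp_conseq[OF that]) (use rest(4,5) in \<open>auto intro: found_if_weaken\<close>)
  show ?case
  proof (cases "cs.rho + 1 < \<sigma>1 Best")
    case True
    then have "wp (last_from_row i) (\<lambda>_ \<sigma>' \<alpha>'. found_if Y \<sigma>1 (cs.completable i (choices \<sigma>1)) \<sigma>')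
        (q * (n * pass_cost + pass_cost) + 6) \<sigma>1 \<alpha>"
      using tables chosen last rest far by (intro wp_last_far) (simp_all add: cs.farthest_def)
    from step[OF this last_budget(2)[OF budget]] show ?thesis
      using True test last_budget(3)[OF budget] by (simp add: wp_Branch)
  next
    case False
    then have "\<tau> HitDist 0 z \<le> cs.rho" if "z < n" "beyond i (choices \<sigma>) cs.D z" for z
      using far that by (fastforce simp: cs.farthest_def)
    then have "wp (mark_needed i;; last_from_all i)
        (\<lambda>_ \<sigma>' \<alpha>'. found_if Y \<sigma>1 (cs.completable i (choices \<sigma>1)) \<sigma>')
        (sz * pass_cost + n * pass_cost + 12 + (n * (sz * pass_cost + pass_cost) + 6)) \<sigma>1 \<alpha>"
      using tables chosen last rest by (intro wp_last_near) simp_all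
    from step[OF this last_budget(1)[OF budget]] show ?thesis
      using False test last_budget(3)[OF budget] by (simp add: wp_Branch)
  qed
qed (use last round_paramsD(5)[OF round] find_farthest_budget in simp_all)

definition candidate :: "nat \<Rightarrow> nat \<Rightarrow> nat" where
  "candidate v j = (if j < sz then \<tau> Hitter 0 j else \<tau> Queue v (j - sz))"

lemma candidate_less: "j < sz + q \<Longrightarrow> v < n \<Longrightarrow> candidate v j < n"
  using hitter_less row_less by (simp add: candidate_def)

lemma image_candidate: "candidate v ` {..<sz + q} = hitters \<union> row_set \<tau> v"
proof
  show "candidate v ` {..<sz + q} \<subseteq> hitters \<union> row_set \<tau> v"
    by (auto simp: candidate_def row_set_def)
  have "\<tau> Hitter 0 j = candidate v j" if "j < sz" for j using that by (simp add: candidate_def)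
  moreover have "\<tau> Queue v j = candidate v (sz + j)" for j by (simp add: candidate_def)
  ultimately show "hitters \<union> row_set \<tau> v \<subseteq> candidate v ` {..<sz + q}"
    by (force simp: row_set_def)
qed

lemma wp_select:
  assumes tables: "tables \<alpha>" and vars: "\<sigma> (Cursor i) = j" "j < sz + q" "\<sigma> Num_hit = sz"
    and farthest: "\<sigma> (Farthest i) = v" "v < n"
  shows "wp (select i) (\<lambda>_ \<sigma>' \<alpha>'. \<sigma>' (Choice i) = candidate v j) 19 \<sigma> \<alpha>"
proof -
  have "j < 2 ^ w" using vars(2) sz_le q_le by (intro less_word) simp
  then show ?thesis
    using vars farthest sz_le q_le by (auto simp: select_def wp_simps candidate_def tablesD[OF tables])
qed

lemma wp_try_candidate:
  assumes rest: "\<And>\<sigma> \<alpha>. tables \<alpha> \<Longrightarrow> (\<And>l. l < Suc i \<Longrightarrow> \<sigma> (Choice l) < n) \<Longrightarrow> round_params \<sigma> \<Longrightarrow>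
      solution_inv Y \<sigma> \<Longrightarrow> wp c (\<lambda>_ \<sigma>' \<alpha>'. found_if Y \<sigma> (cs.completable (Suc i) (choices \<sigma>)) \<sigma>') C \<sigma> \<alpha>"
    and tables: "tables \<alpha>" and chosen: "\<And>l. l < i \<Longrightarrow> \<sigma> (Choice l) < n"
    and round: "round_params \<sigma>" and inv: "solution_inv Y \<sigma>"
    and cursor: "\<sigma> (Cursor i) = j" "j < sz + q" and farthest: "\<sigma> (Farthest i) = v" "v < n"
  shows "wp (select i;; c)
    (\<lambda>_ \<sigma>' \<alpha>'. found_if Y \<sigma> (cs.completable (Suc i) ((choices \<sigma>)(i := candidate v j))) \<sigma>') (C + 19) \<sigma> \<alpha>"
proof -
  have select: "wp (select i) (\<lambda>_ \<sigma>' \<alpha>'. \<sigma>' (Choice i) = candidate v j) 19 \<sigma> \<alpha>"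
    by (rule wp_select[where \<sigma> = \<sigma>, OF tables cursor round_paramsD(2)[OF round] farthest])
  show ?thesis
    unfolding wp_Seq
  proof (rule wp_conseq[OF select], goal_cases budget post)
    case (post t \<sigma>1 \<alpha>1)
    have same: "\<sigma>1 x = \<sigma> x" if "x \<noteq> Choice i" for x using post(3) that by simp
    have choice: "\<sigma>1 (Choice l) = ((choices \<sigma>)(i := candidate v j)) l" if "l < Suc i" for l
      using that post(5) by (cases "l = i") (simp_all add: same)
    have "wp c (\<lambda>_ \<sigma>' \<alpha>'. found_if Y \<sigma>1 (cs.completable (Suc i) (choices \<sigma>1)) \<sigma>') C \<sigma>1 \<alpha>1"
    proof (rule rest)
      show "tables \<alpha>1" by (rule tables_cong[OF tables]) (use post(4) in simp)
      show "\<sigma>1 (Choice l) < n" if "l < Suc i" for l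
        using that chosen candidate_less[OF cursor(2) farthest(2)] choice[OF that]
        by (cases "l = i") simp_all
      show "round_params \<sigma>1" using round by (rule round_params_cong) (auto simp: same)
      show "solution_inv Y \<sigma>1" using inv by (subst solution_inv_cong[of _ \<sigma>]) (simp_all add: same)
    qed
    moreover have "cs.completable (Suc i) (choices \<sigma>1) \<longleftrightarrow>
        cs.completable (Suc i) ((choices \<sigma>)(i := candidate v j))"
      by (rule cs.completable_cong) (rule choice)
    ultimately show ?case
      by (intro wp_conseq[where T = t]) (use post(1) same[of Found] in \<open>auto simp: found_if_def\<close>)
  qed simp
qed

lemma wp_candidates:
  assumes rest: "\<And>\<sigma> \<alpha>. tables \<alpha> \<Longrightarrow> (\<And>l. l < Suc i \<Longrightarrow> \<sigma> (Choice l) < n) \<Longrightarrow> round_params \<sigma> \<Longrightarrow>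
      solution_inv Y \<sigma> \<Longrightarrow> wp (search (Suc i) r)
        (\<lambda>_ \<sigma>' \<alpha>'. found_if Y \<sigma> (cs.completable (Suc i) (choices \<sigma>)) \<sigma>') C \<sigma> \<alpha>"
    and tables: "tables \<alpha>" and chosen: "\<And>l. l < i \<Longrightarrow> \<sigma> (Choice l) < n"
    and round: "round_params \<sigma>" and inv: "solution_inv Y \<sigma>" and farthest: "\<sigma> (Farthest i) = v" "v < n"
  shows "wp (FOR Cursor i < V Num_hit \<oplus> V Row_len DO (select i;; search (Suc i) r))
    (\<lambda>_ \<sigma>' \<alpha>'. found_if Y \<sigma> (\<exists>x\<in>hitters \<union> row_set \<tau> v. cs.completable (Suc i) ((choices \<sigma>)(i := x))) \<sigma>')
    ((sz + q) * (C + 29) + 8) \<sigma> \<alpha>"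
proof -
  let ?P = "\<lambda>j. cs.completable (Suc i) ((choices \<sigma>)(i := candidate v j))"
  have sz_q: "sz + q < 2 ^ w" using sz_le q_le by (intro less_word) simp
  have "wp (FOR Cursor i < V Num_hit \<oplus> V Row_len DO (select i;; search (Suc i) r))
      (\<lambda>_ \<sigma>' \<alpha>'. found_if Y \<sigma> (\<exists>p<sz + q. ?P p) \<sigma>') ((sz + q) * (C + 29) + 8) \<sigma> \<alpha>"
  proof (rule wp_For[where N = "sz + q" and C = "C + 19" and
      I = "\<lambda>j \<sigma>' \<alpha>'. found_if Y \<sigma> (\<exists>p<j. ?P p) \<sigma>'"],
      goal_cases bound word fresh cost indep init step)
    case (bound \<sigma>' \<alpha>')
    then have "\<sigma>' Num_hit = \<sigma> Num_hit" "\<sigma>' Row_len = \<sigma> Row_len" using assigned_search[of "Suc i" r]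
      by auto
    then show ?case using round_paramsD(1,2)[OF round] sz_q by simp
  next
    case fresh
    show ?case using assigned_search[of "Suc i" r] by auto
  next
    case (step j \<sigma>' \<alpha>')
    have tables': "tables \<alpha>'" by (rule tables_cong[OF tables]) (use step(4) in simp)
    have frame: "\<sigma>' x = \<sigma> x" if "x \<in> {Row_len, Num_hit, Guess, Gap, Target, Half, Farthest i} \<union>
        Choice ` {..<i}" for x
    proof -
      have "x \<notin> assigned (search (Suc i) r)" by (rule contra_subsetD[OF assigned_search])
        (use that in auto)
      then show ?thesis using step(3)[of x] that by auto
    qed
    have round': "round_params \<sigma>'" using round by (rule round_params_cong) (auto simp: frame)
    have "((choices \<sigma>')(i := candidate v j)) l = ((choices \<sigma>)(i := candidate v j)) l" if "l < Suc i" for l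
      using that by (cases "l = i") (simp_all add: frame)
    then have same: "cs.completable (Suc i) ((choices \<sigma>')(i := candidate v j)) \<longleftrightarrow> ?P j"
      by (rule cs.completable_cong)
    have "wp (select i;; search (Suc i) r) (\<lambda>_ \<sigma>'' \<alpha>''. found_if Y \<sigma>' (?P j) \<sigma>'') (C + 19) \<sigma>' \<alpha>'"
      unfolding same[symmetric] using chosen farthest step(1,2,5)
      by (intro wp_try_candidate[OF rest tables' _ round']) (simp_all add: frame found_if_def)
    then show ?case using wp_found_if_Suc[where P = ?P and \<sigma>' = \<sigma>' and \<sigma>'' = \<sigma>', OF step(5)] by simp
  qed (use inv sz_q in \<open>simp_all add: found_if_def solution_inv_def covering_def\<close>)
  then show ?thesis unfolding image_candidate[symmetric] by (simp add: Bex_def)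
qed

lemma search_budget:
  "(sz + q) * (n * pass_cost * branching ^ Suc r + 29) + n * pass_cost + 26
    \<le> n * pass_cost * branching ^ Suc (Suc r)"
proof -
  let ?C = "n * pass_cost * branching ^ Suc r"
  have "1 \<le> branching ^ Suc r" by (intro one_le_power) (simp add: branching_def)
  then have "n * pass_cost \<le> ?C" by (metis mult.right_neutral mult_le_mono2)
  moreover have "1 * 100 \<le> n * pass_cost" using n_pos by (intro mult_le_mono)
    (simp_all add: pass_cost_def)
  ultimately have "29 \<le> ?C" "n * pass_cost + 26 \<le> 4 * ?C" by linarith+
  moreover from this(1) have "(sz + q) * (?C + 29) \<le> (sz + q) * (?C + ?C)" by simp
  ultimately have "(sz + q) * (?C + 29) + n * pass_cost + 26 \<le> (sz + q) * (?C + ?C) + 4 * ?C" by linarith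
  also have "\<dots> = ?C * branching" unfolding branching_def by algebra
  finally show ?thesis by (simp add: ac_simps)
qed

lemma wp_search:
  assumes "tables \<alpha>" "\<And>l. l < i \<Longrightarrow> \<sigma> (Choice l) < n" "Suc (i + r) = k" "round_params \<sigma>" "solution_inv Y \<sigma>"
  shows "wp (search i r) (\<lambda>_ \<sigma>' \<alpha>'. found_if Y \<sigma> (cs.completable i (choices \<sigma>)) \<sigma>')
    (n * pass_cost * branching ^ Suc r) \<sigma> \<alpha>"
  using assms
proof (induction r arbitrary: i \<sigma> \<alpha>)
  case 0
  then show ?case by (simp add: wp_choose_last)
next
  case (Suc r)
  let ?C = "n * pass_cost * branching ^ Suc r"
  have i_less: "i < k" "Suc i < k" using Suc.prems(3) by simp_all
  have threshold: "cs.threshold i = R + 2 * i * cs.h - cs.h" by (simp add: cs.threshold_def)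
  have bounds: "2 * i < 2 ^ w" "2 * i * cs.h < 2 ^ w" "R + 2 * i * cs.h < 2 ^ w"
    using cs.h_bound[OF i_less(1)] R_less i_less(1) k_le by (intro less_word; simp)+
  show ?case
    unfolding search.simps
  proof (rule wp_farthest_then[where b = "cs.threshold i", OF Suc.prems(1,2) i_less(1) Suc.prems(4,5)],
      goal_cases chosen fits val time rest)
    case (rest \<sigma>1 t)
    define v where "v = \<sigma>1 (Farthest i)"
    have far: "cs.farthest i (choices \<sigma>) (cs.threshold i) (\<sigma>1 Best) v" using rest(7) by (simp add: v_def)
    then have v_less: "v < n" by (simp add: cs.farthest_def)
    have loop: "wp (FOR Cursor i < V Num_hit \<oplus> V Row_len DO (select i;; search (Suc i) r))
        (\<lambda>_ \<sigma>' \<alpha>'. found_if Y \<sigma>1 (\<exists>x\<in>hitters \<union> row_set \<tau> v. cs.completable (Suc i) ((choices \<sigma>1)(i := x)))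
          \<sigma>')
        ((sz + q) * (?C + 29) + 8) \<sigma>1 \<alpha>"
    proof (rule wp_candidates[OF _ Suc.prems(1) _ rest(2,3) v_def[symmetric] v_less])
      show "wp (search (Suc i) r) (\<lambda>_ \<sigma>' \<alpha>'. found_if Y \<sigma> (cs.completable (Suc i) (choices \<sigma>)) \<sigma>') ?C \<sigma> \<alpha>"
        if "tables \<alpha>" "\<And>l. l < Suc i \<Longrightarrow> \<sigma> (Choice l) < n" "round_params \<sigma>" "solution_inv Y \<sigma>" for \<sigma> \<alpha>
        using Suc.IH[of \<alpha> "Suc i" \<sigma>] that Suc.prems(3) by simp
    qed (use Suc.prems(2) rest(4) in simp)
    have "\<exists>x\<in>hitters \<union> row_set \<tau> v. cs.completable (Suc i) ((choices \<sigma>)(i := x))"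
      if "cs.completable i (choices \<sigma>)"
      using cs.completable_step[OF that i_less(2) far] Suc.prems(2) by blast
    then show ?case
      by (intro wp_conseq[OF loop]) (use rest(1,4,5) search_budget[of r] in \<open>auto intro: found_if_weaken\<close>)
  qed (use threshold bounds cs.h_le search_budget[of r] round_paramsD(3,4)[OF Suc.prems(4)] in simp_all)
qed

end

section \<open>Binary search for the radius\<close>

definition probe_guess :: "nat \<Rightarrow> com" where
  "probe_guess k =
     (Gap ::= V Guess \<oslash> Lit (2 * k - 1);;
      Target ::= Lit 2 \<otimes> V Guess \<ominus> V Gap;;
      Half ::= (V Guess \<ominus> V Gap) \<oslash> Lit 2;;
      Found ::= Lit 0;;
      search 0 (k - 1))"

definition halve :: "nat \<Rightarrow> com" where
  "halve k =
     (Guess ::= (V Low \<oplus> V High) \<oslash> Lit 2;;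
      probe_guess k;;
      (IF V Found THEN High ::= V Guess ELSE Low ::= V Guess \<oplus> Lit 1))"

definition binary_search :: "nat \<Rightarrow> com" where
  "binary_search k = (Low ::= Lit 0;; High ::= NumV;; (WHILE V Low \<prec> V High DO halve k))"

lemma assigned_probe_guess:
  "x \<in> {Row_len, Num_hit, Guess, Low, High} \<Longrightarrow> x \<notin> assigned (probe_guess k)"
  using assigned_search[of 0 "k - 1"] by (auto simp: probe_guess_def)

lemma stored_binary_search [simp]:
  "stored (probe_guess k) = {Needed}" "stored (halve k) = {Needed}" "stored (binary_search k) = {Needed}"
  by (simp_all add: probe_guess_def halve_def binary_search_def)

definition approx_radius :: "nat \<Rightarrow> nat \<Rightarrow> nat" where
  "approx_radius k R = 2 * R - R div (2 * k - 1)"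

context search_round begin

lemma D_eq: "cs.D = approx_radius k R"
  by (simp add: cs.D_def cs.h_def approx_radius_def)

lemma wp_probe_guess:
  assumes tables: "tables \<alpha>" and vars: "\<sigma> Row_len = q" "\<sigma> Num_hit = sz" "\<sigma> Guess = R"
  shows "wp (probe_guess k) (\<lambda>_ \<sigma>' \<alpha>'. if \<sigma>' Found = 0
      then (\<forall>l<k. \<sigma>' (Center l) = \<sigma> (Center l)) \<and> enat (R + 1) \<le> k_radius n E k else covering \<sigma>')
    (n * pass_cost * branching ^ k + 18) \<sigma> \<alpha>"
proof -
  define \<sigma>1 where "\<sigma>1 = \<sigma>(Gap := cs.h, Target := cs.D, Half := cs.rho, Found := 0)"
  have "round_params \<sigma>1" "solution_inv (\<lambda>l. \<sigma> (Center l)) \<sigma>1"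
    using vars by (simp_all add: \<sigma>1_def round_params_def solution_inv_def)
  then have "wp (search 0 (k - 1)) (\<lambda>_ \<sigma>' \<alpha>'. found_if (\<lambda>l. \<sigma> (Center l)) \<sigma>1
      (cs.completable 0 (choices \<sigma>1)) \<sigma>')
      (n * pass_cost * branching ^ k) \<sigma>1 \<alpha>"
    using wp_search[OF tables, of 0 \<sigma>1 "k - 1"] k_pos by simp
  then have "wp (search 0 (k - 1)) (\<lambda>_ \<sigma>' \<alpha>'. if \<sigma>' Found = 0
      then (\<forall>l<k. \<sigma>' (Center l) = \<sigma> (Center l)) \<and> enat (R + 1) \<le> k_radius n E k else covering \<sigma>')
      (n * pass_cost * branching ^ k) \<sigma>1 \<alpha>"
  proof (rule wp_conseq, goal_cases budget post)
    case (post t \<sigma>' \<alpha>')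
    have "\<not> k_radius n E k \<le> enat R" if "\<sigma>' Found = 0"
      using post(5) cs.completable_initially[of "choices \<sigma>1"] that by (auto simp: found_if_def)
    then show ?case
      using post(5) by (simp add: found_if_def solution_inv_def not_le Suc_ile_eq flip: Suc_eq_plus1)
  qed simp
  moreover have "cs.h \<le> 2 * R" using cs.h_le by simp
  moreover have "2 * k - 1 < 2 ^ w" "2 * R < 2 ^ w" "R < 2 ^ w" "2 < (2::nat) ^ w"
    using k_le R_less n_pos by (intro less_word; simp)+
  ultimately show ?thesis
    using vars cs.h_le by (simp add: probe_guess_def wp_simps \<sigma>1_def flip: cs.h_def cs.D_def cs.rho_def)
qed

end

context row_input begin

definition "guess_cost k sz = n * (15 * k + 100) * (2 * (sz + q) + 4) ^ k + 40"

end

context search_tables begin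

definition covers :: "store \<Rightarrow> nat \<Rightarrow> bool" where
  "covers \<sigma> r \<longleftrightarrow> (\<forall>z<n. \<exists>l<k. d (\<sigma> (Center l)) z \<le> r)"

lemma covers_cong: "(\<And>l. l < k \<Longrightarrow> \<sigma>' (Center l) = \<sigma> (Center l)) \<Longrightarrow> covers \<sigma>' r \<longleftrightarrow> covers \<sigma> r"
  by (simp add: covers_def cong: conj_cong)

definition search_inv :: "store \<Rightarrow> bool" where
  "search_inv \<sigma> \<longleftrightarrow> (\<forall>l<k. \<sigma> (Center l) < n) \<and> \<sigma> Low \<le> \<sigma> High \<and> \<sigma> High \<le> n \<and> enat (\<sigma> Low) \<le> k_radius n E k \<and>
     (\<sigma> High < n \<longrightarrow> covers \<sigma> (approx_radius k (\<sigma> High)))"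

lemma wp_halve:
  assumes tables: "tables \<alpha>" and vars: "\<sigma> Row_len = q" "\<sigma> Num_hit = sz" and inv: "search_inv \<sigma>"
    and less: "\<sigma> Low < \<sigma> High"
  shows "wp (halve k) (\<lambda>_ \<sigma>' \<alpha>'. search_inv \<sigma>' \<and> \<sigma>' High - \<sigma>' Low \<le> (\<sigma> High - \<sigma> Low) div 2)
    (guess_cost k sz - 4) \<sigma> \<alpha>"
proof -
  define R where "R = (\<sigma> Low + \<sigma> High) div 2"
  have mid: "R < n" "\<sigma> Low \<le> R" "R - \<sigma> Low \<le> (\<sigma> High - \<sigma> Low) div 2"
    "\<sigma> High - (R + 1) \<le> (\<sigma> High - \<sigma> Low) div 2" "R < \<sigma> High"
    using inv less by (auto simp: search_inv_def R_def)
  interpret search_round n E m w es q k sz \<tau> R by unfold_locales (rule mid(1))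
  let ?\<sigma> = "\<sigma>(Guess := R)"
  let ?Q = "\<lambda>_ \<sigma>' (\<alpha>' :: arrays). search_inv \<sigma>' \<and> \<sigma>' High - \<sigma>' Low \<le> (\<sigma> High - \<sigma> Low) div 2"
  have bounds: "\<sigma> Low + \<sigma> High < 2 ^ w" "2 < (2::nat) ^ w" "R + 1 < 2 ^ w"
    using mid(1) inv less n_pos by (intro less_word; simp add: search_inv_def)+
  have probe: "wp (probe_guess k) (\<lambda>_ \<sigma>' \<alpha>'. if \<sigma>' Found = 0
      then (\<forall>l<k. \<sigma>' (Center l) = ?\<sigma> (Center l)) \<and> enat (R + 1) \<le> k_radius n E k else covering \<sigma>')
      (n * pass_cost * branching ^ k + 18) ?\<sigma> \<alpha>"
    using tables vars by (intro wp_probe_guess) simp_all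
  have "wp (probe_guess k;; (IF V Found THEN High ::= V Guess ELSE Low ::= V Guess \<oplus> Lit 1)) ?Q T ?\<sigma> \<alpha>"
    if time: "n * pass_cost * branching ^ k + 24 \<le> T" for T
    unfolding wp_Seq
  proof (rule wp_conseq[OF probe], goal_cases budget post)
    case (post t \<sigma>1 \<alpha>1)
    have same: "\<sigma>1 Guess = R" "\<sigma>1 Low = \<sigma> Low" "\<sigma>1 High = \<sigma> High"
      using post(3) by (simp_all add: assigned_probe_guess)
    show ?case
    proof (cases "\<sigma>1 Found = 0")
      case True
      then have "covers (\<sigma>1(Low := R + 1)) r \<longleftrightarrow> covers \<sigma> r" for r
        using post(5) by (intro covers_cong) simp
      then have "search_inv (\<sigma>1(Low := R + 1))"
        using True post(5) inv mid(5) same by (simp add: search_inv_def)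
      then show ?thesis using True post(1) time mid(4) same bounds by (simp add: wp_simps)
    next
      case False
      then have "search_inv (\<sigma>1(High := R))"
        using post(5) inv mid(1,2) same by (simp add: search_inv_def covers_def covering_def D_eq)
      then show ?thesis using False post(1) time mid(3) same by (simp add: wp_simps)
    qed
  qed (use time in simp)
  moreover have "guess_cost k sz = n * pass_cost * branching ^ k + 40"
    by (simp add: guess_cost_def pass_cost_def branching_def)
  ultimately show ?thesis
    unfolding R_def using bounds by (simp add: halve_def wp_Seq[of "Guess ::= _"] wp_Assign)
qed

lemma assigned_halve: "x \<in> {Row_len, Num_hit} \<Longrightarrow> x \<notin> assigned (halve k)"
  using assigned_probe_guess[of x k] by (auto simp: halve_def)

lemma wp_binary_search:
  assumes tables: "tables \<alpha>" and vars: "\<sigma> Row_len = q" "\<sigma> Num_hit = sz"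
    and initial: "\<And>l. l < k \<Longrightarrow> \<sigma> (Center l) < n"
  shows "wp (binary_search k) (\<lambda>_ \<sigma>' \<alpha>'. search_inv \<sigma>' \<and> \<sigma>' Low = \<sigma>' High)
      (floorlog 2 n * guess_cost k sz + 8) \<sigma> \<alpha>"
proof -
  let ?\<Phi> = "\<lambda>\<sigma>' (\<alpha>' :: arrays). floorlog 2 (\<sigma>' High - \<sigma>' Low) * guess_cost k sz + 4"
  have "wp (WHILE V Low \<prec> V High DO halve k) (\<lambda>_ \<sigma>' \<alpha>'. search_inv \<sigma>' \<and> val (V Low \<prec> V High) \<sigma>' \<alpha>' = 0)
      (floorlog 2 n * guess_cost k sz + 4) (\<sigma>(Low := 0, High := n)) \<alpha>"
  proof (rule wp_While[where \<Phi> = ?\<Phi>], goal_cases init cost step)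
    case (step \<sigma>' \<alpha>')
    have tables': "tables \<alpha>'" by (rule tables_cong[OF tables]) (use step(2) in simp)
    have "\<sigma>' Row_len = q" "\<sigma>' Num_hit = sz" using step(1) vars by (simp_all add: assigned_halve)
    note halve = wp_halve[where \<sigma> = \<sigma>', OF tables' this step(3)]
    let ?half = "(\<sigma>' High - \<sigma>' Low) div 2"
    have "wp (halve k) (\<lambda>t \<sigma>'' \<alpha>''. search_inv \<sigma>'' \<and> ?\<Phi> \<sigma>'' \<alpha>'' \<le> t) (?\<Phi> \<sigma>' \<alpha>' - 4) \<sigma>' \<alpha>'"
      if less: "\<sigma>' Low < \<sigma>' High"
    proof -
      have "floorlog 2 (\<sigma>' High - \<sigma>' Low) = Suc (floorlog 2 ?half)"
        using less by (subst compute_floorlog) simp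
      then have cost: "?\<Phi> \<sigma>' \<alpha>' = floorlog 2 ?half * guess_cost k sz + guess_cost k sz + 4" by simp
      show ?thesis
      proof (rule wp_conseq[OF halve[OF less]], goal_cases budget post)
        case (post t \<sigma>'' \<alpha>'')
        have "floorlog 2 (\<sigma>'' High - \<sigma>'' Low) * guess_cost k sz \<le> floorlog 2 ?half * guess_cost k sz"
          using post(5) by (intro mult_le_mono1 floorlog_mono) simp
        moreover have "4 \<le> guess_cost k sz" by (simp add: guess_cost_def)
        ultimately show ?case using post(1,5) cost by linarith
      qed (use cost in simp)
    qed
    then show ?case by simp
  qed (use initial in \<open>simp_all add: search_inv_def flip: zero_enat_def\<close>)
  then have "wp (WHILE V Low \<prec> V High DO halve k) (\<lambda>_ \<sigma>' \<alpha>'. search_inv \<sigma>' \<and> \<sigma>' Low = \<sigma>' High)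
      T (\<sigma>(Low := 0, High := n)) \<alpha>" if "floorlog 2 n * guess_cost k sz + 4 \<le> T" for T
    by (rule wp_conseq) (use that in \<open>auto simp: search_inv_def\<close>)
  then show ?thesis by (simp add: binary_search_def wp_simps)
qed

end

section \<open>Distinct centers\<close>

fun apart :: "nat \<Rightarrow> var \<Rightarrow> expr" where
  "apart 0 x = Lit 1"
| "apart (Suc i) x = apart i x \<otimes> (Lit 1 \<ominus> (V (Center i) \<doteq> V x))"

definition separate :: "nat \<Rightarrow> com" where
  "separate i =
     (IF apart i (Center i) THEN SKIP
      ELSE FOR Probe < NumV DO (IF apart i Probe THEN Center i ::= V Probe ELSE SKIP))"

fun pad :: "nat \<Rightarrow> com" where
  "pad 0 = SKIP"
| "pad (Suc i) = (pad i;; separate i)"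

lemma steps_apart [simp]: "steps (apart i x) = 6 * i + 1"
  by (induction i) auto

lemma frame_separate [simp]: "assigned (separate i) = {Probe, Center i}" "stored (separate i) = {}"
  by (simp_all add: separate_def)

lemma stored_pad [simp]: "stored (pad i) = {}"
  by (induction i) simp_all

lemma assigned_pad: "assigned (pad i) \<subseteq> insert Probe (Center ` {..<i})"
  by (induction i) (auto simp: lessThan_Suc)

abbreviation centers :: "store \<Rightarrow> nat \<Rightarrow> nat set" where
  "centers \<sigma> i \<equiv> (\<lambda>l. \<sigma> (Center l)) ` {..<i}"

context machine begin

lemma val_apart: "val (apart i x) \<sigma> \<alpha> = of_bool (\<sigma> x \<notin> centers \<sigma> i)"
  by (induction i) (auto simp: lessThan_Suc)

lemma fits_apart [simp]: "fits (apart i x) \<sigma> \<alpha>"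
  by (induction i) (auto simp: val_apart)

lemma wp_separate:
  assumes i_less: "i < k" "k \<le> n" and center_less: "\<sigma> (Center i) < n"
  shows "wp (separate i) (\<lambda>_ \<sigma>' \<alpha>'. \<sigma>' (Center i) < n \<and> \<sigma>' (Center i) \<notin> centers \<sigma> i \<and>
      (\<sigma> (Center i) \<notin> centers \<sigma> i \<longrightarrow> \<sigma>' (Center i) = \<sigma> (Center i))) (n * (6 * k + 12) + 6 * k + 8) \<sigma> \<alpha>"
proof (cases "\<sigma> (Center i) \<in> centers \<sigma> i")
  case False
  then show ?thesis using center_less i_less by (simp add: separate_def wp_simps val_apart)
next
  case True
  let ?I = "\<lambda>j \<sigma>' (\<alpha>' :: arrays). \<sigma>' (Center i) < n \<and>
    ((\<exists>v<j. v \<notin> centers \<sigma> i) \<longrightarrow> \<sigma>' (Center i) \<notin> centers \<sigma> i)"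
  have "wp (FOR Probe < NumV DO IF apart i Probe THEN Center i ::= V Probe ELSE SKIP) (\<lambda>_. ?I n) T \<sigma> \<alpha>"
    if "n * (6 * k + 12) + 6 \<le> T" for T
  proof (rule wp_For[where N = n and C = "6 * k + 4" and I = ?I],
      goal_cases bound word fresh cost indep init step)
    case (step v \<sigma>' \<alpha>')
    have "centers \<sigma>' i = centers \<sigma> i" using step(3) by (intro image_cong) auto
    then have test: "val (apart i Probe) \<sigma>' \<alpha>' = of_bool (v \<notin> centers \<sigma> i)" using step(2)
      by (simp add: val_apart)
    show ?case using step(1,2,5) i_less by (cases "v \<in> centers \<sigma> i")
      (auto simp: wp_simps test less_Suc_eq)
  qed (use that center_less less_word in \<open>auto simp: algebra_simps\<close>)
  moreover have "\<exists>v<n. v \<notin> centers \<sigma> i"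
  proof (rule ccontr)
    assume "\<not> (\<exists>v<n. v \<notin> centers \<sigma> i)"
    then have "card {..<n} \<le> card (centers \<sigma> i)" by (intro card_mono) auto
    also have "\<dots> \<le> card {..<i}" by (rule card_image_le) simp
    finally show False using i_less by simp
  qed
  ultimately have "wp (FOR Probe < NumV DO IF apart i Probe THEN Center i ::= V Probe ELSE SKIP)
      (\<lambda>_ \<sigma>' \<alpha>'. \<sigma>' (Center i) < n \<and> \<sigma>' (Center i) \<notin> centers \<sigma> i) T \<sigma> \<alpha>"
    if "n * (6 * k + 12) + 6 \<le> T" for T
    using that by simp
  then show ?thesis using True i_less by (simp add: separate_def wp_simps val_apart)
qed

lemma wp_pad:
  assumes i_le: "i \<le> k" "k \<le> n" and center_less: "\<And>l. l < i \<Longrightarrow> \<sigma> (Center l) < n"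
  shows "wp (pad i) (\<lambda>_ \<sigma>' \<alpha>'. inj_on (\<lambda>l. \<sigma>' (Center l)) {..<i} \<and> centers \<sigma>' i \<subseteq> {..<n} \<and>
      centers \<sigma> i \<subseteq> centers \<sigma>' i)
    (i * (n * (6 * k + 12) + 6 * k + 8)) \<sigma> \<alpha>"
  using i_le(1) center_less
proof (induction i)
  case 0
  then show ?case by (simp add: wp_simps)
next
  case (Suc i)
  have IH: "wp (pad i) (\<lambda>_ \<sigma>' \<alpha>'. inj_on (\<lambda>l. \<sigma>' (Center l)) {..<i} \<and> centers \<sigma>' i \<subseteq> {..<n} \<and>
      centers \<sigma> i \<subseteq> centers \<sigma>' i)
      (i * (n * (6 * k + 12) + 6 * k + 8)) \<sigma> \<alpha>"
    using Suc by simp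
  show ?case
    unfolding pad.simps wp_Seq
  proof (rule wp_conseq[OF IH], goal_cases budget post)
    case (post t \<sigma>1 \<alpha>1)
    note padded = post(5)
    have "Center i \<notin> assigned (pad i)" by (rule contra_subsetD[OF assigned_pad]) auto
    then have same: "\<sigma>1 (Center i) = \<sigma> (Center i)" using post(3) by simp
    have sep: "wp (separate i) (\<lambda>_ \<sigma>' \<alpha>'. \<sigma>' (Center i) < n \<and> \<sigma>' (Center i) \<notin> centers \<sigma>1 i \<and>
        (\<sigma>1 (Center i) \<notin> centers \<sigma>1 i \<longrightarrow> \<sigma>' (Center i) = \<sigma>1 (Center i)))
        (n * (6 * k + 12) + 6 * k + 8) \<sigma>1 \<alpha>1"
      using Suc.prems i_le(2) same by (intro wp_separate) simp_all
    show ?case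
    proof (rule wp_conseq[OF sep], goal_cases budget post)
      case (post t' \<sigma>2 \<alpha>2)
      have old: "\<sigma>2 (Center l) = \<sigma>1 (Center l)" if "l < i" for l using post(3) that by simp
      then have image_eq: "centers \<sigma>2 i = centers \<sigma>1 i" by (intro image_cong) auto
      have "inj_on (\<lambda>l. \<sigma>2 (Center l)) {..<i}"
        using padded old by (simp add: inj_on_def)
      then show ?case
        using post(5) image_eq padded same by (auto simp: lessThan_Suc)
    qed (use post(1) in simp)
  qed simp
qed

end

section \<open>The algorithm\<close>

definition row_length :: "nat \<Rightarrow> com" where
  "row_length k =
     (Row_len ::= Lit 1;;
      (if k = 1 then SKIP
       else FOR Probe < NumV DO
         (IF V Row_len \<otimes> V Row_len \<prec> NumV THEN Row_len ::= V Row_len \<oplus> Lit 1 ELSE SKIP)))"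

lemma assigned_row_length: "assigned (row_length k) \<subseteq> {Row_len, Probe}"
  by (simp add: row_length_def)

lemma stored_row_length [simp]: "stored (row_length k) = {}"
  by (simp add: row_length_def)

definition preprocess :: com where
  "preprocess = (all_pairs;; greedy;; near_hitters)"

fun write_centers :: "nat \<Rightarrow> com" where
  "write_centers 0 = SKIP"
| "write_centers (Suc l) = (write_centers l;; Ends\<langle>Lit l\<rangle> \<leftarrow> V (Center l))"

definition write_output :: "nat \<Rightarrow> com" where
  "write_output k =
     (write_centers k;;
      (IF V High \<prec> NumV
       THEN Result ::= Lit 2 \<otimes> V High \<ominus> V High \<oslash> Lit (2 * k - 1) \<oplus> Lit 1
       ELSE Result ::= Lit 0))"

definition main :: "nat \<Rightarrow> com" where
  "main k = (row_length k;; preprocess;; binary_search k;; pad k;; write_output k)"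

definition row_len :: "nat \<Rightarrow> nat \<Rightarrow> nat" where
  "row_len k n = (if k = 1 then 1 else LEAST q. n \<le> q * q)"

lemma less_row_len_iff:
  assumes "k \<noteq> 1"
  shows "p < row_len k n \<longleftrightarrow> p * p < n"
proof
  assume "p < row_len k n"
  then show "p * p < n" using assms not_less_Least[of p "\<lambda>q. n \<le> q * q"] by (simp add: row_len_def)
next
  assume "p * p < n"
  moreover have "n \<le> row_len k n * row_len k n"
    using assms LeastI[of "\<lambda>q. n \<le> q * q" n] by (simp add: row_len_def)
  ultimately show "p < row_len k n" by (metis leD leI le_less_trans less_le_trans mult_le_mono)
qed

lemma row_len_bounds:
  assumes "1 \<le> n"
  shows "1 \<le> row_len k n" "row_len k n \<le> n"
proof -
  have "0 < row_len k n" "\<not> n < row_len k n"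
    using assms less_row_len_iff[of k 0 n] less_row_len_iff[of k n n]
    by (cases "k = 1"; simp add: row_len_def)+
  then show "1 \<le> row_len k n" "row_len k n \<le> n" by simp_all
qed

context machine begin

lemma wp_row_length:
  "wp (row_length k) (\<lambda>_ \<sigma>' \<alpha>'. \<sigma>' Row_len = row_len k n) (n * 18 + 8) \<sigma> \<alpha>"
proof (cases "k = 1")
  case True
  then show ?thesis by (simp add: row_length_def wp_simps row_len_def)
next
  case False
  note len = row_len_bounds[OF n_pos, of k]
  let ?I = "\<lambda>j \<sigma>' (\<alpha>' :: arrays). \<sigma>' Row_len = min (Suc j) (row_len k n)"
  have "wp (FOR Probe < NumV DO
         (IF V Row_len \<otimes> V Row_len \<prec> NumV THEN Row_len ::= V Row_len \<oplus> Lit 1 ELSE SKIP))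
      (\<lambda>_. ?I n) T (\<sigma>(Row_len := 1)) \<alpha>" if "n * 18 + 6 \<le> T" for T
  proof (rule wp_For[where N = n and C = 10 and I = ?I], goal_cases bound word fresh cost indep init step)
    case (step j \<sigma>' \<alpha>')
    define p where "p = \<sigma>' Row_len"
    have "p \<le> n" using step(5) len(2) by (simp add: p_def)
    then have "p * p < 2 ^ w" "p + 1 < 2 ^ w" using mult_le_mono[of p n p n] by (intro less_word; simp)+
    moreover have "p * p < n \<longleftrightarrow> p < row_len k n" by (rule less_row_len_iff[OF False, symmetric])
    ultimately show ?case using step(5) by (auto simp: wp_simps simp flip: p_def)
  qed (use that len(1) less_word in \<open>auto simp: One_nat_def\<close>)
  then show ?thesis using len(2) False by (simp add: row_length_def wp_simps)
qed

lemma wp_write_centers: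
  assumes "i \<le> n"
  shows "wp (write_centers i) (\<lambda>_ \<sigma>' \<alpha>'. \<sigma>' = \<sigma> \<and> (\<forall>l<i. \<alpha>' Ends 0 l = \<sigma> (Center l))) (i * 13) \<sigma> \<alpha>"
  using assms
proof (induction i)
  case 0
  then show ?case by (simp add: wp_simps)
next
  case (Suc i)
  then have "wp (write_centers i) (\<lambda>_ \<sigma>' \<alpha>'. \<sigma>' = \<sigma> \<and> (\<forall>l<i. \<alpha>' Ends 0 l = \<sigma> (Center l))) (i * 13) \<sigma> \<alpha>"
    by simp
  then show ?case
    unfolding write_centers.simps wp_Seq
  proof (rule wp_conseq, goal_cases budget post)
    case (post t \<sigma>' \<alpha>')
    have "i < 2 ^ w" using Suc.prems by (intro less_word) simp
    then show ?case using post(1,5) Suc.prems by (auto simp: wp_simps less_Suc_eq)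
  qed simp
qed

lemma wp_write_output:
  assumes k_bounds: "1 \<le> k" "k \<le> n"
  shows "wp (write_output k) (\<lambda>_ \<sigma>' \<alpha>'. (\<forall>l<k. \<alpha>' Ends 0 l = \<sigma> (Center l)) \<and>
      \<sigma>' Result = (if \<sigma> High < n then approx_radius k (\<sigma> High) + 1 else 0)) (k * 13 + 14) \<sigma> \<alpha>"
  unfolding write_output_def wp_Seq
proof (rule wp_conseq[OF wp_write_centers[OF k_bounds(2)]], goal_cases budget post)
  case (post t \<sigma>' \<alpha>')
  have "2 * \<sigma> High < 2 ^ w" "2 * \<sigma> High - \<sigma> High div (2 * k - 1) + 1 < 2 ^ w" if "\<sigma> High < n"
    using that by (intro less_word; simp)+
  moreover have "2 * k - 1 < 2 ^ w" "2 < (2::nat) ^ w" using k_bounds by (intro less_word; simp)+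
  moreover have "\<sigma> High div (2 * k - 1) \<le> 2 * \<sigma> High"
    using div_le_dividend[of "\<sigma> High" "2 * k - 1"] by linarith
  ultimately show ?case using post(1,5) by (simp add: wp_simps approx_radius_def)
qed simp

end

context row_input begin

lemma search_tables_if_preprocessed:
  assumes rows: "\<forall>s<n. row_computed q s \<alpha>" and same: "\<alpha>' Dist = \<alpha> Dist" "\<alpha>' Queue = \<alpha> Queue"
    and hit: "\<forall>v\<in>unhit \<alpha>. \<exists>j<sz. \<alpha>' Hitter 0 j \<in> row_set \<alpha> v" and hitters: "sz \<le> n"
      "\<forall>j<sz. \<alpha>' Hitter 0 j < n"
    and near: "\<forall>z<n. nearest_among (\<alpha>' Hitter 0) sz z (\<alpha>' HitDist 0 z) (\<alpha>' HitNear 0 z)"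
    and k_bounds: "1 \<le> k" "k \<le> n" "k = 1 \<Longrightarrow> q = 1"
  shows "search_tables n E m w es q k sz \<alpha>'"
proof unfold_locales
  have row: "near_row q v (\<alpha> Queue v) (\<alpha> Ample 0 v \<noteq> 0)" if "v < n" for v
    using rows that by (simp add: row_computed_def)
  have row_hit: "\<exists>i<q. \<alpha>' HitDist 0 v \<le> d v (\<alpha> Queue v i)" if ample: "v < n" "\<alpha> Ample 0 v \<noteq> 0" for v
  proof -
    have "v \<in> unhit \<alpha>" using ample by (simp add: unhit_def)
    then obtain j where "j < sz" "\<alpha>' Hitter 0 j \<in> row_set \<alpha> v" using hit by blast
    moreover obtain i where "i < q" "\<alpha>' Hitter 0 j = \<alpha> Queue v i" using calculation(2)
      by (auto simp: row_set_def)
    ultimately show ?thesis using near ample(1) unfolding nearest_among_def by metis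
  qed
  show "x \<in> row_set \<alpha>' v" if "v < n" "r < 2 * n" "r < \<alpha>' HitDist 0 v" "x < n" "d v x \<le> r" for v r x
    unfolding row_set_def same by (rule near_row_ball[OF row[OF that(1)] row_hit[OF that(1)] that(2-5)])
  show "\<alpha>' HitDist 0 v = 0" if vertex: "v < n" and "k = 1" for v
  proof -
    have q_eq: "q = 1" by (rule k_bounds(3)[OF \<open>k = 1\<close>])
    have "\<alpha> Ample 0 v \<noteq> 0" using near_rowD(2)[OF row[OF vertex] q_eq] .
    then obtain i where "i < q" "\<alpha>' HitDist 0 v \<le> d v (\<alpha> Queue v i)" using row_hit[OF vertex] by blast
    then show ?thesis using near_row_1[OF row[OF vertex, unfolded q_eq] vertex] q_eq by simp
  qed
  show "distances \<alpha>'" using rows by (simp add: distances_def row_computed_def same)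
  show "\<alpha>' Queue v i < n" if "v < n" "i < q" for v i
    using rows that q_le by (simp add: row_computed_def same)
qed (use k_bounds hitters near in auto)

definition "preprocess_cost = all_pairs_cost + greedy_cost + n * (max_hitters * 40 + 46) + 6"

lemma wp_preprocess:
  assumes input: "\<And>e. e < 2 * m \<Longrightarrow> \<alpha> Ends 0 e = ep e" "\<And>v. v < n \<Longrightarrow> \<alpha> Head 0 v = 0"
    and vars: "\<sigma> Row_len = q" and k_bounds: "1 \<le> k" "k \<le> n" "k = 1 \<Longrightarrow> q = 1"
  shows "wp preprocess (\<lambda>_ \<sigma>' \<alpha>'. \<sigma>' Num_hit \<le> max_hitters \<and> search_tables n E m w es q k (\<sigma>' Num_hit) \<alpha>')
    preprocess_cost \<sigma> \<alpha>"
  unfolding preprocess_def wp_Seq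
proof (rule wp_conseq[OF wp_all_pairs[where \<sigma> = \<sigma> and \<alpha> = \<alpha>, OF input vars]],
    goal_cases ends head budget post)
  case (post t1 \<sigma>1 \<alpha>1)
  note rows = post
  have "\<sigma>1 Row_len = q" using rows(3) vars by simp
  moreover have "rows_valid \<alpha>1"
    using rows(5) near_rowD(1) q_le by (fastforce simp: rows_valid_def row_computed_def unhit_def)
  ultimately show ?case
  proof (rule wp_conseq[OF wp_greedy[where \<sigma> = \<sigma>1]], goal_cases budget post)
    case (post t2 \<sigma>2 \<alpha>2)
    note hit = post
    define sz where "sz = \<sigma>2 Num_hit"
    have hitters: "sz \<le> max_hitters" "sz \<le> n" "\<forall>j<sz. \<alpha>2 Hitter 0 j < n"
      "\<forall>v\<in>unhit \<alpha>1. \<exists>j<sz. \<alpha>2 Hitter 0 j \<in> row_set \<alpha>1 v"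
      using hit(5) by (simp_all add: sz_def)
    have same: "\<alpha>2 Dist = \<alpha>1 Dist" "\<alpha>2 Queue = \<alpha>1 Queue" using hit(4) by simp_all
    have "distances \<alpha>2" using rows(5) same by (simp add: distances_def row_computed_def)
    then have near: "wp near_hitters (\<lambda>_ \<sigma>' \<alpha>'. \<forall>z<n. nearest_among (\<alpha>2 Hitter 0) sz z (\<alpha>' HitDist 0 z)
        (\<alpha>' HitNear 0 z))
        (n * (sz * 40 + 46) + 6) \<sigma>2 \<alpha>2"
      using hitters by (intro wp_near_hitters) (simp_all add: sz_def)
    have "n * (sz * 40 + 46) \<le> n * (max_hitters * 40 + 46)" using hitters(1) by (intro mult_le_mono2) simp
    then have "n * (sz * 40 + 46) + 6 \<le> t2" using hit(1) rows(1) unfolding preprocess_cost_def by linarith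
    then show ?case
    proof (rule wp_conseq[OF near], goal_cases post)
      case (post t3 \<sigma>3 \<alpha>3)
      have "\<sigma>3 Num_hit = sz" "\<alpha>3 Dist = \<alpha>1 Dist" "\<alpha>3 Queue = \<alpha>1 Queue" "\<alpha>3 Hitter = \<alpha>2 Hitter"
        using post(3,4) same by (simp_all add: sz_def)
      then show ?case using rows(5) hitters post(5) k_bounds
        by (auto intro!: search_tables_if_preprocessed)
    qed
  qed (use rows(1) in \<open>simp add: preprocess_cost_def\<close>)
qed (simp_all add: preprocess_cost_def)

end

text \<open>The word \<open>0\<close> stands for \<open>\<infinity>\<close>, as in \<open>output_value\<close>.\<close>

definition decode_radius :: "nat \<Rightarrow> enat" where
  "decode_radius b = (case b of 0 \<Rightarrow> \<infinity> | Suc r \<Rightarrow> enat r)"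

lemma decode_radius_simps [simp]: "decode_radius 0 = \<infinity>" "decode_radius (r + 1) = enat r"
  by (simp_all add: decode_radius_def flip: Suc_eq_plus1)

lemma approx_radius_le:
  assumes "1 \<le> k" "R \<le> r"
  shows "real (approx_radius k R) \<le> (2 - 1 / (2 * real k - 1)) * real r + (1 - 1 / (2 * real k - 1))"
proof -
  define p where "p = 2 * k - 1"
  have p_eq: "1 \<le> p" "real p = 2 * real k - 1" using assms(1) by (auto simp: p_def)
  have "R < p * (R div p) + p" using p_eq mult_div_mod_eq[of p R] mod_less_divisor[of p R] by linarith
  then have "real (R + 1) \<le> real (p * (R div p) + p)" by (intro of_nat_mono) simp
  then have floor: "(real R + 1) / real p \<le> real (R div p) + 1" using p_eq(1) by (simp add: field_simps)
  have "R div p \<le> 2 * R" using div_le_dividend[of R p] by linarith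
  then have "real (approx_radius k R) = 2 * real R - real (R div p)"
    by (simp add: approx_radius_def p_def of_nat_diff)
  also have "\<dots> \<le> 2 * real R - (real R + 1) / real p + 1" using floor by simp
  also have "\<dots> = (2 - 1 / real p) * real R + (1 - 1 / real p)"
    by (simp add: field_simps add_divide_distrib)
  also have "\<dots> \<le> (2 - 1 / real p) * real r + (1 - 1 / real p)"
    using p_eq assms(2) by (intro add_right_mono mult_left_mono) (auto simp: field_simps)
  finally show ?thesis by (simp add: p_eq(2))
qed

lemma (in finite_graph) k_center_approx_if_covers:
  assumes k_pos: "1 \<le> k" and k_centers: "C \<subseteq> {..<n}" "card C = k"
    and R_le: "enat R \<le> k_radius n E k" "R \<le> n"
    and covers: "R < n \<Longrightarrow> \<forall>z<n. \<exists>c\<in>C. d c z \<le> approx_radius k R"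
  shows "k_center_approx (2 - 1 / (2 * real k - 1)) (1 - 1 / (2 * real k - 1)) n E k
    (decode_radius (if R < n then approx_radius k R + 1 else 0)) C"
proof (cases "R < n")
  case True
  let ?r = "approx_radius k R"
  have r_less: "?r < 2 * n" using True by (simp add: approx_radius_def)
  have near: "\<forall>v<n. \<exists>c\<in>C. d v c \<le> ?r" using covers[OF True] d_commute by metis
  then have radius_le: "k_radius n E k \<le> enat ?r" using k_centers k_radius_le_iff[OF r_less] by blast
  then obtain R' where radius_eq: "k_radius n E k = enat R'" by (cases "k_radius n E k") auto
  with R_le(1) have "R \<le> R'" by simp
  from approx_radius_le[OF k_pos this] show ?thesis
    using True k_centers near radius_le set_gdist_le_iff[OF r_less]
    by (simp add: k_center_approx_def radius_eq)
next
  case False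
  then have "\<not> k_radius n E k < enat n" using R_le by (metis antisym_conv2 leD le_neq_trans)
  then have "k_radius n E k = \<infinity>" using k_radius_less_or_inf by blast
  moreover have "0 < 2 - 1 / (2 * real k - 1)" using k_pos by (simp add: field_simps)
  ultimately show ?thesis using False k_centers by (simp add: k_center_approx_def)
qed

context row_input begin

definition "main_cost k = n * 18 + 8 + preprocess_cost + (floorlog 2 n * guess_cost k max_hitters + 8) +
  k * (n * (6 * k + 12) + 6 * k + 8) + (k * 13 + 14)"

lemma guess_cost_mono: "sz \<le> sz' \<Longrightarrow> guess_cost k sz \<le> guess_cost k sz'"
  unfolding guess_cost_def by (intro add_mono mult_le_mono power_mono) simp_all

lemma wp_finish:
  assumes k_bounds: "1 \<le> k" "k \<le> n" and vars: "\<And>l. l < k \<Longrightarrow> \<sigma> (Center l) < n" "\<sigma> High \<le> n"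
    "enat (\<sigma> High) \<le> k_radius n E k"
    and covers: "\<sigma> High < n \<Longrightarrow> \<forall>z<n. \<exists>l<k. d (\<sigma> (Center l)) z \<le> approx_radius k (\<sigma> High)"
  shows "wp (pad k;; write_output k) (\<lambda>_ \<sigma>' \<alpha>'.
      k_center_approx (2 - 1 / (2 * real k - 1)) (1 - 1 / (2 * real k - 1)) n E k
        (decode_radius (\<sigma>' Result)) (\<alpha>' Ends 0 ` {..<k}))
    (k * (n * (6 * k + 12) + 6 * k + 8) + (k * 13 + 14)) \<sigma> \<alpha>"
  unfolding wp_Seq
proof (rule wp_conseq[OF wp_pad[where \<sigma> = \<sigma>, OF le_refl k_bounds(2) vars(1)]],
    goal_cases centers budget post)
  case (post t \<sigma>1 \<alpha>1)
  have "High \<notin> assigned (pad k)" by (rule contra_subsetD[OF assigned_pad]) auto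
  then have high: "\<sigma>1 High = \<sigma> High" by (rule post(3))
  have padded: "inj_on (\<lambda>l. \<sigma>1 (Center l)) {..<k}" "centers \<sigma>1 k \<subseteq> {..<n}" "centers \<sigma> k \<subseteq> centers \<sigma>1 k"
    using post(5) by simp_all
  have "\<exists>c\<in>centers \<sigma>1 k. d c z \<le> approx_radius k (\<sigma> High)" if z_less: "\<sigma> High < n" "z < n" for z
  proof -
    obtain l where "l < k" "d (\<sigma> (Center l)) z \<le> approx_radius k (\<sigma> High)" using covers z_less by blast
    moreover from this(1) have "\<sigma> (Center l) \<in> centers \<sigma>1 k" using padded(3) by auto
    ultimately show ?thesis by blast
  qed
  moreover have "card (centers \<sigma>1 k) = k" using padded(1) by (simp add: card_image)
  ultimately have approx: "k_center_approx (2 - 1 / (2 * real k - 1)) (1 - 1 / (2 * real k - 1)) n E k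
      (decode_radius (if \<sigma> High < n then approx_radius k (\<sigma> High) + 1 else 0)) (centers \<sigma>1 k)"
    using k_bounds(1) vars(2,3) padded(2) by (intro k_center_approx_if_covers) simp_all
  show ?case
  proof (rule wp_conseq[OF wp_write_output[OF k_bounds]], goal_cases budget post)
    case (post t' \<sigma>2 \<alpha>2)
    have "\<alpha>2 Ends 0 ` {..<k} = centers \<sigma>1 k" using post(5) by (intro image_cong) auto
    then show ?case using approx post(5) high by (cases "\<sigma> High < n") simp_all
  qed (use post(1) in simp)
qed simp_all

lemma wp_main:
  assumes input: "\<And>e. e < 2 * m \<Longrightarrow> \<alpha> Ends 0 e = ep e" "\<And>v. v < n \<Longrightarrow> \<alpha> Head 0 v = 0" "\<And>l. \<sigma> (Center l) = 0"
    and k_bounds: "1 \<le> k" "k \<le> n" and q_eq: "q = row_len k n"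
  shows "wp (main k) (\<lambda>_ \<sigma>' \<alpha>'. k_center_approx (2 - 1 / (2 * real k - 1))
      (1 - 1 / (2 * real k - 1)) n E k
      (decode_radius (\<sigma>' Result)) (\<alpha>' Ends 0 ` {..<k})) (main_cost k) \<sigma> \<alpha>"
  unfolding main_def wp_Seq[of "row_length k"] wp_Seq[of preprocess] wp_Seq[of "binary_search k"]
proof (rule wp_conseq[OF wp_row_length], goal_cases budget post)
  case (post t1 \<sigma>1 \<alpha>1)
  note init = post
  have arrays: "\<alpha>1 = \<alpha>" using init(4) by auto
  have center1: "\<sigma>1 (Center l) = 0" for l
  proof -
    have "Center l \<notin> assigned (row_length k)" by (rule contra_subsetD[OF assigned_row_length]) simp
    then show ?thesis using init(3) input(3) by simp
  qed
  have "k = 1 \<Longrightarrow> q = 1" using q_eq by (simp add: row_len_def)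
  then have pre: "wp preprocess (\<lambda>_ \<sigma>' \<alpha>'. \<sigma>' Num_hit \<le> max_hitters \<and>
      search_tables n E m w es q k (\<sigma>' Num_hit) \<alpha>')
      preprocess_cost \<sigma>1 \<alpha>1"
    using input init(5) k_bounds q_eq by (intro wp_preprocess) (simp_all add: arrays)
  show ?case
  proof (rule wp_conseq[OF pre], goal_cases budget post)
    case (post t2 \<sigma>2 \<alpha>2)
    define sz where "sz = \<sigma>2 Num_hit"
    have hitters: "sz \<le> max_hitters" "search_tables n E m w es q k sz \<alpha>2" using post(5)
      by (simp_all add: sz_def)
    interpret search_tables n E m w es q k sz \<alpha>2 by (rule hitters(2))
    have "\<sigma>2 Row_len = q" "\<sigma>2 (Center l) = 0" for l
      using post(3) init(5) center1 q_eq by (simp_all add: preprocess_def)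
    then have bin: "wp (binary_search k) (\<lambda>_ \<sigma>' \<alpha>'. search_inv \<sigma>' \<and> \<sigma>' Low = \<sigma>' High)
        (floorlog 2 n * guess_cost k sz + 8) \<sigma>2 \<alpha>2"
      using n_pos by (intro wp_binary_search) (simp_all add: tables_def sz_def)
    have "floorlog 2 n * guess_cost k sz \<le> floorlog 2 n * guess_cost k max_hitters"
      by (intro mult_le_mono2 guess_cost_mono hitters(1))
    then have time: "floorlog 2 n * guess_cost k sz + 8 + (k * (n * (6 * k + 12) + 6 * k + 8)
        + (k * 13 + 14)) \<le> t2"
      using post(1) init(1) unfolding main_cost_def by linarith
    show ?case
    proof (rule wp_conseq[OF bin], goal_cases budget post)
      case (post t3 \<sigma>3 \<alpha>3)
      then have "search_inv \<sigma>3" "\<sigma>3 Low = \<sigma>3 High" by simp_all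
      then have finish: "wp (pad k;; write_output k) (\<lambda>_ \<sigma>' \<alpha>'.
          k_center_approx (2 - 1 / (2 * real k - 1)) (1 - 1 / (2 * real k - 1)) n E k
            (decode_radius (\<sigma>' Result)) (\<alpha>' Ends 0 ` {..<k}))
          (k * (n * (6 * k + 12) + 6 * k + 8) + (k * 13 + 14)) \<sigma>3 \<alpha>3"
        using k_bounds by (intro wp_finish) (simp_all add: search_inv_def covers_def)
      then show ?case by (rule wp_conseq) (use post(1) time in simp_all)
    qed (use time in simp)
  qed (use init(1) in \<open>simp add: main_cost_def\<close>)
qed (simp add: main_cost_def)

end

section \<open>Running time\<close>

definition log_factor :: "nat \<Rightarrow> real" where
  "log_factor n = 1 + log 2 (real n)"

lemma log_factor_ge_1: "1 \<le> n \<Longrightarrow> 1 \<le> log_factor n"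
  by (simp add: log_factor_def)

lemma floorlog_le_log_factor:
  assumes "1 \<le> n"
  shows "real (floorlog 2 n) \<le> log_factor n"
proof -
  have "floorlog 2 n = nat \<lfloor>log 2 (real n)\<rfloor> + 1" using assms by (simp add: floorlog_def)
  moreover have "0 \<le> log 2 (real n)" using assms by simp
  ultimately show ?thesis by (simp add: log_factor_def)
qed

lemma ln_le_log_2:
  assumes "1 \<le> (x :: real)"
  shows "ln x \<le> log 2 x"
proof -
  have "ln 2 \<le> (1 :: real)" using ln_le_minus_one[of 2] by simp
  moreover have "0 < ln (2 :: real)" by simp
  ultimately have "1 \<le> 1 / ln (2 :: real)" by (simp add: field_simps)
  then have "ln x * 1 \<le> ln x * (1 / ln 2)" using assms by (intro mult_left_mono) auto
  then show ?thesis by (simp add: log_def)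
qed

definition work :: "nat \<Rightarrow> nat \<Rightarrow> nat \<Rightarrow> real" where
  "work k n m = real m * real n + real n powr (real k / 2 + 1)"

lemma work_ge:
  assumes "1 \<le> n" "n \<le> m + 1"
  shows "real n * real n \<le> work k n m" "real m * real n \<le> work k n m" "real n \<le> work k n m"
    "real m \<le> work k n m" "1 \<le> work k n m"
proof -
  have n_ge: "1 \<le> real n" using assms(1) by simp
  have "real n powr 1 \<le> real n powr (real k / 2 + 1)" using n_ge by (intro powr_mono) simp_all
  then have powr: "real n \<le> real n powr (real k / 2 + 1)" using n_ge by simp
  have "real n * real n \<le> real (m + 1) * real n" using assms(2) by (intro mult_right_mono) simp_all
  then show square: "real n * real n \<le> work k n m" using powr by (simp add: work_def algebra_simps)
  show product: "real m * real n \<le> work k n m" by (simp add: work_def)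
  have "real n * 1 \<le> real n * real n" "real m * 1 \<le> real m * real n"
    using n_ge by (intro mult_left_mono; simp)+
  then show "real n \<le> work k n m" "real m \<le> work k n m" "1 \<le> work k n m" using square product n_ge
    by linarith+
qed

text \<open>With rows of about this length, all candidates together number at most \<open>O(width * log n)\<close>.\<close>

definition width :: "nat \<Rightarrow> nat \<Rightarrow> real" where
  "width k n = (if k = 1 then real n else sqrt (real n))"

lemma width_ge_1: "1 \<le> n \<Longrightarrow> 1 \<le> width k n"
  by (simp add: width_def)

lemma row_len_le_width:
  assumes "1 \<le> n"
  shows "real (row_len k n) \<le> 2 * width k n"
proof (cases "k = 1")
  case False
  define p where "p = row_len k n - 1"
  have row_len_eq: "row_len k n = p + 1" using row_len_bounds(1)[OF assms, of k] by (simp add: p_def)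
  then have "p * p < n" using less_row_len_iff[OF False, of p n] by simp
  then have "(real p)\<^sup>2 \<le> real n" by (metis of_nat_le_iff of_nat_mult less_imp_le power2_eq_square)
  then have "real p \<le> sqrt (real n)" by (rule real_le_rsqrt)
  moreover have "1 \<le> sqrt (real n)" using assms by simp
  ultimately have "real (row_len k n) \<le> 2 * sqrt (real n)" using row_len_eq by linarith
  then show ?thesis using False by (simp add: width_def)
qed (use assms in \<open>simp add: row_len_def width_def\<close>)

lemma le_width_row_len: "real n \<le> width k n * real (row_len k n)"
proof (cases "k = 1")
  case False
  have "n \<le> row_len k n * row_len k n" using less_row_len_iff[OF False, of "row_len k n" n] by simp
  then have "real n \<le> (real (row_len k n))\<^sup>2" by (metis of_nat_le_iff of_nat_mult power2_eq_square)
  then have "sqrt (real n) \<le> real (row_len k n)" by (intro real_le_lsqrt) auto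
  then have "sqrt (real n) * sqrt (real n) \<le> sqrt (real n) * real (row_len k n)"
    by (intro mult_left_mono) auto
  then show ?thesis using False by (simp add: width_def)
qed (simp add: row_len_def width_def)

lemma width_power_le_work:
  assumes "1 \<le> n" "n \<le> m + 1"
  shows "real n * width k n ^ k \<le> work k n m"
proof (cases "k = 1")
  case True
  then show ?thesis using work_ge(1)[OF assms] by (simp add: width_def)
next
  case False
  have "sqrt (real n) ^ k = (real n powr (1 / 2)) powr real k"
    using assms(1) by (simp add: powr_half_sqrt powr_realpow)
  also have "\<dots> = real n powr (real k / 2)" by (simp add: powr_powr)
  finally show ?thesis using False assms(1) by (simp add: width_def work_def powr_add)
qed

context row_input begin

lemma max_hitters_le: "real max_hitters * real q \<le> real n * log_factor n"
proof -
  have "real max_hitters \<le> greedy_potential n q n"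
    using greedy_potential_nonneg[of n q n] by (simp add: max_hitters_def)
  also have "\<dots> = real n / real q * (1 + ln (real n))" using n_pos by (simp add: greedy_potential_def)
  also have "\<dots> \<le> real n / real q * log_factor n"
    using n_pos ln_le_log_2[of "real n"] by (intro mult_left_mono) (auto simp: log_factor_def)
  finally show ?thesis using q_pos by (simp add: field_simps)
qed

lemma max_hitters_le_width:
  assumes "q = row_len k n"
  shows "real max_hitters \<le> width k n * log_factor n"
proof -
  have "real max_hitters * real q \<le> width k n * real q * log_factor n"
    using max_hitters_le le_width_row_len[of n k] log_factor_ge_1[OF n_pos] assms
    by (smt (verit) mult_right_mono)
  then show ?thesis using q_pos by (simp add: mult.assoc mult.left_commute)
qed

lemma all_pairs_cost_le: "n \<le> m + 1 \<Longrightarrow> real all_pairs_cost \<le> 474 * work k n m"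
  using work_ge[of n m k] n_pos by (simp add: all_pairs_cost_def algebra_simps)

lemma greedy_cost_le:
  assumes "n \<le> m + 1"
  shows "real greedy_cost \<le> 500 * (work k n m * log_factor n)"
proof -
  let ?H = "real max_hitters" and ?L = "log_factor n" and ?W = "work k n m"
  have "real n * 1 \<le> real n * real q" "1 * 1 \<le> real n * real q" using n_pos q_pos
    by (intro mult_mono; simp)+
  then have "real (greedy_round_cost + 2) \<le> 245 * (real n * real q)"
    by (simp add: greedy_round_cost_def algebra_simps)
  then have "(?H + 1) * real (greedy_round_cost + 2) \<le> (?H + 1) * (245 * (real n * real q))"
    by (intro mult_left_mono) auto
  also have "\<dots> = 245 * (real n * (?H * real q)) + 245 * (real n * real q)" by (simp add: algebra_simps)
  also have "\<dots> \<le> 245 * (real n * (real n * ?L)) + 245 * (real n * real n)"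
    using max_hitters_le q_le by (intro add_mono mult_left_mono) auto
  also have "\<dots> \<le> 245 * (?W * ?L) + 245 * ?W"
  proof -
    have "real n * real n * ?L \<le> ?W * ?L"
      using work_ge(1)[OF n_pos assms] log_factor_ge_1[OF n_pos] by (intro mult_right_mono) auto
    then show ?thesis using work_ge(1)[OF n_pos assms, of k] by (simp add: mult.assoc)
  qed
  finally have "(?H + 1) * real (greedy_round_cost + 2) \<le> 245 * (?W * ?L) + 245 * ?W" .
  moreover have "real greedy_cost = (?H + 1) * real (greedy_round_cost + 2) + 10"
    by (simp add: greedy_cost_def algebra_simps)
  moreover have "?W * 1 \<le> ?W * ?L"
    using work_ge(5)[OF n_pos assms, of k] log_factor_ge_1[OF n_pos] by (intro mult_left_mono) auto
  ultimately show ?thesis using work_ge(5)[OF n_pos assms, of k] by linarith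
qed

lemma preprocess_cost_le:
  assumes "n \<le> m + 1"
  shows "real preprocess_cost \<le> 1066 * (work k n m * log_factor n)"
proof -
  let ?H = "real max_hitters" and ?L = "log_factor n" and ?W = "work k n m"
  have "?H * 1 \<le> ?H * real q" using q_pos by (intro mult_left_mono) auto
  then have "real n * ?H \<le> real n * (real n * ?L)" using max_hitters_le by (intro mult_left_mono) auto
  also have "\<dots> \<le> ?W * ?L"
    unfolding mult.assoc[symmetric] using work_ge(1)[OF n_pos assms] log_factor_ge_1[OF n_pos]
    by (intro mult_right_mono) auto
  finally have "real n * ?H \<le> ?W * ?L" .
  moreover have "?W * 1 \<le> ?W * ?L"
    using work_ge(5)[OF n_pos assms, of k] log_factor_ge_1[OF n_pos] by (intro mult_left_mono) auto
  moreover have "real preprocess_cost = real all_pairs_cost + real greedy_cost + 40 * (real n * ?H)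
      + 46 * real n + 6"
    by (simp add: preprocess_cost_def algebra_simps)
  ultimately show ?thesis
    using all_pairs_cost_le[OF assms, of k] greedy_cost_le[OF assms, of k]
      work_ge(3,5)[OF n_pos assms, of k]
    by linarith
qed

lemma guess_cost_le:
  assumes "n \<le> m + 1" "q = row_len k n"
  shows "real (guess_cost k max_hitters)
      \<le> ((15 * real k + 100) * 10 ^ k + 40) * (work k n m * log_factor n ^ k)"
proof -
  let ?H = "real max_hitters" and ?L = "log_factor n" and ?W = "work k n m" and ?s = "width k n"
  define b where "b = ?s * ?L"
  have width_ge: "1 \<le> ?s" by (rule width_ge_1[OF n_pos])
  then have "?s * 1 \<le> b" unfolding b_def using log_factor_ge_1[OF n_pos] by (intro mult_left_mono) auto
  moreover have "real q \<le> 2 * ?s" using row_len_le_width[OF n_pos, of k] assms(2) by simp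
  moreover have "?H \<le> b" unfolding b_def by (rule max_hitters_le_width[OF assms(2)])
  ultimately have "2 * (?H + real q) + 4 \<le> 10 * (?s * ?L)" unfolding b_def[symmetric] using width_ge
    by simp
  then have "(2 * (?H + real q) + 4) ^ k \<le> (10 * (?s * ?L)) ^ k" by (intro power_mono) auto
  then have "real n * (15 * real k + 100) * (2 * (?H + real q) + 4) ^ k
      \<le> real n * (15 * real k + 100) * (10 * (?s * ?L)) ^ k" by (intro mult_left_mono) auto
  also have "\<dots> = (15 * real k + 100) * 10 ^ k * (real n * ?s ^ k * ?L ^ k)"
    by (simp add: power_mult_distrib)
  also have "\<dots> \<le> (15 * real k + 100) * 10 ^ k * (?W * ?L ^ k)"
    using width_power_le_work[OF n_pos assms(1)] log_factor_ge_1[OF n_pos]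
    by (intro mult_left_mono mult_right_mono) auto
  finally have "real (guess_cost k max_hitters) \<le> (15 * real k + 100) * 10 ^ k * (?W * ?L ^ k) + 40"
    by (simp add: guess_cost_def)
  moreover have "1 * 1 \<le> ?W * ?L ^ k"
    using work_ge(5)[OF n_pos assms(1), of k] log_factor_ge_1[OF n_pos]
    by (intro mult_mono one_le_power) auto
  ultimately show ?thesis unfolding distrib_right by linarith
qed

end

definition cost_factor :: "nat \<Rightarrow> nat" where
  "cost_factor k = (15 * k + 100) * 10 ^ k + k * (12 * k + 33) + 1200"

definition time_bound :: "nat \<Rightarrow> nat \<Rightarrow> nat \<Rightarrow> nat" where
  "time_bound k n m = nat \<lfloor>real (cost_factor k) * work k n m * log_factor n ^ (k + 1)\<rfloor>"

lemma time_bound_soft_O: "time_bound k \<in> soft_O (work k)"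
  unfolding soft_O_def
proof (rule CollectI, rule exI[of _ "cost_factor k"], rule exI[of _ "k + 1"], intro allI impI)
  fix n m :: nat
  assume "1 \<le> n"
  then have "0 \<le> real (cost_factor k) * work k n m * log_factor n ^ (k + 1)"
    by (intro mult_nonneg_nonneg zero_le_power) (auto simp: work_def log_factor_def)
  then show "real (time_bound k n m) \<le> real (cost_factor k) * work k n m * (1 + log 2 (real n)) ^ (k + 1)"
    unfolding time_bound_def by (simp add: log_factor_def)
qed

lemma (in row_input) main_cost_less_time_bound:
  assumes edges: "n \<le> m + 1" and q_eq: "q = row_len k n"
  shows "main_cost k + 1 \<le> time_bound k n m"
proof -
  let ?L = "log_factor n" and ?W = "work k n m"
  define P where "P = ?W * ?L ^ (k + 1)"
  have work_ge: "1 \<le> ?W" "real n \<le> ?W" using work_ge[OF n_pos edges] by simp_all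
  have "?W * 1 \<le> P" "?W * ?L \<le> P"
    unfolding P_def using work_ge(1) log_factor_ge_1[OF n_pos] power_increasing[of 1 "k + 1" ?L]
    by (intro mult_left_mono one_le_power; simp)+
  then have P_ge: "1 \<le> P" "real n \<le> P" "?W * ?L \<le> P" using work_ge by simp_all
  have "real (floorlog 2 n) * real (guess_cost k max_hitters)
      \<le> ?L * (((15 * real k + 100) * 10 ^ k + 40) * (?W * ?L ^ k))"
    using floorlog_le_log_factor[OF n_pos] guess_cost_le[OF edges q_eq] log_factor_ge_1[OF n_pos]
    by (intro mult_mono) auto
  then have search: "real (floorlog 2 n) * real (guess_cost k max_hitters)
      \<le> ((15 * real k + 100) * 10 ^ k + 40) * P"
    unfolding P_def power_add power_one_right by (simp only: ac_simps)
  have "real (6 * k + 12) * real n + real (6 * k + 8) \<le> real (6 * k + 12) * P + real (6 * k + 8) * P"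
    using P_ge mult_left_mono[of 1 P "real (6 * k + 8)"] by (intro add_mono mult_left_mono) auto
  then have padding: "real k * (real (6 * k + 12) * real n + real (6 * k + 8))
      \<le> real k * ((12 * real k + 20) * P)"
    by (intro mult_left_mono) (simp_all add: algebra_simps)
  have "real (main_cost k + 1) = 18 * real n + real preprocess_cost
      + real (floorlog 2 n) * real (guess_cost k max_hitters)
      + real k * (real (6 * k + 12) * real n + real (6 * k + 8)) + 13 * real k + 31"
    by (simp add: main_cost_def algebra_simps)
  also have "\<dots> \<le> 18 * P + 1066 * P + ((15 * real k + 100) * 10 ^ k + 40) * P
      + real k * ((12 * real k + 20) * P)
      + 13 * real k * P + 31 * P"
    using search padding P_ge preprocess_cost_le[OF edges, of k] mult_left_mono[of 1 P "13 * real k"]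
    by (intro add_mono) auto
  also have "\<dots> \<le> real (cost_factor k) * P"
    using P_ge(1) by (simp add: cost_factor_def algebra_simps)
  finally show ?thesis unfolding time_bound_def by (intro le_nat_floor) (simp add: P_def mult.assoc)
qed

section \<open>The theorem\<close>

definition program :: "nat \<Rightarrow> instr list" where
  "program k = compile (main k) @ [Move 0 (vreg Result)]"

lemma (in machine) run_program:
  assumes "wp c (\<lambda>_. Q) T \<sigma> \<alpha>" "simulates r \<sigma> \<alpha>" "T + 1 \<le> T'"
  shows "\<exists>r' \<sigma>' \<alpha>'. simulates r' \<sigma>' \<alpha>' \<and> Q \<sigma>' \<alpha>' \<and>
    run w T' (compile c @ [Move 0 (vreg x)], r) = return_pmf ([], set_reg 0 (\<sigma>' x) r')"
proof -
  obtain t \<sigma>' \<alpha>' where run: "exec c \<sigma> \<alpha> t \<sigma>' \<alpha>'" "t \<le> T" "Q \<sigma>' \<alpha>'" using assms(1) unfolding wp_def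
    by blast
  obtain r' where result: "simulates r' \<sigma>' \<alpha>'"
    "run w t (compile c @ [Move 0 (vreg x)], r) = return_pmf ([Move 0 (vreg x)], r')"
    using run_compile[OF run(1) assms(2)] by blast
  have "run w 1 ([Move 0 (vreg x)], r') = return_pmf ([], set_reg 0 (\<sigma>' x) r')"
    using result(1) by (simp only: run_1) (simp add: simulates_def)
  then have "run w (t + (1 + (T' - (t + 1)))) (compile c @ [Move 0 (vreg x)], r)
      = return_pmf ([], set_reg 0 (\<sigma>' x) r')"
    by (rule run_trans[OF result(2) run_trans[OF _ run_halted]])
  then show ?thesis using result(1) run(2,3) assms(3) by auto
qed

lemma (in graph_input) simulates_input:
  "simulates (input_state n es) (\<lambda>_. 0) (\<lambda>a i j. mem (input_state n es) (addr a i j))"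
  by (simp add: simulates_def) (simp add: input_state_def m_eq)

lemma (in graph_input) mem_input_state:
  "e < 2 * m \<Longrightarrow> mem (input_state n es) (addr Ends 0 e) = ep e" "mem (input_state n es) (addr Head 0 v) = 0"
  by (simp_all add: addr_def block_def input_state_def ep_def flip: m_eq)

lemma (in row_input) run_program_correct:
  assumes k_bounds: "1 \<le> k" "k \<le> n" and edges: "n \<le> m + 1" and q_eq: "q = row_len k n"
  shows "\<exists>r. run w (time_bound k n m) (program k, input_state n es) = return_pmf ([], r) \<and>
    k_center_approx (2 - 1 / (2 * real k - 1)) (1 - 1 / (2 * real k - 1)) n E k
      (output_value ([], r)) (output_centers k ([], r))"
proof -
  let ?\<alpha> = "\<lambda>a i j. mem (input_state n es) (addr a i j)"
  have "wp (main k) (\<lambda>_ \<sigma>' \<alpha>'. k_center_approx (2 - 1 / (2 * real k - 1)) (1 - 1 / (2 * real k - 1)) n E k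
      (decode_radius (\<sigma>' Result)) (\<alpha>' Ends 0 ` {..<k})) (main_cost k) (\<lambda>_. 0) ?\<alpha>"
    by (rule wp_main) (use k_bounds q_eq in \<open>simp_all add: mem_input_state\<close>)
  from run_program[OF this simulates_input main_cost_less_time_bound[OF edges q_eq], of Result]
  obtain r \<sigma> \<alpha> where final: "simulates r \<sigma> \<alpha>"
    "k_center_approx (2 - 1 / (2 * real k - 1)) (1 - 1 / (2 * real k - 1)) n E k
      (decode_radius (\<sigma> Result)) (\<alpha> Ends 0 ` {..<k})"
    "run w (time_bound k n m) (program k, input_state n es) = return_pmf ([], set_reg 0 (\<sigma> Result) r)"
    unfolding program_def by blast
  have "mem r (addr Ends 0 l) = \<alpha> Ends 0 l" if "l < k" for l
    using final(1) that k_bounds(2) by (simp add: simulates_def)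
  then have "mem r ` {..<k} = \<alpha> Ends 0 ` {..<k}" by (intro image_cong) (auto simp: addr_def)
  then show ?thesis
    using final(2,3) by (auto simp: output_value_def output_centers_def decode_radius_def set_reg_def)
qed

lemma word_length_suffices:
  assumes "1 \<le> n" "m \<le> n * n"
  shows "100 * (n * n + n + m + 1) \<le> 2 ^ (12 * floorlog 2 n)"
proof -
  define b where "b = (2 :: nat) ^ floorlog 2 n"
  have "n < b" unfolding b_def using floorlog_bounds[of n 2] assms by simp
  then have "n * n \<le> b ^ 2" "2 \<le> b" using assms by (auto simp: power2_eq_square intro!: mult_le_mono)
  moreover have "2 ^ 10 \<le> b ^ 10" using \<open>2 \<le> b\<close> by (intro power_mono) auto
  ultimately have "2 ^ 10 * (n * n) \<le> b ^ 10 * b ^ 2" by (intro mult_le_mono)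
  also have "\<dots> = 2 ^ (12 * floorlog 2 n)"
    unfolding b_def by (simp add: power_mult[symmetric] power_add[symmetric] mult.commute)
  finally have "1024 * (n * n) \<le> 2 ^ (12 * floorlog 2 n)" by simp
  moreover have "1 * n \<le> n * n" "1 * 1 \<le> n * n" using assms(1) by (intro mult_le_mono; simp)+
  ultimately show ?thesis using assms(2) unfolding distrib_left mult_1 by linarith
qed

lemma length_edge_listing: "edge_listing E es \<Longrightarrow> length es = card E"
  using distinct_card[of "map (\<lambda>(u, v). {u, v}) es"] by (simp add: edge_listing_def)

lemma program_solves_k_center:
  assumes k_pos: "1 \<le> k"
  shows "solves_k_center_whp (program k) 12 (time_bound k) 1 k (2 - 1 / (2 * real k - 1))
      (1 - 1 / (2 * real k - 1))"
  unfolding solves_k_center_whp_def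
proof (intro allI impI)
  fix n E es
  assume input: "simple_graph n E \<and> k \<le> n \<and> n \<le> card E + 1 \<and> edge_listing E es"
  have n_pos: "1 \<le> n" using input k_pos by simp
  interpret finite_graph n E using input n_pos by unfold_locales auto
  interpret row_input n E "card E" "12 * floorlog 2 n" es "row_len k n"
    using input n_pos word_length_suffices[OF n_pos card_edges_le] length_edge_listing[of E es]
      row_len_bounds[OF n_pos, of k]
    by unfold_locales auto
  obtain r where "run (12 * floorlog 2 n) (time_bound k n (card E)) (program k, input_state n es)
      = return_pmf ([], r)"
    "k_center_approx (2 - 1 / (2 * real k - 1)) (1 - 1 / (2 * real k - 1)) n E k
      (output_value ([], r)) (output_centers k ([], r))"
    using run_program_correct input k_pos by blast
  then show "let D = run (12 * floorlog 2 n) (time_bound k n (card E)) (program k, input_state n es) in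
      (\<forall>cf\<in>set_pmf D. halted cf) \<and>
      measure_pmf.prob D {cf. k_center_approx (2 - 1 / (2 * real k - 1)) (1 - 1 / (2 * real k - 1)) n E k
        (output_value cf) (output_centers k cf)} \<ge> 1 - 1 / real n powr 1"
    by (simp add: halted_def)
qed

theorem mainTheorem9:
  fixes k :: nat
  assumes "k \<ge> 1"
  shows "\<exists>(P :: instr list) (\<kappa> :: nat) (T :: nat \<Rightarrow> nat \<Rightarrow> nat) (c :: real).
    \<kappa> \<ge> 2 \<and> c > 0 \<and>
    T \<in> soft_O (\<lambda>n m. real m * real n + real n powr (real k / 2 + 1)) \<and>
    solves_k_center_whp P \<kappa> T c k
      (2 - 1 / (2 * real k - 1)) (1 - 1 / (2 * real k - 1))"
proof (intro exI conjI)
  show "(2 :: nat) \<le> 12" "(0 :: real) < 1" by simp_all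
  show "time_bound k \<in> soft_O (\<lambda>n m. real m * real n + real n powr (real k / 2 + 1))"
    using time_bound_soft_O by (simp add: work_def[abs_def])
  show "solves_k_center_whp (program k) 12 (time_bound k) 1 k (2 - 1 / (2 * real k - 1))
      (1 - 1 / (2 * real k - 1))"
    using assms by (rule program_solves_k_center)
qed

end
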